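(* The reachability problem for permutation $\mathbb Z$-VASS is PSPACE-hard.
   Context: An affine $\mathbb Z$-VASS is $\mathcal V=(d,Q,T)$ with $Q$ finite and $T\subseteq Q\times\mathbb Z^{d\times d}\times\mathbb Z^d\times Q$ finite; configurations are $q(\mathbf v)\in Q\times\mathbb Z^d$; $p(\mathbf u)\xrightarrow{t}q(\mathbf v)$ iff $t=(p,A,\mathbf b,q)\in T$ and $\mathbf v=A\mathbf u+\mathbf b$; $\xrightarrow{*}$ is the reflexive-transitive closure of the union of these relations. A permutation matrix is a matrix in $\{0,1\}^{d\times d}$ with exactly one $1$ in each row and each column; a permutation $\mathbb Z$-VASS is an affine $\mathbb Z$-VASS all of whose transition matrices are permutation matrices. The reachability problem: given such $\mathcal V$ and configurations $p(\mathbf u),q(\mathbf v)$ (numbers in binary), decide whether $p(\mathbf u)\xrightarrow{*}q(\mathbf v)$. *)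

theory Defs
  imports "Jordan_Normal_Form.Matrix" "HOL-Computational_Algebra.Polynomial"
begin

section \<open>Affine and permutation \<open>\<int>\<close>-VASS\<close>

type_synonym 'q transition = "'q \<times> int mat \<times> int vec \<times> 'q"
type_synonym 'q zvass = "nat \<times> 'q set \<times> 'q transition set"
type_synonym 'q configuration = "'q \<times> int vec"

definition affine_zvass :: "'q zvass \<Rightarrow> bool" where
  "affine_zvass = (\<lambda>(d, Q, T). finite Q \<and> finite T \<and>
     T \<subseteq> Q \<times> carrier_mat d d \<times> carrier_vec d \<times> Q)"

definition configurations :: "'q zvass \<Rightarrow> 'q configuration set" where
  "configurations = (\<lambda>(d, Q, T). Q \<times> carrier_vec d)"

definition transition_rel ::
    "'q zvass \<Rightarrow> 'q transition \<Rightarrow> ('q configuration \<times> 'q configuration) set" where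
  "transition_rel V = (\<lambda>(p, A, b, q).
     {((p, u), (q, v)) | u v. (p, u) \<in> configurations V \<and> v = A *\<^sub>v u + b})"

definition step_rel :: "'q zvass \<Rightarrow> ('q configuration \<times> 'q configuration) set" where
  "step_rel V = (\<Union>t \<in> snd (snd V). transition_rel V t)"

definition permutation_matrix :: "nat \<Rightarrow> int mat \<Rightarrow> bool" where
  "permutation_matrix d A \<longleftrightarrow> A \<in> carrier_mat d d \<and>
     (\<forall>i<d. \<forall>j<d. A $$ (i, j) \<in> {0, 1}) \<and>
     (\<forall>i<d. \<exists>!j. j < d \<and> A $$ (i, j) = 1) \<and>
     (\<forall>j<d. \<exists>!i. i < d \<and> A $$ (i, j) = 1)"

definition permutation_zvass :: "'q zvass \<Rightarrow> bool" where
  "permutation_zvass V \<longleftrightarrow> affine_zvass V \<and>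
     (\<forall>(p, A, b, q) \<in> snd (snd V). permutation_matrix (fst V) A)"


section \<open>Instances as binary strings\<close>

text \<open>Control states are named by natural numbers and finite sets are given by listing their
  elements. All numbers are written in binary, least significant digit first, without
  superfluous zeros. Lists are made self-delimiting by a bit in front of every element (and
  at the end) that tells whether a further element follows.\<close>

fun binary_digits :: "nat \<Rightarrow> bool list" where
  "binary_digits n = (if n = 0 then [] else odd n # binary_digits (n div 2))"

declare binary_digits.simps [simp del]

definition enc_list :: "('a \<Rightarrow> bool list) \<Rightarrow> 'a list \<Rightarrow> bool list" where
  "enc_list e xs = concat (map (\<lambda>x. True # e x) xs) @ [False]"

definition enc_nat :: "nat \<Rightarrow> bool list" where
  "enc_nat n = enc_list (\<lambda>b. [b]) (binary_digits n)"

definition enc_int :: "int \<Rightarrow> bool list" where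
  "enc_int z = (z < 0) # enc_nat (nat \<bar>z\<bar>)"

definition enc_vec :: "int vec \<Rightarrow> bool list" where
  "enc_vec v = enc_list enc_int (list_of_vec v)"

definition enc_mat :: "int mat \<Rightarrow> bool list" where
  "enc_mat A = enc_list (enc_list enc_int) (mat_to_list A)"

definition enc_transition :: "nat transition \<Rightarrow> bool list" where
  "enc_transition = (\<lambda>(p, A, b, q). enc_nat p @ enc_mat A @ enc_vec b @ enc_nat q)"

definition enc_configuration :: "nat configuration \<Rightarrow> bool list" where
  "enc_configuration = (\<lambda>(p, u). enc_nat p @ enc_vec u)"

definition enc_instance ::
    "nat \<Rightarrow> nat list \<Rightarrow> nat transition list \<Rightarrow> nat configuration \<Rightarrow> nat configuration \<Rightarrow> bool list"
where
  "enc_instance d Qs Ts c c' =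
     enc_nat d @ enc_list enc_nat Qs @ enc_list enc_transition Ts @
     enc_configuration c @ enc_configuration c'"

definition permutation_zvass_reachability :: "bool list set" where
  "permutation_zvass_reachability =
     {enc_instance d Qs Ts c c' | d Qs Ts c c'.
        permutation_zvass (d, set Qs, set Ts) \<and>
        c \<in> configurations (d, set Qs, set Ts) \<and>
        c' \<in> configurations (d, set Qs, set Ts) \<and>
        (c, c') \<in> (step_rel (d, set Qs, set Ts))\<^sup>*}"

text \<open>The encoding is uniquely readable, so that the language above is not affected by two
  different instances sharing a code.\<close>

definition prefix_free_on :: "'a set \<Rightarrow> ('a \<Rightarrow> bool list) \<Rightarrow> bool" where
  "prefix_free_on S e \<longleftrightarrow>
     (\<forall>x\<in>S. \<forall>y\<in>S. \<forall>r s. e x @ r = e y @ s \<longrightarrow> x = y \<and> r = s)"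

lemma prefix_free_onD:
  "prefix_free_on S e \<Longrightarrow> e x @ r = e y @ s \<Longrightarrow> x \<in> S \<Longrightarrow> y \<in> S \<Longrightarrow> x = y \<and> r = s"
  unfolding prefix_free_on_def by blast

lemma prefix_free_enc_list:
  assumes e: "prefix_free_on S e"
  shows "prefix_free_on (lists S) (enc_list e)"
proof -
  have "xs = ys \<and> r = s"
    if "enc_list e xs @ r = enc_list e ys @ s" "xs \<in> lists S" "ys \<in> lists S" for xs ys r s
    using that
  proof (induction xs arbitrary: ys)
    case Nil
    then show ?case by (cases ys) (auto simp: enc_list_def)
  next
    case (Cons x xs)
    then obtain y ys' where ys: "ys = y # ys'" by (cases ys) (auto simp: enc_list_def)
    have "e x @ (enc_list e xs @ r) = e y @ (enc_list e ys' @ s)"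
      using Cons.prems(1) by (simp add: ys enc_list_def)
    then have "x = y \<and> enc_list e xs @ r = enc_list e ys' @ s"
      using prefix_free_onD[OF e] Cons.prems(2,3) ys by auto
    then show ?case using Cons.IH[of ys'] Cons.prems(2,3) ys by auto
  qed
  then show ?thesis unfolding prefix_free_on_def by blast
qed

lemma binary_digits_inj: "binary_digits m = binary_digits n \<Longrightarrow> m = n"
proof (induction m arbitrary: n rule: less_induct)
  case (less m)
  show ?case
  proof (cases "m = 0 \<or> n = 0")
    case True
    then show ?thesis using less.prems
      by (auto simp: binary_digits.simps[of m] binary_digits.simps[of n] split: if_splits)
  next
    case False
    then have eq: "odd m = odd n" "binary_digits (m div 2) = binary_digits (n div 2)"
      using less.prems binary_digits.simps[of m] binary_digits.simps[of n] by auto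
    then have "m div 2 = n div 2" using less.IH[of "m div 2"] False by simp
    then show ?thesis using eq(1) by presburger
  qed
qed

lemma prefix_free_enc_nat: "prefix_free_on UNIV enc_nat"
proof -
  have "prefix_free_on (lists UNIV) (enc_list (\<lambda>b::bool. [b]))"
    by (rule prefix_free_enc_list) (auto simp: prefix_free_on_def)
  then show ?thesis
    unfolding prefix_free_on_def enc_nat_def using binary_digits_inj by blast
qed

lemma prefix_free_enc_int: "prefix_free_on UNIV enc_int"
proof -
  have "x = y \<and> r = s" if "enc_int x @ r = enc_int y @ s" for x y r s
  proof -
    have "enc_nat (nat \<bar>x\<bar>) @ r = enc_nat (nat \<bar>y\<bar>) @ s" "(x < 0) = (y < 0)"
      using that by (auto simp: enc_int_def)
    then show ?thesis using prefix_free_onD[OF prefix_free_enc_nat] by (smt (verit) UNIV_I eq_nat_nat_iff)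
  qed
  then show ?thesis unfolding prefix_free_on_def by blast
qed

lemma list_of_vec_inj: "list_of_vec v = list_of_vec w \<Longrightarrow> v = w"
  by (metis vec_list)

lemma prefix_free_enc_vec: "prefix_free_on UNIV enc_vec"
  using prefix_free_enc_list[OF prefix_free_enc_int] list_of_vec_inj
  unfolding prefix_free_on_def enc_vec_def by (metis UNIV_I lists_UNIV)

lemma mat_to_list_inj:
  assumes "A \<in> carrier_mat d d" "B \<in> carrier_mat d d" "mat_to_list A = mat_to_list B"
  shows "A = B"
proof (rule eq_matI)
  fix i j assume "i < dim_row B" "j < dim_col B"
  moreover have "mat_to_list A ! i ! j = mat_to_list B ! i ! j" using assms(3) by simp
  ultimately show "A $$ (i, j) = B $$ (i, j)" using assms(1,2) by (simp add: mat_to_list_def)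
qed (use assms in auto)

lemma prefix_free_enc_mat: "prefix_free_on (carrier_mat d d) enc_mat"
proof -
  have "prefix_free_on UNIV (enc_list (enc_list enc_int))"
    using prefix_free_enc_list[OF prefix_free_enc_list[OF prefix_free_enc_int]] by simp
  then show ?thesis
    unfolding prefix_free_on_def enc_mat_def using mat_to_list_inj by blast
qed

lemma prefix_free_on_cancel:
  "prefix_free_on S e \<Longrightarrow> x \<in> S \<Longrightarrow> y \<in> S \<Longrightarrow> e x @ r = e y @ s \<longleftrightarrow> x = y \<and> r = s"
  unfolding prefix_free_on_def by blast

lemmas enc_cancel =
  prefix_free_on_cancel[OF prefix_free_enc_nat UNIV_I UNIV_I]
  prefix_free_on_cancel[OF prefix_free_enc_vec UNIV_I UNIV_I]
  prefix_free_on_cancel[OF prefix_free_enc_mat]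

lemma prefix_free_enc_transition:
  "prefix_free_on (UNIV \<times> carrier_mat d d \<times> UNIV \<times> UNIV) enc_transition"
  unfolding prefix_free_on_def enc_transition_def by (auto simp: enc_cancel)

lemma prefix_free_enc_configuration: "prefix_free_on UNIV enc_configuration"
  unfolding prefix_free_on_def enc_configuration_def by (auto simp: enc_cancel)

lemma enc_instance_inj:
  assumes "affine_zvass (d, set Qs, set Ts)" "affine_zvass (d', set Qs', set Ts')"
    and eq: "enc_instance d Qs Ts c1 c2 = enc_instance d' Qs' Ts' c1' c2'"
  shows "d = d' \<and> Qs = Qs' \<and> Ts = Ts' \<and> c1 = c1' \<and> c2 = c2'"
proof -
  have d: "d = d'"
    using eq by (simp add: enc_instance_def enc_cancel(1))
  have Ts: "Ts \<in> lists (UNIV \<times> carrier_mat d d \<times> UNIV \<times> UNIV)"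
    "Ts' \<in> lists (UNIV \<times> carrier_mat d d \<times> UNIV \<times> UNIV)"
    using assms(1,2) d unfolding affine_zvass_def by fastforce+
  have "enc_instance d Qs Ts c1 c2 @ [] = enc_instance d' Qs' Ts' c1' c2' @ []"
    using eq by simp
  then show ?thesis
    unfolding enc_instance_def append_assoc
      enc_cancel(1)
      prefix_free_on_cancel[OF prefix_free_enc_list[OF prefix_free_enc_nat, unfolded lists_UNIV] UNIV_I UNIV_I]
      prefix_free_on_cancel[OF prefix_free_enc_list[OF prefix_free_enc_transition] Ts]
      prefix_free_on_cancel[OF prefix_free_enc_configuration UNIV_I UNIV_I]
    by blast
qed


section \<open>Deterministic Turing machines\<close>

text \<open>A machine has tapes that are infinite to the right; the symbols and the control states are
  initial segments of the natural numbers. Symbol 0 is the blank, 1 is the left end marker that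
  initially occupies cell 0 of every tape, and 2 and 3 are the input and output symbols for the
  two bits. The transition function maps a state and the list of scanned symbols to a new state
  and, for every tape, the symbol to be written and the head movement.\<close>

datatype move = Left | Stay | Right

record tm =
  tapes :: nat
  symbols :: nat
  states :: nat
  start :: nat
  accept :: nat
  reject :: nat
  delta :: "nat \<Rightarrow> nat list \<Rightarrow> nat \<times> (nat \<times> move) list"

definition turing_machine :: "tm \<Rightarrow> bool" where
  "turing_machine M \<longleftrightarrow>
     tapes M \<ge> 1 \<and> symbols M \<ge> 4 \<and>
     start M < states M \<and> accept M < states M \<and> reject M < states M \<and> accept M \<noteq> reject M \<and>
     (\<forall>q < states M. \<forall>as. length as = tapes M \<and> set as \<subseteq> {..<symbols M} \<longrightarrow>
        (case delta M q as of (q', acts) \<Rightarrow>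
           q' < states M \<and> length acts = tapes M \<and> fst ` set acts \<subseteq> {..<symbols M}))"

text \<open>A tape is given by its contents and the position of the head.\<close>

type_synonym tape = "(nat \<Rightarrow> nat) \<times> nat"
type_synonym tm_config = "nat \<times> tape list"

fun move_head :: "move \<Rightarrow> nat \<Rightarrow> nat" where
  "move_head Left i = i - 1"
| "move_head Stay i = i"
| "move_head Right i = i + 1"

fun act :: "tape \<Rightarrow> nat \<times> move \<Rightarrow> tape" where
  "act (f, i) (a, m) = (f(i := a), move_head m i)"

definition halted :: "tm \<Rightarrow> tm_config \<Rightarrow> bool" where
  "halted M c \<longleftrightarrow> fst c \<in> {accept M, reject M}"

definition tm_step :: "tm \<Rightarrow> tm_config \<Rightarrow> tm_config" where
  "tm_step M c =
     (if halted M c then c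
      else case delta M (fst c) (map (\<lambda>(f, i). f i) (snd c)) of
        (q', acts) \<Rightarrow> (q', map2 act (snd c) acts))"

definition tape_contents :: "bool list \<Rightarrow> nat \<Rightarrow> nat" where
  "tape_contents w i =
     (if i = 0 then 1
      else if i \<le> length w then (if w ! (i - 1) then 3 else 2)
      else 0)"

definition initial_config :: "tm \<Rightarrow> bool list \<Rightarrow> tm_config" where
  "initial_config M w =
     (start M, (tape_contents w, 0) # replicate (tapes M - 1) (tape_contents [], 0))"

definition tm_run :: "tm \<Rightarrow> bool list \<Rightarrow> nat \<Rightarrow> tm_config" where
  "tm_run M w t = (tm_step M ^^ t) (initial_config M w)"

definition computes_in_time :: "tm \<Rightarrow> (bool list \<Rightarrow> bool list) \<Rightarrow> (nat \<Rightarrow> nat) \<Rightarrow> bool" where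
  "computes_in_time M f T \<longleftrightarrow>
     (\<forall>w. \<exists>t \<le> T (length w). halted M (tm_run M w t) \<and>
        fst (last (snd (tm_run M w t))) = tape_contents (f w))"

text \<open>A head starts at cell 0 and moves by at most one cell per step, so all its positions are
  below \<open>s\<close> iff at most \<open>s\<close> cells of its tape are visited.\<close>

definition decides_in_space :: "tm \<Rightarrow> bool list set \<Rightarrow> (nat \<Rightarrow> nat) \<Rightarrow> bool" where
  "decides_in_space M L S \<longleftrightarrow>
     (\<forall>w. (\<exists>t. fst (tm_run M w t) = (if w \<in> L then accept M else reject M)) \<and>
          (\<forall>t. \<forall>(f, i) \<in> set (snd (tm_run M w t)). i < S (length w)))"


section \<open>PSPACE-hardness\<close>

text \<open>PSPACE is defined by one-tape machines, which does not affect the class; reductions are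
  many-one reductions computed by multi-tape machines that read the input on the first tape and
  leave the output alone on the last one.\<close>

definition PSPACE :: "bool list set set" where
  "PSPACE = {L. \<exists>M (p :: nat poly). turing_machine M \<and> tapes M = 1 \<and> decides_in_space M L (poly p)}"

definition polynomial_time_computable :: "(bool list \<Rightarrow> bool list) \<Rightarrow> bool" where
  "polynomial_time_computable f \<longleftrightarrow>
     (\<exists>M (p :: nat poly). turing_machine M \<and> computes_in_time M f (poly p))"

definition polynomial_time_reducible :: "bool list set \<Rightarrow> bool list set \<Rightarrow> bool" where
  "polynomial_time_reducible L L' \<longleftrightarrow>
     (\<exists>f. polynomial_time_computable f \<and> (\<forall>w. w \<in> L \<longleftrightarrow> f w \<in> L'))"

definition PSPACE_hard :: "bool list set \<Rightarrow> bool" where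
  "PSPACE_hard L' \<longleftrightarrow> (\<forall>L \<in> PSPACE. polynomial_time_reducible L L')"

end

theory Submission
  imports Defs
begin

text \<open>A one-tape machine that visits fewer than \<open>S\<close> cells is simulated by a finite automaton that
  sweeps over a cyclic word of \<open>S\<close> letters, one of which is a separator. The word is stored in
  \<open>S\<close> blocks of counters, one counter per letter, with a token at the current letter; replacing the
  first letter of the word and moving on to the next one is a permutation of the counters, the same
  for all positions. A guess of the letter is verified by an increment at the guessed place: until
  the final phase the counters never decrease, so that a wrong guess leaves a positive counter
  without a token, which cannot be removed any more, because the final phase only decrements the
  counters for one fixed letter. Reachability of the zero vector therefore means that all guesses
  were correct.

  The number of transitions is independent of the input, and the matrices are so uniform that a
  multi-tape machine prints them by passes over a tape of \<open>S\<close> cells. Such a machine is obtained from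
  a while program, whose continuations are the control states.\<close>


section \<open>Sweeping automata on cyclic words\<close>

text \<open>A transition of a Z-VASS is enabled at every vector, so a letter cannot be tested when
  it is read; the only test of a whole run is the comparison with the target vector. All checks are
  postponed to it, and the difficulty is to make errors persist: a transposition of letters is
  injective, so it never moves a misplaced unit under the token, and without decrements no such unit
  is cancelled. The values at the tokens are not controlled, as they grow with every visit. This is
  why an accepting run ends with a round that writes letter 0 everywhere: afterwards a single fixed
  letter has to be emptied, by decrements that touch no other letter. Control states and letters
  depend only on the machine, so the position in the word must be carried by the vector; hence the
  rotation. The length \<open>S\<close> is a power of n + 2, where n is the length of the input:
  such powers bound every polynomial and arise from 1 by repeated multiplication, for which the
  input tape itself provides the factor.\<close>

type_synonym 'q rule = "'q \<times> nat \<times> nat \<times> 'q"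

definition sweep :: "'q rule set \<Rightarrow> nat \<Rightarrow> (('q \<times> (nat \<Rightarrow> nat) \<times> nat) \<times> ('q \<times> (nat \<Rightarrow> nat) \<times> nat)) set" where
  "sweep R S = {((q, X, m), (q', X(m := c), Suc m mod S)) | q X m c q'. (q, X m, c, q') \<in> R}"

lemma sweepI: "(q, X m, c, q') \<in> R \<Longrightarrow> ((q, X, m), (q', X(m := c), Suc m mod S)) \<in> sweep R S"
  unfolding sweep_def by blast

lemma sweep_stepI:
  assumes "(c0, (q, X, m)) \<in> (sweep R S)\<^sup>*" "(q, a, c, q') \<in> R" "X m = a" "Y = X(m := c)" "m' = Suc m mod S"
  shows "(c0, (q', Y, m')) \<in> (sweep R S)\<^sup>*"
proof -
  have "((q, X, m), (q', Y, m')) \<in> sweep R S" using sweepI[of q X m c q' R S] assms by simp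
  with assms(1) show ?thesis by (rule rtrancl_into_rtrancl)
qed

section \<open>The sweeping automaton of a one-tape machine\<close>

definition reachable :: "tm \<Rightarrow> bool list \<Rightarrow> nat \<Rightarrow> (nat \<Rightarrow> nat) \<Rightarrow> nat \<Rightarrow> bool" where
  "reachable M w q f i \<longleftrightarrow> (\<exists>t. tm_run M w t = (q, [(f, i)]))"

definition trans1 :: "tm \<Rightarrow> nat \<Rightarrow> nat \<Rightarrow> nat \<times> nat \<times> move" where
  "trans1 M q a = (fst (delta M q [a]), hd (snd (delta M q [a])))"

text \<open>The letters are the symbols \<open>a\<close>, the symbols \<open>symbols M + a\<close> under the head, and the
  separator \<open>2 * symbols M\<close> in front of cell 0. A head that moves left reaches a cell that
  has already been passed, so the automaton guesses such a move one position in advance.\<close>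

datatype control = Sweep nat | FromLeft nat | ToLeft nat | AtStart nat | Clean

text \<open>A letter that no rule accepts blocks the run, and this is how guesses are checked:
  \<open>left1\<close> marks a cell before the head has been seen, and \<open>left2\<close> demands
  the head at the very next letter. \<open>idle\<close> applies everywhere, so the head may be
  ignored for any number of rounds. At cell 0, recognised by the separator in front of it, a left
  move leaves the head in place, as \<open>move_head\<close> does; \<open>start2\<close> treats this
  case.\<close>

inductive_set sweep_rules :: "tm \<Rightarrow> control rule set" for M where
  idle: "q < states M \<Longrightarrow> c \<le> 2 * symbols M \<Longrightarrow> (Sweep q, c, c, Sweep q) \<in> sweep_rules M"
| stay: "q < states M \<Longrightarrow> a < symbols M \<Longrightarrow> q \<notin> {accept M, reject M} \<Longrightarrow> trans1 M q a = (q', b, Stay) \<Longrightarrow>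
    (Sweep q, symbols M + a, symbols M + b, Sweep q') \<in> sweep_rules M"
| right1: "q < states M \<Longrightarrow> a < symbols M \<Longrightarrow> q \<notin> {accept M, reject M} \<Longrightarrow> trans1 M q a = (q', b, Right) \<Longrightarrow>
    (Sweep q, symbols M + a, b, FromLeft q') \<in> sweep_rules M"
| right2: "q < states M \<Longrightarrow> c < symbols M \<Longrightarrow> (FromLeft q, c, symbols M + c, Sweep q) \<in> sweep_rules M"
| left1: "q < states M \<Longrightarrow> c < symbols M \<Longrightarrow> (Sweep q, c, symbols M + c, ToLeft q) \<in> sweep_rules M"
| left2: "q < states M \<Longrightarrow> a < symbols M \<Longrightarrow> q \<notin> {accept M, reject M} \<Longrightarrow> trans1 M q a = (q', b, Left) \<Longrightarrow>
    (ToLeft q, symbols M + a, b, Sweep q') \<in> sweep_rules M"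
| start1: "q < states M \<Longrightarrow> (Sweep q, 2 * symbols M, 2 * symbols M, AtStart q) \<in> sweep_rules M"
| start2: "q < states M \<Longrightarrow> a < symbols M \<Longrightarrow> q \<notin> {accept M, reject M} \<Longrightarrow> trans1 M q a = (q', b, Left) \<Longrightarrow>
    (AtStart q, symbols M + a, symbols M + b, Sweep q') \<in> sweep_rules M"
| clean1: "c \<le> 2 * symbols M \<Longrightarrow> (Sweep (accept M), c, 0, Clean) \<in> sweep_rules M"
| clean2: "c \<le> 2 * symbols M \<Longrightarrow> (Clean, c, 0, Clean) \<in> sweep_rules M"

text \<open>Cell \<open>x\<close> lies at position \<open>x + 1\<close>, behind the separator, so a
  head in cell \<open>i\<close> needs \<open>i + 1 < S\<close>.\<close>

definition plain_word :: "tm \<Rightarrow> (nat \<Rightarrow> nat) \<Rightarrow> nat \<Rightarrow> nat" where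
  "plain_word M f = (\<lambda>x. if x = 0 then 2 * symbols M else f (x - 1))"

definition tape_word :: "tm \<Rightarrow> (nat \<Rightarrow> nat) \<Rightarrow> nat \<Rightarrow> nat \<Rightarrow> nat" where
  "tape_word M f i = (plain_word M f)(Suc i := symbols M + f i)"

lemma plain_word_upd: "plain_word M (f(i := b)) = (plain_word M f)(Suc i := b)"
  by (auto simp: plain_word_def fun_eq_iff)

section \<open>The sweeping automaton follows the machine\<close>

locale one_tape_machine =
  fixes M :: tm
  assumes M: "turing_machine M" and one: "tapes M = 1"
begin

lemma delta1:
  assumes "q < states M" "a < symbols M"
  obtains q' b m where "delta M q [a] = (q', [(b, m)])" "trans1 M q a = (q', b, m)"
    "q' < states M" "b < symbols M"
proof -
  obtain q' acts where d: "delta M q [a] = (q', acts)" by force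
  have "\<forall>q < states M. \<forall>as. length as = tapes M \<and> set as \<subseteq> {..<symbols M} \<longrightarrow>
      (case delta M q as of (q', acts) \<Rightarrow>
        q' < states M \<and> length acts = tapes M \<and> fst ` set acts \<subseteq> {..<symbols M})"
    using M unfolding turing_machine_def by (elim conjE)
  from this[rule_format, of q "[a]"] have "case delta M q [a] of (q', acts) \<Rightarrow>
      q' < states M \<and> length acts = tapes M \<and> fst ` set acts \<subseteq> {..<symbols M}"
    using assms one by simp
  then have *: "q' < states M" "length acts = 1" "fst ` set acts \<subseteq> {..<symbols M}"
    using d one by auto
  then obtain b m where "acts = [(b, m)]"
    by (cases acts) auto
  with d * show ?thesis by (intro that[of q' b m]) (auto simp: trans1_def)
qed

lemma run_shape:
  "\<exists>q f i. tm_run M w t = (q, [(f, i)]) \<and> q < states M \<and> (\<forall>x. f x < symbols M)"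
proof (induction t)
  case 0
  have "symbols M \<ge> 4" "start M < states M" using M by (auto simp: turing_machine_def)
  moreover from this have "tape_contents w x < symbols M" for x
    by (simp add: tape_contents_def)
  ultimately show ?case using one by (simp add: tm_run_def initial_config_def)
next
  case (Suc t)
  then obtain q f i where c: "tm_run M w t = (q, [(f, i)])" "q < states M" "\<forall>x. f x < symbols M"
    by blast
  obtain q' b m where d: "delta M q [f i] = (q', [(b, m)])" "trans1 M q (f i) = (q', b, m)"
    "q' < states M" "b < symbols M"
    by (rule delta1[OF c(2) c(3)[rule_format]])
  have "tm_run M w (Suc t) = tm_step M (q, [(f, i)])"
    using c(1) by (simp add: tm_run_def)
  also have "\<dots> = (if q \<in> {accept M, reject M} then (q, [(f, i)]) else (q', [(f(i := b), move_head m i)]))"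
    using d by (simp add: tm_step_def halted_def)
  finally show ?case using c(2,3) d(3,4) by (cases "q \<in> {accept M, reject M}") simp_all
qed

lemma reachable_bounds: "reachable M w q f i \<Longrightarrow> q < states M \<and> (\<forall>x. f x < symbols M)"
proof -
  assume "reachable M w q f i"
  then obtain t where t: "tm_run M w t = (q, [(f, i)])" unfolding reachable_def by blast
  obtain q' f' i' where "tm_run M w t = (q', [(f', i')])" "q' < states M" "\<forall>x. f' x < symbols M"
    using run_shape[of w t] by (elim exE conjE)
  with t show ?thesis by simp
qed

lemma reachable_initial: "reachable M w (start M) (tape_contents w) 0"
  unfolding reachable_def using one by (intro exI[of _ 0]) (simp add: tm_run_def initial_config_def)

lemma reachable_step:
  assumes r: "reachable M w q f i" and q: "q \<notin> {accept M, reject M}"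
    and tr: "trans1 M q (f i) = (q', b, m)"
  shows "reachable M w q' (f(i := b)) (move_head m i)"
proof -
  obtain t where t: "tm_run M w t = (q, [(f, i)])" using r unfolding reachable_def by blast
  note b = reachable_bounds[OF r]
  obtain q2 b2 m2 where "delta M q [f i] = (q2, [(b2, m2)])" "trans1 M q (f i) = (q2, b2, m2)"
    "q2 < states M" "b2 < symbols M"
    by (rule delta1[OF b[THEN conjunct1] b[THEN conjunct2, rule_format]])
  then have "delta M q [f i] = (q', [(b, m)])" using tr by simp
  then have "tm_run M w (Suc t) = (q', [(f(i := b), move_head m i)])"
    using t q by (simp add: tm_run_def tm_step_def halted_def)
  then show ?thesis unfolding reachable_def by blast
qed

text \<open>Every word is tied to a configuration of the actual run, also between the two rules of a
  move. \<open>FromLeft\<close> already stands for the new configuration, whose head mark is still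
  missing and belongs to the letter at the pointer. \<open>ToLeft\<close> still stands for the old
  one, with a premature second mark at a cell \<open>j\<close> that need not be next to the
  head.\<close>

fun sweep_inv :: "nat \<Rightarrow> bool list \<Rightarrow> control \<times> (nat \<Rightarrow> nat) \<times> nat \<Rightarrow> bool" where
  "sweep_inv S w (Sweep q, X, m) = (\<exists>f i. reachable M w q f i \<and> X = tape_word M f i)"
| "sweep_inv S w (FromLeft q, X, m) = (\<exists>f. reachable M w q f (m - 1) \<and> m \<ge> 1 \<and> X = plain_word M f)"
| "sweep_inv S w (ToLeft q, X, m) = (\<exists>f i j. reachable M w q f i \<and> j \<noteq> i \<and> Suc j < S \<and> m = Suc (Suc j) mod S \<and>
     X = (tape_word M f i)(Suc j := symbols M + f j))"
| "sweep_inv S w (AtStart q, X, m) = (\<exists>f i. reachable M w q f i \<and> m = 1 \<and> X = tape_word M f i)"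
| "sweep_inv S w (Clean, X, m) = (\<exists>f i. reachable M w (accept M) f i)"

text \<open>Plain symbols, marked symbols and the separator occupy disjoint ranges of letters, so
  the scanned letter alone locates the pointer relative to the head.\<close>

lemma tape_word_head:
  assumes "reachable M w q f i" "tape_word M f i m = symbols M + a" "a < symbols M"
  shows "m = Suc i \<and> a = f i"
proof -
  have "f (m - 1) < symbols M" using reachable_bounds[OF assms(1)] by blast
  then show ?thesis using assms(2,3) by (auto simp: tape_word_def plain_word_def split: if_splits)
qed

lemma tape_word_plain:
  assumes "reachable M w q f i" "tape_word M f i m = c" "c < symbols M"
  shows "\<exists>j. m = Suc j \<and> j \<noteq> i \<and> c = f j"
proof -
  have "symbols M + f i \<ge> symbols M" by simp
  then have "m \<noteq> Suc i" "m \<noteq> 0" using assms(2,3)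
    by (auto simp: tape_word_def plain_word_def split: if_splits)
  then have "m = Suc (m - 1)" "m - 1 \<noteq> i" "c = f (m - 1)"
    using assms(2) by (auto simp: tape_word_def plain_word_def)
  then show ?thesis by blast
qed

lemma tape_word_separator:
  assumes "reachable M w q f i" "tape_word M f i m = 2 * symbols M"
  shows "m = 0"
proof -
  have "f (m - 1) < symbols M" "f i < symbols M" using reachable_bounds[OF assms(1)] by blast+
  then show ?thesis using assms(2) by (auto simp: tape_word_def plain_word_def split: if_splits)
qed

lemma tape_word_le: "reachable M w q f i \<Longrightarrow> tape_word M f i x \<le> 2 * symbols M"
proof -
  assume "reachable M w q f i"
  then have "f i < symbols M" "f (x - 1) < symbols M" using reachable_bounds by blast+
  then show ?thesis by (simp add: tape_word_def plain_word_def)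
qed

lemma sweep_rotate:
  assumes q: "q < states M" and X: "\<And>x. X x \<le> 2 * symbols M" and m: "m < S" "m' < S"
  shows "((Sweep q, X, m), (Sweep q, X, m')) \<in> (sweep (sweep_rules M) S)\<^sup>*"
proof -
  have "((Sweep q, X, m), (Sweep q, X, (m + j) mod S)) \<in> (sweep (sweep_rules M) S)\<^sup>*" for j
  proof (induction j)
    case (Suc j)
    show ?case
      by (rule sweep_stepI[OF Suc sweep_rules.idle[OF q X]]) (auto simp: mod_Suc_eq)
  qed (use m in simp)
  \<comment> \<open>The summand \<open>S\<close> keeps the truncated subtraction exact when
    \<open>m'\<close> lies before \<open>m\<close>; it vanishes modulo \<open>S\<close>.\<close>
  from this[of "m' + S - m"] show ?thesis using m by simp
qed

definition sweep_init :: "bool list \<Rightarrow> control \<times> (nat \<Rightarrow> nat) \<times> nat" where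
  "sweep_init w = (Sweep (start M), tape_word M (tape_contents w) 0, 0)"

context
  fixes w :: "bool list" and S :: nat
  assumes space: "\<And>q f i. reachable M w q f i \<Longrightarrow> i + 1 < S"
begin

lemma S_ge: "S \<ge> 2"
proof -
  from space[OF reachable_initial] show ?thesis by simp
qed

lemma sweep_inv_step:
  assumes rule: "(q, X m, c, q') \<in> sweep_rules M" and inv: "sweep_inv S w (q, X, m)"
    and m: "m < S"
  shows "sweep_inv S w (q', X(m := c), Suc m mod S)"
  using rule
proof cases
  case (idle q1)
  then show ?thesis using inv by (metis fun_upd_triv sweep_inv.simps(1))
next
  case (stay q1 a q2 b)
  then obtain f i where fi: "reachable M w q1 f i" "X = tape_word M f i" using inv by auto
  then have "m = Suc i" "a = f i" using tape_word_head stay by metis+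
  then have "reachable M w q2 (f(i := b)) i" using reachable_step[OF fi(1)] stay by fastforce
  then show ?thesis using stay fi \<open>m = Suc i\<close>
    by (auto simp: tape_word_def plain_word_upd intro!: exI[of _ "f(i := b)"] exI[of _ i])
next
  case (right1 q1 a q2)
  then obtain f i where fi: "reachable M w q1 f i" "X = tape_word M f i" using inv by auto
  then have mi: "m = Suc i" "a = f i" using tape_word_head right1 by metis+
  then have r: "reachable M w q2 (f(i := c)) (Suc i)" using reachable_step[OF fi(1)] right1 by fastforce
  \<comment> \<open>The space bound of the successor configuration excludes a wrap-around onto the
    separator.\<close>
  then have "Suc m mod S = Suc (Suc i)" using space[OF r] mi by simp
  then show ?thesis using right1 fi r mi
    by (auto simp: tape_word_def plain_word_upd intro!: exI[of _ "f(i := c)"])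
next
  case (right2 q1)
  then obtain f where f: "reachable M w q1 f (m - 1)" "m \<ge> 1" "X = plain_word M f" using inv by auto
  then have "X m = f (m - 1)" by (simp add: plain_word_def)
  then show ?thesis using right2 f
    by (auto simp: tape_word_def intro!: exI[of _ f] exI[of _ "m - 1"])
next
  case (left1 q1)
  then obtain f i where fi: "reachable M w q1 f i" "X = tape_word M f i" using inv by auto
  then obtain j where "m = Suc j" "j \<noteq> i" "X m = f j"
    using tape_word_plain[of w q1 f i m "X m"] left1 by metis
  then show ?thesis using left1 fi m by auto
next
  case (left2 q1 a q2)
  then obtain f i j where fi: "reachable M w q1 f i" "j \<noteq> i" "m = Suc (Suc j) mod S"
    "X = (tape_word M f i)(Suc j := symbols M + f j)" "Suc j < S" using inv by auto
  \<comment> \<open>The pointer has advanced by one in a cycle of at least two letters, so it reads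
    a letter of the original word and not the premature mark.\<close>
  have "m \<noteq> Suc j"
  proof
    assume "m = Suc j"
    then show False using fi(3,5) by (cases "Suc (Suc j) = S") auto
  qed
  then have "tape_word M f i m = symbols M + a" using fi(4) left2 by simp
  then have mi: "m = Suc i" "a = f i" using tape_word_head[OF fi(1)] left2 by auto
  \<comment> \<open>Since \<open>m = Suc i\<close> is not 0, the pointer has not wrapped round: the
    cell marked in advance is the left neighbour of the head.\<close>
  then have ij: "i = Suc j"
    using fi(3,5) by (cases "Suc (Suc j) = S") auto
  have r: "reachable M w q2 (f(i := c)) j" using reachable_step[OF fi(1)] left2 mi ij by fastforce
  have "X(m := c) = tape_word M (f(i := c)) j"
    using fi(4) mi ij by (auto simp: tape_word_def plain_word_upd fun_eq_iff)
  then show ?thesis using left2 r by auto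
next
  case (start1 q1)
  then obtain f i where fi: "reachable M w q1 f i" "X = tape_word M f i" using inv by auto
  then have "m = 0" using tape_word_separator start1 by metis
  then show ?thesis using start1 fi S_ge by (auto intro!: exI[of _ f] exI[of _ i] simp: fun_eq_iff)
next
  case (start2 q1 a q2 b)
  then obtain f i where fi: "reachable M w q1 f i" "X = tape_word M f i" "m = 1" using inv by auto
  then have mi: "i = 0" "a = f i" using tape_word_head[OF fi(1)] start2 by force+
  then have "reachable M w q2 (f(i := b)) i" using reachable_step[OF fi(1)] start2 by fastforce
  then show ?thesis using start2 fi mi
    by (auto simp: tape_word_def plain_word_upd intro!: exI[of _ "f(i := b)"] exI[of _ i])
qed (use inv in auto)

lemma sweep_sound:
  assumes "(sweep_init w, (Clean, X, m)) \<in> (sweep (sweep_rules M) S)\<^sup>*"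
  shows "\<exists>f i. reachable M w (accept M) f i"
proof -
  have "sweep_inv S w c \<and> snd (snd c) < S" if "(sweep_init w, c) \<in> (sweep (sweep_rules M) S)\<^sup>*" for c
    using that
  proof (induction rule: rtrancl_induct)
    case base
    show ?case using S_ge reachable_initial by (auto simp: sweep_init_def)
  next
    case (step c c')
    from step(2) obtain q X m a q' where c: "c = (q, X, m)" "c' = (q', X(m := a), Suc m mod S)"
      "(q, X m, a, q') \<in> sweep_rules M" unfolding sweep_def by blast
    then show ?case using sweep_inv_step[of q X m a q'] step.IH S_ge by simp
  qed
  from this[OF assms] show ?thesis by simp
qed

text \<open>In \<open>Sweep\<close> the pointer can be rotated freely, so each machine step starts
  by bringing it to the required letter, and the position where it is left is arbitrary.\<close>

lemma sweep_reaches: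
  assumes "tm_run M w t = (q, [(f, i)])"
  shows "\<exists>m < S. (sweep_init w, (Sweep q, tape_word M f i, m)) \<in> (sweep (sweep_rules M) S)\<^sup>*"
  using assms
proof (induction t arbitrary: q f i)
  case 0
  then show ?case using S_ge one
    by (intro exI[of _ 0]) (simp add: sweep_init_def tm_run_def initial_config_def)
next
  case (Suc t)
  let ?R = "(sweep (sweep_rules M) S)\<^sup>*"
  obtain q1 f1 i1 where c: "tm_run M w t = (q1, [(f1, i1)])" using run_shape by blast
  have r1: "reachable M w q1 f1 i1" using c unfolding reachable_def by blast
  have r: "reachable M w q f i" using Suc.prems unfolding reachable_def by blast
  note b1 = reachable_bounds[OF r1]
  obtain m where m: "m < S" "(sweep_init w, (Sweep q1, tape_word M f1 i1, m)) \<in> ?R"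
    using Suc.IH[OF c] by blast
  have to: "(sweep_init w, (Sweep q1, tape_word M f1 i1, m')) \<in> ?R" if "m' < S" for m'
    by (rule rtrancl_trans[OF m(2) sweep_rotate]) (use m(1) b1 that in \<open>simp_all add: tape_word_le[OF r1]\<close>)
  have st: "tm_run M w (Suc t) = tm_step M (q1, [(f1, i1)])"
    using c by (simp add: tm_run_def)
  show ?case
  proof (cases "q1 \<in> {accept M, reject M}")
    case True
    then have "(q, [(f, i)]) = (q1, [(f1, i1)])" using st Suc.prems by (simp add: tm_step_def halted_def)
    then show ?thesis using m by auto
  next
    case False
    obtain q' b mv where d: "delta M q1 [f1 i1] = (q', [(b, mv)])" "trans1 M q1 (f1 i1) = (q', b, mv)"
      "q' < states M" "b < symbols M"
      by (rule delta1[OF b1[THEN conjunct1] b1[THEN conjunct2, rule_format]])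
    have eq: "q' = q" "f = f1(i1 := b)" "i = move_head mv i1"
      using st Suc.prems d False by (auto simp: tm_step_def halted_def)
    have i1: "Suc i1 < S" using space[OF r1] by simp
    have hd: "tape_word M f1 i1 (Suc i1) = symbols M + f1 i1" by (simp add: tape_word_def)
    note rl = b1[THEN conjunct1] b1[THEN conjunct2, rule_format, of i1] False
    show ?thesis
    proof (cases mv)
      case Stay
      have "(sweep_init w, (Sweep q, tape_word M f i, Suc (Suc i1) mod S)) \<in> ?R"
      proof (rule sweep_stepI[OF to[OF i1] sweep_rules.stay[OF rl]])
        show "trans1 M q1 (f1 i1) = (q, b, Stay)" using d eq Stay by simp
        show "tape_word M f i = (tape_word M f1 i1)(Suc i1 := symbols M + b)"
          using eq Stay by (simp add: tape_word_def plain_word_upd)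
      qed (use hd in auto)
      then show ?thesis using S_ge by (intro exI[of _ "Suc (Suc i1) mod S"]) simp
    next
      case Right
      have i2: "Suc (Suc i1) < S" using space[OF r] eq Right by simp
      have "(sweep_init w, (FromLeft q, plain_word M f, Suc (Suc i1))) \<in> ?R"
      proof (rule sweep_stepI[OF to[OF i1] sweep_rules.right1[OF rl]])
        show "trans1 M q1 (f1 i1) = (q, b, Right)" using d eq Right by simp
        show "plain_word M f = (tape_word M f1 i1)(Suc i1 := b)"
          using eq Right by (simp add: tape_word_def plain_word_upd)
      qed (use hd i2 in auto)
      then have "(sweep_init w, (Sweep q, tape_word M f i, Suc (Suc (Suc i1)) mod S)) \<in> ?R"
      proof (rule sweep_stepI[OF _ sweep_rules.right2])
        show "q < states M" "f (Suc i1) < symbols M" using reachable_bounds[OF r] by auto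
        show "tape_word M f i = (plain_word M f)(Suc (Suc i1) := symbols M + f (Suc i1))"
          using eq Right by (simp add: tape_word_def)
      qed (auto simp: plain_word_def)
      then show ?thesis using S_ge by (intro exI[of _ "Suc (Suc (Suc i1)) mod S"]) simp
    next
      case Left
      have tr: "trans1 M q1 (f1 i1) = (q, b, Left)" using d eq Left by simp
      show ?thesis
      proof (cases i1)
        \<comment> \<open>Here \<open>move_head Left 0 = 0\<close>: the head stays, so the new mark
          replaces the old one on the same letter.\<close>
        case 0
        have "(sweep_init w, (AtStart q1, tape_word M f1 i1, 1)) \<in> ?R"
        proof (rule sweep_stepI[OF to[of 0] sweep_rules.start1[OF rl(1)]])
          show "tape_word M f1 i1 0 = 2 * symbols M" "tape_word M f1 i1 = (tape_word M f1 i1)(0 := 2 * symbols M)"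
            by (simp_all add: tape_word_def plain_word_def fun_eq_iff)
        qed (use S_ge in auto)
        then have "(sweep_init w, (Sweep q, tape_word M f i, 2 mod S)) \<in> ?R"
        proof (rule sweep_stepI[OF _ sweep_rules.start2[OF rl tr]])
          show "tape_word M f i = (tape_word M f1 i1)(1 := symbols M + b)"
            using eq Left 0 by (simp add: tape_word_def plain_word_upd)
        qed (use hd 0 in \<open>auto simp: numeral_2_eq_2\<close>)
        then show ?thesis using S_ge by (intro exI[of _ "2 mod S"]) simp
      next
        case (Suc j)
        let ?Y = "(tape_word M f1 i1)(i1 := symbols M + f1 j)"
        \<comment> \<open>Position \<open>i1\<close> of the word holds the cell \<open>j\<close>
          left of the head, which is at position \<open>Suc i1\<close>: the pointer stops one letter
          before the head.\<close>
        have "(sweep_init w, (ToLeft q1, ?Y, Suc i1)) \<in> ?R"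
        proof (rule sweep_stepI[OF to[of i1] sweep_rules.left1[OF rl(1)]])
          show "f1 j < symbols M" using b1 by simp
          show "tape_word M f1 i1 i1 = f1 j" using Suc by (simp add: tape_word_def plain_word_def)
        qed (use i1 in auto)
        then have "(sweep_init w, (Sweep q, tape_word M f i, Suc (Suc i1) mod S)) \<in> ?R"
        proof (rule sweep_stepI[OF _ sweep_rules.left2[OF rl tr]])
          show "tape_word M f i = ?Y(Suc i1 := b)"
            using eq(3) Left Suc unfolding tape_word_def eq(2) plain_word_upd by (auto simp: fun_eq_iff)
        qed (use hd in auto)
        then show ?thesis using S_ge by (intro exI[of _ "Suc (Suc i1) mod S"]) simp
      qed
    qed
  qed
qed

lemma sweep_complete:
  assumes "reachable M w (accept M) f i"
  shows "\<exists>X m. (sweep_init w, (Clean, X, m)) \<in> (sweep (sweep_rules M) S)\<^sup>* \<and> (\<forall>x < S. X x = 0)"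
proof -
  let ?R = "(sweep (sweep_rules M) S)\<^sup>*"
  let ?X = "tape_word M f i"
  note le = tape_word_le[OF assms]
  obtain m where m: "m < S" "(sweep_init w, (Sweep (accept M), ?X, m)) \<in> ?R"
    using assms sweep_reaches unfolding reachable_def by blast
  \<comment> \<open>Starting the last round at position 0 makes the erased letters an initial
    segment of the word.\<close>
  have "((Sweep (accept M), ?X, m), (Sweep (accept M), ?X, 0)) \<in> ?R"
    using reachable_bounds[OF assms] S_ge m(1) by (intro sweep_rotate le) auto
  with m(2) have *: "(sweep_init w, (Sweep (accept M), ?X, 0)) \<in> ?R"
    by (rule rtrancl_trans)
  have "\<exists>X. (sweep_init w, (Clean, X, Suc n mod S)) \<in> ?R \<and> (\<forall>x. X x \<le> 2 * symbols M) \<and> (\<forall>x < Suc n. X x = 0)"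
    if "Suc n \<le> S" for n
    using that
  proof (induction n)
    case 0
    have "(sweep_init w, (Clean, ?X(0 := 0), Suc 0 mod S)) \<in> ?R"
      by (rule sweep_stepI[OF * sweep_rules.clean1[OF le]]) auto
    then show ?case by (intro exI[of _ "?X(0 := 0)"] conjI; (assumption | simp add: le))
  next
    case (Suc n)
    then obtain X where X: "(sweep_init w, (Clean, X, Suc n)) \<in> ?R" "\<forall>x. X x \<le> 2 * symbols M"
      "\<forall>x < Suc n. X x = 0" by auto
    have "(sweep_init w, (Clean, X(Suc n := 0), Suc (Suc n) mod S)) \<in> ?R"
      by (rule sweep_stepI[OF X(1) sweep_rules.clean2[OF X(2)[rule_format]]]) auto
    then show ?case by (intro exI[of _ "X(Suc n := 0)"] conjI; (assumption | simp add: X less_Suc_eq))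
  qed
  from this[of "S - 1"] S_ge show ?thesis by auto
qed

end

lemma trans1_bounds:
  "q < states M \<Longrightarrow> a < symbols M \<Longrightarrow> trans1 M q a = (q', b, m) \<Longrightarrow> q' < states M \<and> b < symbols M"
proof -
  assume qa: "q < states M" "a < symbols M" and tr: "trans1 M q a = (q', b, m)"
  obtain q2 b2 m2 where "delta M q [a] = (q2, [(b2, m2)])" "trans1 M q a = (q2, b2, m2)"
    "q2 < states M" "b2 < symbols M"
    by (rule delta1[OF qa])
  then show ?thesis using tr by simp
qed

definition controls :: "control set" where
  "controls = Sweep ` {..<states M} \<union> FromLeft ` {..<states M} \<union> ToLeft ` {..<states M} \<union>
     AtStart ` {..<states M} \<union> {Clean}"

text \<open>Besides finiteness this gives the block length: the separator is the largest letter, so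
  \<open>2 * symbols M + 1\<close> counters per position suffice.\<close>

lemma sweep_rules_subset:
  "sweep_rules M \<subseteq> controls \<times> {..2 * symbols M} \<times> {..2 * symbols M} \<times> controls"
proof
  fix r assume "r \<in> sweep_rules M"
  then obtain q a c q' where r: "r = (q, a, c, q')" "(q, a, c, q') \<in> sweep_rules M"
    by (metis prod_cases4)
  from r(2) show "r \<in> controls \<times> {..2 * symbols M} \<times> {..2 * symbols M} \<times> controls"
  proof cases
    case clean1
    moreover have "accept M < states M" using M by (simp add: turing_machine_def)
    ultimately show ?thesis by (simp add: r(1) controls_def)
  qed (auto simp: r(1) controls_def dest: trans1_bounds)
qed

lemma finite_sweep_rules: "finite (sweep_rules M)"
  by (rule finite_subset[OF sweep_rules_subset]) (auto simp: controls_def)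

end

section \<open>Counter blocks and their rotation\<close>

text \<open>A token at \<open>a\<close> is to move to \<open>c\<close>, but a permutation must also
  dispose of the counter at \<open>c\<close>. The transposition does so and is the identity for
  \<open>a = c\<close>.\<close>

definition swap_letters :: "nat \<Rightarrow> nat \<Rightarrow> nat \<Rightarrow> nat" where
  "swap_letters a c x = (if x = a then c else if x = c then a else x)"

lemma swap_letters_invol [simp]: "swap_letters a c (swap_letters a c x) = x"
  by (simp add: swap_letters_def)

lemma swap_letters_less: "a < k \<Longrightarrow> c < k \<Longrightarrow> x < k \<Longrightarrow> swap_letters a c x < k"
  by (simp add: swap_letters_def)

text \<open>The \<open>S * k\<close> counters form \<open>S\<close> blocks of length \<open>k\<close>. All blocks move forward by one, and
  the first one becomes the last one with its entries \<open>a\<close> and \<open>c\<close> exchanged.\<close>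

definition rotation :: "nat \<Rightarrow> nat \<Rightarrow> nat \<Rightarrow> nat \<Rightarrow> nat \<Rightarrow> nat" where
  "rotation S k a c i = (if i < (S - 1) * k then i + k else swap_letters a c (i - (S - 1) * k))"

text \<open>Row \<open>i\<close> selects the old coordinate \<open>rotation S k a c i\<close>: the
  index map tells where the new entries come from.\<close>

definition rotation_mat :: "nat \<Rightarrow> nat \<Rightarrow> nat \<Rightarrow> nat \<Rightarrow> int mat" where
  "rotation_mat S k a c = mat (S * k) (S * k) (\<lambda>(i, j). if j = rotation S k a c i then 1 else 0)"

text \<open>After the rotation the processed letter is in the last block, and the increment is meant
  for its new value \<open>c\<close>.\<close>

definition last_block_vec :: "nat \<Rightarrow> nat \<Rightarrow> nat \<Rightarrow> int \<Rightarrow> int vec" where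
  "last_block_vec S k c z = vec (S * k) (\<lambda>i. if i = (S - 1) * k + c then z else 0)"

type_synonym counter_rule = "nat \<times> nat \<times> nat \<times> int \<times> nat"

definition rule_transition :: "nat \<Rightarrow> nat \<Rightarrow> counter_rule \<Rightarrow> nat transition" where
  "rule_transition S k = (\<lambda>(p, a, c, z, q). (p, rotation_mat S k a c, last_block_vec S k c z, q))"

text \<open>Block 0 holds the position under the pointer and the others follow cyclically. Hence a
  transition always acts on the same coordinates, and its matrix does not depend on the
  pointer.\<close>

definition block_vec :: "nat \<Rightarrow> nat \<Rightarrow> (nat \<Rightarrow> nat \<Rightarrow> int) \<Rightarrow> nat \<Rightarrow> int vec" where
  "block_vec S k val m = vec (S * k) (\<lambda>i. val ((m + i div k) mod S) (i mod k))"

definition update_counters :: "(nat \<Rightarrow> nat \<Rightarrow> int) \<Rightarrow> nat \<Rightarrow> nat \<Rightarrow> nat \<Rightarrow> int \<Rightarrow> nat \<Rightarrow> nat \<Rightarrow> int" where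
  "update_counters val m a c z =
     val(m := (\<lambda>x. val m (swap_letters a c x) + (if x = c then z else 0)))"

lemma rotation_less:
  assumes "a < k" "c < k" "i < S * k"
  shows "rotation S k a c i < S * k"
proof -
  obtain S' where S: "S = Suc S'" using assms by (cases S) auto
  have "i - S' * k < k" if "\<not> i < S' * k" using assms(3) that by (simp add: S)
  then show ?thesis
    using assms swap_letters_less[of a k c "i - S' * k"] by (auto simp: S rotation_def trans_less_add1)
qed

lemma rotation_bij:
  assumes "a < k" "c < k" "S \<ge> 1" "j < S * k"
  shows "\<exists>!i. i < S * k \<and> rotation S k a c i = j"
proof (rule ex_ex1I)
  obtain S' where S: "S = Suc S'" using assms by (cases S) auto
  show "\<exists>i. i < S * k \<and> rotation S k a c i = j"
  proof (cases "j < k")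
    case True
    then show ?thesis
      using swap_letters_less[OF assms(1,2) True]
      by (intro exI[of _ "S' * k + swap_letters a c j"]) (simp add: S rotation_def)
  next
    case False
    then show ?thesis using assms(4)
      by (intro exI[of _ "j - k"]) (auto simp: S rotation_def)
  qed
next
  obtain S' where S: "S = Suc S'" using assms by (cases S) auto
  fix i i' assume i: "i < S * k \<and> rotation S k a c i = j" and i': "i' < S * k \<and> rotation S k a c i' = j"
  have less: "swap_letters a c (x - S' * k) < k" if "x < S * k" for x
    using swap_letters_less[OF assms(1,2)] that assms(1) by (simp add: S)
  show "i = i'"
  proof (cases "i < S' * k"; cases "i' < S' * k")
    assume "\<not> i < S' * k" "\<not> i' < S' * k"
    then have "swap_letters a c (i - S' * k) = swap_letters a c (i' - S' * k)"
      using i i' by (simp add: S rotation_def)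
    then have "i - S' * k = i' - S' * k" by (metis swap_letters_invol)
    with \<open>\<not> i < S' * k\<close> \<open>\<not> i' < S' * k\<close> show ?thesis by linarith
  qed (use i i' less[of i] less[of i'] in \<open>auto simp: S rotation_def\<close>)
qed

lemma permutation_rotation_mat:
  assumes "a < k" "c < k" "S \<ge> 1"
  shows "permutation_matrix (S * k) (rotation_mat S k a c)"
  unfolding permutation_matrix_def
proof (intro conjI allI impI)
  fix i assume i: "i < S * k"
  show "\<exists>!j. j < S * k \<and> rotation_mat S k a c $$ (i, j) = 1"
    using rotation_less[OF assms(1,2) i] i by (auto simp: rotation_mat_def split: if_splits)
next
  fix j assume j: "j < S * k"
  show "\<exists>!i. i < S * k \<and> rotation_mat S k a c $$ (i, j) = 1"
  proof -
    have "(i < S * k \<and> rotation_mat S k a c $$ (i, j) = 1) \<longleftrightarrow> (i < S * k \<and> rotation S k a c i = j)" for i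
      using j by (auto simp: rotation_mat_def split: if_splits)
    then show ?thesis using rotation_bij[OF assms j] by simp
  qed
qed (auto simp: rotation_mat_def)

lemma rotation_mat_mult:
  assumes "a < k" "c < k" "u \<in> carrier_vec (S * k)"
  shows "rotation_mat S k a c *\<^sub>v u = vec (S * k) (\<lambda>i. u $ rotation S k a c i)"
proof (rule eq_vecI)
  fix i assume "i < dim_vec (vec (S * k) (\<lambda>i. u $ rotation S k a c i))"
  then have i: "i < S * k" by simp
  have "(rotation_mat S k a c *\<^sub>v u) $ i
      = (\<Sum>j<S * k. (if j = rotation S k a c i then 1 else 0) * u $ j)"
    using i assms(3) by (simp add: rotation_mat_def scalar_prod_def lessThan_atLeast0)
  also have "\<dots> = (\<Sum>j<S * k. if j = rotation S k a c i then u $ j else 0)"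
    by (intro sum.cong) auto
  also have "\<dots> = u $ rotation S k a c i"
    using rotation_less[OF assms(1,2) i] by simp
  finally show "(rotation_mat S k a c *\<^sub>v u) $ i = vec (S * k) (\<lambda>i. u $ rotation S k a c i) $ i"
    using i by simp
qed (simp add: rotation_mat_def)

text \<open>The first \<open>S - 1\<close> blocks of the new vector are old blocks under shifted
  indices; only the block that leaves the front and reappears at the end is changed.\<close>

lemma block_vec_step:
  assumes "a < k" "c < k" "m < S"
  shows "rotation_mat S k a c *\<^sub>v block_vec S k val m + last_block_vec S k c z
    = block_vec S k (update_counters val m a c z) (Suc m mod S)"
proof -
  obtain S' where S: "S = Suc S'" using assms by (cases S) auto
  have "block_vec S k val m \<in> carrier_vec (S * k)" by (simp add: block_vec_def)
  note mult = rotation_mat_mult[OF assms(1,2) this]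
  show ?thesis unfolding mult
  proof (rule eq_vecI)
    fix i assume "i < dim_vec (block_vec S k (update_counters val m a c z) (Suc m mod S))"
    then have i: "i < S * k" by (simp add: block_vec_def)
    have main: "block_vec S k val m $ rotation S k a c i + (if i = S' * k + c then z else 0)
        = update_counters val m a c z ((Suc m mod S + i div k) mod S) (i mod k)"
    proof (cases "i < S' * k")
      case True
      then have dv: "i div k < S'" by (simp add: less_mult_imp_div_less)
      have eq: "(Suc m mod S + i div k) mod S = (m + Suc (i div k)) mod S" by (simp add: mod_add_left_eq)
      \<comment> \<open>The block lies at least one and fewer than \<open>S\<close> positions beyond
        \<open>m\<close>, so it is not the updated one.\<close>
      have "(m + Suc (i div k)) mod S \<noteq> m"
      proof (cases "m + Suc (i div k) < S")
        case False
        then have "(m + Suc (i div k)) mod S = m + Suc (i div k) - S"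
          using dv assms(3) by (simp add: le_mod_geq S)
        then show ?thesis using dv False by (simp add: S)
      qed simp
      moreover have "(i + k) div k = Suc (i div k)" "rotation S k a c i < S * k"
        using assms(1) rotation_less[OF assms(1,2) i] by auto
      ultimately show ?thesis using True unfolding eq
        by (simp add: S rotation_def block_vec_def update_counters_def)
    next
      case False
      define r where "r = i - S' * k"
      have r: "i = S' * k + r" "r < k" using False i by (auto simp: r_def S)
      have dm: "i div k = S'" "i mod k = r" using r by auto
      have "(Suc m mod S + S') mod S = (m + S) mod S" by (simp add: mod_add_left_eq S)
      then have eq: "(Suc m mod S + S') mod S = m" using assms(3) by simp
      have "swap_letters a c r < k" using swap_letters_less assms r by simp
      then show ?thesis using r(2) assms(3) unfolding dm eq
        by (simp add: r(1) S rotation_def block_vec_def update_counters_def trans_less_add1)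
    qed
    have bv: "block_vec S k W m' $ i = W ((m' + i div k) mod S) (i mod k)" for W m'
      using i by (simp add: block_vec_def)
    have lv: "last_block_vec S k c z $ i = (if i = S' * k + c then z else 0)"
      "dim_vec (last_block_vec S k c z) = S * k"
      using i by (simp_all add: last_block_vec_def S)
    show "(vec (S * k) (\<lambda>i. block_vec S k val m $ rotation S k a c i) + last_block_vec S k c z) $ i
        = block_vec S k (update_counters val m a c z) (Suc m mod S) $ i"
      unfolding bv[of "update_counters val m a c z"] main[symmetric] using i lv by simp
  qed (simp add: last_block_vec_def block_vec_def)
qed

lemma block_vec_zero:
  assumes "m < S" "k > 0"
  shows "block_vec S k val m = 0\<^sub>v (S * k) \<longleftrightarrow> (\<forall>p < S. \<forall>x < k. val p x = 0)"
proof
  assume *: "block_vec S k val m = 0\<^sub>v (S * k)"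
  show "\<forall>p < S. \<forall>x < k. val p x = 0"
  proof (intro allI impI)
    fix p x assume p: "p < S" and x: "x < k"
    \<comment> \<open>The block that holds position \<open>p\<close> when the pointer is at
      \<open>m\<close>.\<close>
    define j where "j = (p + S - m) mod S"
    have j: "j < S" using p by (simp add: j_def)
    have "(m + j) mod S = p" using p assms(1) by (simp add: j_def mod_add_right_eq)
    moreover have "j * k + x < S * k"
    proof -
      have "j * k + x < Suc j * k" using x by simp
      also have "\<dots> \<le> S * k" using j by (intro mult_le_mono1) simp
      finally show ?thesis .
    qed
    moreover have "(j * k + x) div k = j" "(j * k + x) mod k = x" using x by auto
    ultimately show "val p x = 0"
      using arg_cong[OF *, of "\<lambda>v. v $ (j * k + x)"] by (simp add: block_vec_def)
  qed
next
  assume "\<forall>p < S. \<forall>x < k. val p x = 0"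
  then show "block_vec S k val m = 0\<^sub>v (S * k)"
    using assms by (intro eq_vecI) (auto simp: block_vec_def)
qed

section \<open>Runs as movements of a pointer over fixed counters\<close>

definition counter_step ::
    "counter_rule set \<Rightarrow> nat \<Rightarrow> ((nat \<times> (nat \<Rightarrow> nat \<Rightarrow> int) \<times> nat) \<times> (nat \<times> (nat \<Rightarrow> nat \<Rightarrow> int) \<times> nat)) set" where
  "counter_step Z S = {((p, val, m), (q, update_counters val m a c z, Suc m mod S)) |
     p val m a c z q. (p, a, c, z, q) \<in> Z}"

definition valid_rules :: "nat \<Rightarrow> nat set \<Rightarrow> counter_rule set \<Rightarrow> bool" where
  "valid_rules k Q Z \<longleftrightarrow> (\<forall>(p, a, c, z, q) \<in> Z. p \<in> Q \<and> q \<in> Q \<and> a < k \<and> c < k)"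

lemma permutation_zvass_rules:
  assumes "valid_rules k Q Z" "finite Q" "finite Z" "S \<ge> 1"
  shows "permutation_zvass (S * k, Q, rule_transition S k ` Z)"
  using assms permutation_rotation_mat[of _ k _ S]
  unfolding permutation_zvass_def affine_zvass_def valid_rules_def
  by (fastforce simp: rule_transition_def rotation_mat_def last_block_vec_def)

lemma counter_step_iff:
  assumes "valid_rules k Q Z" "m < S"
  shows "((p, block_vec S k val m), y) \<in> step_rel (S * k, Q, rule_transition S k ` Z) \<longleftrightarrow>
    (\<exists>q val' m'. y = (q, block_vec S k val' m') \<and> ((p, val, m), (q, val', m')) \<in> counter_step Z S)"
proof
  assume "((p, block_vec S k val m), y) \<in> step_rel (S * k, Q, rule_transition S k ` Z)"
  then obtain a c z q where r: "(p, a, c, z, q) \<in> Z"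
    and y: "y = (q, rotation_mat S k a c *\<^sub>v block_vec S k val m + last_block_vec S k c z)"
    by (auto simp: step_rel_def transition_rel_def rule_transition_def)
  have "a < k" "c < k" using assms(1) r by (auto simp: valid_rules_def)
  from y[unfolded block_vec_step[OF this assms(2)]] r
  show "\<exists>q val' m'. y = (q, block_vec S k val' m') \<and> ((p, val, m), (q, val', m')) \<in> counter_step Z S"
    unfolding counter_step_def by blast
next
  assume "\<exists>q val' m'. y = (q, block_vec S k val' m') \<and> ((p, val, m), (q, val', m')) \<in> counter_step Z S"
  then obtain a c z q where r: "(p, a, c, z, q) \<in> Z"
    and y: "y = (q, block_vec S k (update_counters val m a c z) (Suc m mod S))"
    unfolding counter_step_def by auto
  have ac: "a < k" "c < k" "p \<in> Q" using assms(1) r by (auto simp: valid_rules_def)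
  have "block_vec S k val m \<in> carrier_vec (S * k)" by (simp add: block_vec_def)
  then show "((p, block_vec S k val m), y) \<in> step_rel (S * k, Q, rule_transition S k ` Z)"
    unfolding y block_vec_step[OF ac(1,2) assms(2), symmetric] step_rel_def
    using r ac by (auto simp: transition_rel_def rule_transition_def configurations_def
        intro!: bexI[of _ "(p, a, c, z, q)"])
qed

text \<open>Block vectors are closed under all transitions, whether the guesses are right or wrong,
  so reachability can be treated in terms of pointer and counters alone.\<close>

lemma counter_steps_iff:
  assumes Z: "valid_rules k Q Z" and m: "m < S"
  shows "((p, block_vec S k val m), y) \<in> (step_rel (S * k, Q, rule_transition S k ` Z))\<^sup>* \<longleftrightarrow>
    (\<exists>q val' m'. y = (q, block_vec S k val' m') \<and> ((p, val, m), (q, val', m')) \<in> (counter_step Z S)\<^sup>* \<and> m' < S)"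
    (is "_ \<in> ?R \<longleftrightarrow> ?P y")
proof
  assume "((p, block_vec S k val m), y) \<in> ?R"
  then show "?P y"
  proof (induction rule: rtrancl_induct)
    case base
    then show ?case using m by blast
  next
    case (step y y')
    then obtain q val' m' where y: "y = (q, block_vec S k val' m')"
      "((p, val, m), (q, val', m')) \<in> (counter_step Z S)\<^sup>*" "m' < S" by blast
    with step(2) obtain q2 val2 m2 where y': "y' = (q2, block_vec S k val2 m2)"
      "((q, val', m'), (q2, val2, m2)) \<in> counter_step Z S"
      using counter_step_iff[OF Z y(3)] by blast
    moreover have "m2 < S" using y'(2) m by (auto simp: counter_step_def)
    ultimately show ?case using y(2) by (blast intro: rtrancl_into_rtrancl)
  qed
next
  assume "?P y"
  then obtain q val' m' where y: "y = (q, block_vec S k val' m')"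
    and steps: "((p, val, m), (q, val', m')) \<in> (counter_step Z S)\<^sup>*" by blast
  have "snd (snd c) < S \<and> ((p, block_vec S k val m), (fst c, block_vec S k (fst (snd c)) (snd (snd c)))) \<in> ?R"
    if "((p, val, m), c) \<in> (counter_step Z S)\<^sup>*" for c
    using that
  proof (induction rule: rtrancl_induct)
    case base
    then show ?case using m by simp
  next
    case (step c c')
    obtain q2 val2 m2 where c: "c = (q2, val2, m2)" by (cases c)
    obtain q3 val3 m3 where c': "c' = (q3, val3, m3)" by (cases c')
    have "m2 < S" using step.IH c by simp
    have "((q2, block_vec S k val2 m2), (q3, block_vec S k val3 m3)) \<in> step_rel (S * k, Q, rule_transition S k ` Z)"
      using counter_step_iff[OF Z \<open>m2 < S\<close>] step(2) c c' by blast
    moreover have "m3 < S" using step(2) c' m by (auto simp: counter_step_def)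
    ultimately show ?case using step.IH c c' by (auto intro: rtrancl_into_rtrancl)
  qed
  from this[OF steps] y show "((p, block_vec S k val m), y) \<in> ?R" by simp
qed

section \<open>Guessed letters and the detection of wrong guesses\<close>

definition simulation_rules :: "('q \<Rightarrow> nat) \<Rightarrow> 'q rule set \<Rightarrow> 'q \<Rightarrow> nat \<Rightarrow> counter_rule set" where
  "simulation_rules code R cl fin =
     (\<lambda>(q, a, c, q'). (code q, a, c, 1, code q')) ` R \<union> {(code cl, 0, 0, 0, fin), (fin, 0, 0, 0, fin), (fin, 0, 0, -1, fin)}"

definition token :: "(nat \<Rightarrow> nat) \<Rightarrow> nat \<Rightarrow> nat \<Rightarrow> int" where
  "token X p x = (if x = X p then 1 else 0)"

locale simulation =
  fixes code :: "'q \<Rightarrow> nat" and R :: "'q rule set" and cl :: 'q and fin S k :: nat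
  assumes code: "inj code" "fin \<notin> range code" and S: "S \<ge> 1" and k: "k \<ge> 1"
    and letters: "\<And>q a c q'. (q, a, c, q') \<in> R \<Longrightarrow> a < k \<and> c < k"
begin

abbreviation "Z \<equiv> simulation_rules code R cl fin"

text \<open>\<open>X\<close> is a ghost word: it follows the swaps of all rules that are fired, so
  its letters carry positive counters even after a wrong guess, when it no longer comes from a
  sweep.\<close>

definition tokens :: "(nat \<Rightarrow> nat \<Rightarrow> int) \<Rightarrow> (nat \<Rightarrow> nat) \<Rightarrow> bool" where
  "tokens val X \<longleftrightarrow> (\<forall>p < S. X p < k \<and> val p (X p) \<ge> 1 \<and> (\<forall>x < k. val p x \<ge> 0))"

definition corrupt :: "(nat \<Rightarrow> nat \<Rightarrow> int) \<Rightarrow> (nat \<Rightarrow> nat) \<Rightarrow> bool" where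
  "corrupt val X \<longleftrightarrow> (\<exists>p < S. \<exists>x < k. x \<noteq> X p \<and> val p x \<ge> 1)"

lemma tokens_update:
  assumes "tokens val X" "a < k" "c < k" "m < S"
  shows "tokens (update_counters val m a c 1) (X(m := swap_letters a c (X m)))"
  using assms swap_letters_less[OF assms(2,3)]
  by (auto simp: tokens_def update_counters_def)

text \<open>The swap is injective, so a surplus away from the token stays away from it, and the
  increment does not reduce it.\<close>

lemma corrupt_update:
  assumes "corrupt val X" and ac: "a < k" "c < k"
  shows "corrupt (update_counters val m a c 1) (X(m := swap_letters a c (X m)))"
proof -
  obtain p x where p: "p < S" "x < k" "x \<noteq> X p" "val p x \<ge> 1"
    using assms(1) unfolding corrupt_def by blast
  show ?thesis
  proof (cases "p = m")
    case True
    have "swap_letters a c x \<noteq> swap_letters a c (X m)" using p(3) True by (metis swap_letters_invol)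
    then show ?thesis using p True swap_letters_less[OF ac p(2)] unfolding corrupt_def
      by (intro exI[of _ p] conjI exI[of _ "swap_letters a c x"]) (auto simp: update_counters_def)
  next
    case False
    then show ?thesis using p unfolding corrupt_def
      by (intro exI[of _ p] conjI exI[of _ x]) (auto simp: update_counters_def)
  qed
qed

text \<open>If the token is not at \<open>a\<close>, the swap does not bring it to \<open>c\<close>.
  The value arriving at \<open>c\<close> comes from \<open>a\<close>, is nonnegative, and becomes
  positive by the increment.\<close>

lemma corrupt_wrong_guess:
  assumes t: "tokens val X" and ac: "a < k" "c < k" and m: "m < S" and a: "a \<noteq> X m"
  shows "corrupt (update_counters val m a c 1) (X(m := swap_letters a c (X m)))"
proof -
  have "swap_letters a c (X m) \<noteq> c"
    using a by (metis swap_letters_def swap_letters_invol)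
  moreover have "val m (swap_letters a c c) \<ge> 0"
    using t m ac by (auto simp: tokens_def swap_letters_def)
  ultimately show ?thesis using m ac unfolding corrupt_def
    by (intro exI[of _ m] conjI exI[of _ c]) (auto simp: update_counters_def)
qed

definition cleaned :: "'q \<Rightarrow> (nat \<Rightarrow> nat) \<Rightarrow> bool" where
  "cleaned q0 X0 \<longleftrightarrow> (\<exists>X m. ((q0, X0, 0), (cl, X, m)) \<in> (sweep R S)\<^sup>* \<and> (\<forall>x < S. X x = 0))"

text \<open>During the simulation the ghost word is genuine unless an error is on record. In
  \<open>fin\<close> the invariant keeps only what the remaining rules cannot change: the counters
  away from letter 0.\<close>

definition counter_inv :: "'q \<Rightarrow> (nat \<Rightarrow> nat) \<Rightarrow> nat \<Rightarrow> (nat \<Rightarrow> nat \<Rightarrow> int) \<Rightarrow> nat \<Rightarrow> bool" where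
  "counter_inv q0 X0 s val m \<longleftrightarrow> m < S \<and>
     ((\<exists>q X. s = code q \<and> tokens val X \<and> (corrupt val X \<or> ((q0, X0, 0), (q, X, m)) \<in> (sweep R S)\<^sup>*)) \<or>
      (s = fin \<and> ((\<exists>p < S. \<exists>x < k. x \<noteq> 0 \<and> val p x \<noteq> 0) \<or> cleaned q0 X0)))"

lemma counter_inv_step:
  assumes inv: "counter_inv q0 X0 s val m" and r: "(s, a, c, z, s') \<in> Z"
  shows "counter_inv q0 X0 s' (update_counters val m a c z) (Suc m mod S)"
proof -
  have m: "m < S" "Suc m mod S < S" using inv S by (auto simp: counter_inv_def)
  consider (sim) q q' where "(q, a, c, q') \<in> R" "s = code q" "s' = code q'" "z = 1"
    | (enter) "s = code cl" "a = 0" "c = 0" "z = 0" "s' = fin"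
    | (final) "s = fin" "a = 0" "c = 0" "s' = fin"
    using r by (auto simp: simulation_rules_def)
  then show ?thesis
  proof cases
    case sim
    then obtain X where X: "tokens val X" "corrupt val X \<or> ((q0, X0, 0), (q, X, m)) \<in> (sweep R S)\<^sup>*"
      using inv code by (auto simp: counter_inv_def dest: injD)
    have ac: "a < k" "c < k" using letters sim(1) by auto
    let ?X = "X(m := swap_letters a c (X m))"
    have "corrupt (update_counters val m a c 1) ?X \<or> ((q0, X0, 0), (q', ?X, Suc m mod S)) \<in> (sweep R S)\<^sup>*"
    proof (cases "corrupt val X \<or> a \<noteq> X m")
      case True
      then show ?thesis using corrupt_update[OF _ ac] corrupt_wrong_guess[OF X(1) ac m(1)] by blast
    next
      case False
      then have "((q0, X0, 0), (q', ?X, Suc m mod S)) \<in> (sweep R S)\<^sup>*"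
        using X(2) by (intro sweep_stepI[OF _ sim(1)]) (auto simp: swap_letters_def)
      then show ?thesis ..
    qed
    then show ?thesis
      unfolding counter_inv_def using m(2) tokens_update[OF X(1) ac m(1)] sim by blast
  next
    case enter
    then obtain X where X: "tokens val X" "corrupt val X \<or> ((q0, X0, 0), (cl, X, m)) \<in> (sweep R S)\<^sup>*"
      using inv code by (auto simp: counter_inv_def dest: injD)
    have same: "update_counters val m a c z = val"
      using enter by (auto simp: update_counters_def swap_letters_def fun_eq_iff)
    \<comment> \<open>The rule that enters \<open>fin\<close> does not check that all letters have
      been erased. This is deduced from the counters: each token has a positive value, hence sits at
      letter 0, and then no counter records an error.\<close>
    have "cleaned q0 X0" if z: "\<forall>p < S. \<forall>x < k. x \<noteq> 0 \<longrightarrow> val p x = 0"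
    proof -
      have X0: "X p = 0" if "p < S" for p
      proof (rule ccontr)
        assume "X p \<noteq> 0"
        then have "val p (X p) = 0" "val p (X p) \<ge> 1" using z X(1) that by (auto simp: tokens_def)
        then show False by simp
      qed
      then have "\<not> corrupt val X" using z by (auto simp: corrupt_def)
      then show ?thesis unfolding cleaned_def using X(2) X0 by blast
    qed
    then show ?thesis unfolding counter_inv_def same using m(2) enter(5) by blast
  next
    case final
    then have "(\<exists>p < S. \<exists>x < k. x \<noteq> 0 \<and> val p x \<noteq> 0) \<or> cleaned q0 X0"
      using inv code by (auto simp: counter_inv_def)
    moreover have "update_counters val m a c z p x = val p x" if "x \<noteq> 0" for p x
      using final that by (simp add: update_counters_def swap_letters_def)
    ultimately show ?thesis unfolding counter_inv_def using m(2) final(4) by metis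
  qed
qed

lemma counter_sound:
  assumes "((code q0, token X0, 0), (fin, val, m)) \<in> (counter_step Z S)\<^sup>*"
    and X0: "\<And>p. p < S \<Longrightarrow> X0 p < k" and zero: "\<forall>p < S. \<forall>x < k. val p x = 0"
  shows "cleaned q0 X0"
proof -
  have "counter_inv q0 X0 (fst y) (fst (snd y)) (snd (snd y))"
    if "((code q0, token X0, 0), y) \<in> (counter_step Z S)\<^sup>*" for y
    using that
  proof (induction rule: rtrancl_induct)
    case base
    have "tokens (token X0) X0" using X0 by (auto simp: tokens_def token_def)
    then show ?case using S by (auto simp: counter_inv_def)
  next
    case (step y y')
    then show ?case using counter_inv_step unfolding counter_step_def by fastforce
  qed
  from this[OF assms(1)] show ?thesis
    using zero code by (auto simp: counter_inv_def)
qed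

definition clean_counters :: "(nat \<Rightarrow> nat \<Rightarrow> int) \<Rightarrow> bool" where
  "clean_counters val \<longleftrightarrow> (\<forall>p < S. val p 0 \<ge> 0 \<and> (\<forall>x < k. x \<noteq> 0 \<longrightarrow> val p x = 0))"

lemma counter_rotate:
  assumes "m < S" "m' < S"
  shows "((fin, val, m), (fin, val, m')) \<in> (counter_step Z S)\<^sup>*"
proof -
  have "((fin, val, m), (fin, val, (m + j) mod S)) \<in> (counter_step Z S)\<^sup>*" for j
  proof (induction j)
    case (Suc j)
    have "update_counters val ((m + j) mod S) 0 0 0 = val"
      by (auto simp: update_counters_def swap_letters_def fun_eq_iff)
    moreover have "(fin, 0, 0, 0, fin) \<in> Z" by (simp add: simulation_rules_def)
    ultimately have "((fin, val, (m + j) mod S), (fin, val, Suc ((m + j) mod S) mod S)) \<in> counter_step Z S"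
      unfolding counter_step_def by force
    with Suc show ?case by (simp add: mod_Suc_eq)
  qed (use assms in simp)
  from this[of "m' + S - m"] show ?thesis using assms by simp
qed

text \<open>The rules at \<open>fin\<close> swap letter 0 with itself, so they only rotate, one of
  them with a decrement. The plain one leads to a position whose counter is still positive; the
  other one then lowers the sum of these counters.\<close>

lemma counter_drain:
  assumes "clean_counters val" "m < S"
  shows "\<exists>val' m'. ((fin, val, m), (fin, val', m')) \<in> (counter_step Z S)\<^sup>* \<and> (\<forall>p < S. \<forall>x < k. val' p x = 0)"
  using assms
proof (induction "\<Sum>p<S. nat (val p 0)" arbitrary: val m rule: less_induct)
  case less
  show ?case
  proof (cases "\<forall>p < S. val p 0 = 0")
    case True
    then have "\<forall>p < S. \<forall>x < k. val p x = 0" using less.prems unfolding clean_counters_def by metis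
    then show ?thesis by blast
  next
    case False
    then obtain p where p: "p < S" "val p 0 > 0" using less.prems unfolding clean_counters_def by force
    let ?val = "update_counters val p 0 0 (-1)"
    have v: "?val p' x = (if p' = p \<and> x = 0 then val p 0 - 1 else val p' x)" for p' x
      by (simp add: update_counters_def swap_letters_def)
    have "(\<Sum>p<S. nat (?val p 0)) < (\<Sum>p<S. nat (val p 0))"
      by (rule sum_strict_mono_ex1) (use p in \<open>auto simp: v\<close>)
    moreover have "clean_counters ?val" using less.prems(1) p unfolding clean_counters_def by (simp add: v)
    moreover have "Suc p mod S < S" using S by simp
    ultimately obtain val' m' where *: "((fin, ?val, Suc p mod S), (fin, val', m')) \<in> (counter_step Z S)\<^sup>*"
      "\<forall>p < S. \<forall>x < k. val' p x = 0"
      using less.hyps[of ?val "Suc p mod S"] by blast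
    have "(fin, 0, 0, -1, fin) \<in> Z" by (simp add: simulation_rules_def)
    then have "((fin, val, p), (fin, ?val, Suc p mod S)) \<in> counter_step Z S"
      unfolding counter_step_def by blast
    with counter_rotate[OF less.prems(2) p(1)] *(1)
    have "((fin, val, m), (fin, val', m')) \<in> (counter_step Z S)\<^sup>*"
      by (meson converse_rtrancl_into_rtrancl rtrancl_trans)
    with *(2) show ?thesis by blast
  qed
qed

lemma counter_complete:
  assumes cl: "cleaned q0 X0" and X0: "\<And>p. p < S \<Longrightarrow> X0 p < k"
  shows "\<exists>val m. ((code q0, token X0, 0), (fin, val, m)) \<in> (counter_step Z S)\<^sup>* \<and> (\<forall>p < S. \<forall>x < k. val p x = 0)"
proof -
  \<comment> \<open>The value at a token grows with the visits and is left open; away from the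
    tokens, correct guesses keep all counters exactly zero.\<close>
  define good where "good = (\<lambda>val X. tokens val X \<and> (\<forall>p < S. \<forall>x < k. x \<noteq> X p \<longrightarrow> val p x = 0))"
  have sim: "snd (snd y) < S \<and> (\<exists>val. ((code q0, token X0, 0), (code (fst y), val, snd (snd y))) \<in> (counter_step Z S)\<^sup>*
      \<and> good val (fst (snd y)))"
    if "((q0, X0, 0), y) \<in> (sweep R S)\<^sup>*" for y
    using that
  proof (induction rule: rtrancl_induct)
    case base
    have "good (token X0) X0" using X0 by (auto simp: good_def tokens_def token_def)
    then show ?case using S by auto
  next
    case (step y y')
    then obtain q X m c q' where y: "y = (q, X, m)" "y' = (q', X(m := c), Suc m mod S)" "(q, X m, c, q') \<in> R"
      unfolding sweep_def by blast
    with step.IH obtain val where m: "m < S"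
      and val: "((code q0, token X0, 0), (code q, val, m)) \<in> (counter_step Z S)\<^sup>*" "good val X"
      by auto
    let ?val = "update_counters val m (X m) c 1"
    have ac: "X m < k" "c < k" using letters y(3) by auto
    have "(code q, X m, c, 1, code q') \<in> Z" using y(3) by (force simp: simulation_rules_def)
    then have "((code q, val, m), (code q', ?val, Suc m mod S)) \<in> counter_step Z S"
      unfolding counter_step_def by blast
    with val(1) have "((code q0, token X0, 0), (code q', ?val, Suc m mod S)) \<in> (counter_step Z S)\<^sup>*" ..
    moreover have "good ?val (X(m := c))"
    proof -
      have "X(m := swap_letters (X m) c (X m)) = X(m := c)" by (simp add: swap_letters_def)
      then have "tokens ?val (X(m := c))"
        using tokens_update[of val X "X m" c m] val(2) ac m by (simp add: good_def)
      moreover have "?val p x = 0" if "p < S" "x < k" "x \<noteq> (X(m := c)) p" for p x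
      proof (cases "p = m")
        case True
        then have "x \<noteq> c" using that by simp
        then have "swap_letters (X m) c x \<noteq> X m" by (auto simp: swap_letters_def)
        then show ?thesis using val(2) m True \<open>x \<noteq> c\<close> swap_letters_less[OF ac that(2)]
          by (simp add: good_def update_counters_def)
      next
        case False
        then show ?thesis using val(2) that by (simp add: good_def update_counters_def)
      qed
      ultimately show ?thesis by (simp add: good_def)
    qed
    ultimately show ?case using S y(2) by (auto simp del: fun_upd_apply)
  qed
  obtain X m where X: "((q0, X0, 0), (cl, X, m)) \<in> (sweep R S)\<^sup>*" "\<forall>x < S. X x = 0"
    using cl unfolding cleaned_def by blast
  from sim[OF X(1)] obtain val where m: "m < S"
    and val: "((code q0, token X0, 0), (code cl, val, m)) \<in> (counter_step Z S)\<^sup>*" "good val X" by auto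
  have "update_counters val m 0 0 0 = val"
    by (auto simp: update_counters_def swap_letters_def fun_eq_iff)
  moreover have "(code cl, 0, 0, 0, fin) \<in> Z" by (simp add: simulation_rules_def)
  ultimately have "((code cl, val, m), (fin, val, Suc m mod S)) \<in> counter_step Z S"
    unfolding counter_step_def by force
  with val(1) have 1: "((code q0, token X0, 0), (fin, val, Suc m mod S)) \<in> (counter_step Z S)\<^sup>*" ..
  have "clean_counters val"
    using val(2) X(2) k by (auto simp: good_def tokens_def clean_counters_def)
  then obtain val' m' where "((fin, val, Suc m mod S), (fin, val', m')) \<in> (counter_step Z S)\<^sup>*"
    "\<forall>p < S. \<forall>x < k. val' p x = 0"
    using counter_drain[of val "Suc m mod S"] S by auto
  with 1 show ?thesis by (meson rtrancl_trans)
qed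

theorem simulation_correct:
  assumes Q: "\<And>q a c q'. (q, a, c, q') \<in> R \<Longrightarrow> code q \<in> Q \<and> code q' \<in> Q" "code cl \<in> Q" "fin \<in> Q"
    and X0: "\<And>p. p < S \<Longrightarrow> X0 p < k"
  shows "((code q0, block_vec S k (token X0) 0), (fin, 0\<^sub>v (S * k))) \<in> (step_rel (S * k, Q, rule_transition S k ` Z))\<^sup>*
    \<longleftrightarrow> cleaned q0 X0"
proof -
  have Z: "valid_rules k Q Z"
    using Q letters k by (auto simp: valid_rules_def simulation_rules_def)
  have "0 < S" "0 < k" using S k by auto
  show ?thesis
    unfolding counter_steps_iff[OF Z \<open>0 < S\<close>]
  proof
    assume "\<exists>q val' m'. (fin, 0\<^sub>v (S * k)) = (q, block_vec S k val' m') \<and>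
      ((code q0, token X0, 0), (q, val', m')) \<in> (counter_step Z S)\<^sup>* \<and> m' < S"
    then obtain val' m' where v: "block_vec S k val' m' = 0\<^sub>v (S * k)"
      "((code q0, token X0, 0), (fin, val', m')) \<in> (counter_step Z S)\<^sup>*" "m' < S" by auto
    then show "cleaned q0 X0"
      using counter_sound[OF v(2) X0] block_vec_zero[OF v(3) \<open>0 < k\<close>] by blast
  next
    assume "cleaned q0 X0"
    then obtain val m where v: "((code q0, token X0, 0), (fin, val, m)) \<in> (counter_step Z S)\<^sup>*"
      "\<forall>p < S. \<forall>x < k. val p x = 0" using counter_complete X0 by blast
    have "m < S"
      using v(1) by (cases rule: rtranclE) (use S in \<open>auto simp: counter_step_def\<close>)
    then show "\<exists>q val' m'. (fin, 0\<^sub>v (S * k)) = (q, block_vec S k val' m') \<and>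
      ((code q0, token X0, 0), (q, val', m')) \<in> (counter_step Z S)\<^sup>* \<and> m' < S"
      using v block_vec_zero[OF \<open>m < S\<close> \<open>0 < k\<close>] by metis
  qed
qed

end

section \<open>Codes of the matrices and vectors\<close>

text \<open>A list code without its closing bit, so that the codes of consecutive blocks
  concatenate.\<close>

definition block_code :: "nat \<Rightarrow> (nat \<Rightarrow> int) \<Rightarrow> bool list" where
  "block_code k h = concat (map (\<lambda>x. True # enc_int (h x)) [0..<k])"

definition unit_code :: "nat \<Rightarrow> nat \<Rightarrow> bool list" where
  "unit_code k y = block_code k (\<lambda>x. if x = y then 1 else 0)"

definition zero_code :: "nat \<Rightarrow> bool list" where
  "zero_code k = block_code k (\<lambda>_. 0)"

text \<open>The rotation reads from the next block, hence the column \<open>Suc i\<close>. The first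
  bit belongs to the list of rows, the last one closes the row itself.\<close>

definition row_code :: "nat \<Rightarrow> nat \<Rightarrow> nat \<Rightarrow> nat \<Rightarrow> bool list" where
  "row_code S k i r =
     True # concat (map (\<lambda>j. if j = Suc i then unit_code k r else zero_code k) [0..<S]) @ [False]"

definition last_row_code :: "nat \<Rightarrow> nat \<Rightarrow> nat \<Rightarrow> bool list" where
  "last_row_code S k r = True # unit_code k r @ concat (replicate (S - 1) (zero_code k)) @ [False]"

lemma concat_map_blocks:
  "concat (map f [0..<S * k]) = concat (map (\<lambda>j. concat (map (\<lambda>a. f (j * k + a)) [0..<k])) [0..<S])"
proof (induction S)
  case (Suc S)
  have "[0..<Suc S * k] = [0..<S * k] @ [S * k..<S * k + k]"
    by (metis add.commute le_add1 mult_Suc upt_add_eq_append zero_le)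
  moreover have "[S * k..<S * k + k] = map (\<lambda>a. S * k + a) [0..<k]"
    by (rule nth_equalityI) auto
  ultimately show ?case using Suc by (simp add: comp_def)
qed simp

lemma enc_list_eq: "enc_list e (map f [0..<n]) = concat (map (\<lambda>x. True # e (f x)) [0..<n]) @ [False]"
  by (simp add: enc_list_def comp_def)

lemma enc_vec_blocks:
  "enc_vec (vec (S * k) g) = concat (map (\<lambda>j. block_code k (\<lambda>a. g (j * k + a))) [0..<S]) @ [False]"
proof -
  have "list_of_vec (vec (S * k) g) = map g [0..<S * k]"
    by (rule nth_equalityI) (auto simp: list_of_vec_index)
  then show ?thesis
    by (simp add: enc_vec_def enc_list_eq concat_map_blocks block_code_def)
qed

lemma enc_mat_blocks:
  "enc_mat (mat (S * k) (S * k) g) =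
     concat (map (\<lambda>i. concat (map (\<lambda>r. True # concat (map (\<lambda>j. block_code k (\<lambda>a. g (i * k + r, j * k + a))) [0..<S]) @ [False])
       [0..<k])) [0..<S]) @ [False]"
proof -
  have "mat_to_list (mat (S * k) (S * k) g) = map (\<lambda>i. map (\<lambda>j. g (i, j)) [0..<S * k]) [0..<S * k]"
    by (auto simp: mat_to_list_def)
  then show ?thesis
    by (simp add: enc_mat_def enc_list_eq concat_map_blocks block_code_def)
qed

lemma block_eq_iff:
  fixes k :: nat
  assumes "a < k" "r < k"
  shows "j * k + a = i * k + r \<longleftrightarrow> j = i \<and> a = r"
proof
  assume *: "j * k + a = i * k + r"
  have "(j * k + a) div k = j" "(i * k + r) div k = i" using assms by auto
  with * show "j = i \<and> a = r" by simp
qed simp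

lemma concat_map_const: "(\<And>x. x \<in> set xs \<Longrightarrow> f x = c) \<Longrightarrow> concat (map f xs) = concat (replicate (length xs) c)"
  by (induction xs) auto

text \<open>Only the last \<open>k\<close> rows depend on the rule; all others shift by one block
  and can be printed in the same way for every rule.\<close>

lemma enc_rotation_mat:
  assumes "a < k" "c < k" "S \<ge> 1"
  shows "enc_mat (rotation_mat S k a c) =
    concat (map (\<lambda>i. concat (map (row_code S k i) [0..<k])) [0..<S - 1]) @
    concat (map (\<lambda>r. last_row_code S k (swap_letters a c r)) [0..<k]) @ [False]"
proof -
  obtain S' where S: "S = Suc S'" using assms by (cases S) auto
  let ?row = "\<lambda>i r. True # concat (map (\<lambda>j. block_code k (\<lambda>x. if j * k + x = rotation S k a c (i * k + r) then 1 else 0)) [0..<S]) @ [False]"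
  have row: "?row i r = row_code S k i r" if "i < S'" "r < k" for i r
  proof -
    have "Suc i * k \<le> S' * k" using that by (intro mult_le_mono1) simp
    then have "i * k + r < S' * k" using that by simp
    then have rot: "rotation S k a c (i * k + r) = Suc i * k + r" by (simp add: rotation_def S)
    have "block_code k (\<lambda>x. if j * k + x = rotation S k a c (i * k + r) then 1 else 0)
        = (if j = Suc i then unit_code k r else zero_code k)" for j
      unfolding rot unit_code_def zero_code_def block_code_def
      using block_eq_iff[OF _ that(2), of _ j "Suc i"] by (auto intro!: arg_cong[where f = concat])
    then show ?thesis unfolding row_code_def by presburger
  qed
  have last: "?row S' r = last_row_code S k (swap_letters a c r)" if "r < k" for r
  proof -
    have less: "swap_letters a c r < k" using swap_letters_less assms that by simp
    have rot: "rotation S k a c (S' * k + r) = 0 * k + swap_letters a c r" by (simp add: rotation_def S)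
    have "block_code k (\<lambda>x. if j * k + x = rotation S k a c (S' * k + r) then 1 else 0)
        = (if j = 0 then unit_code k (swap_letters a c r) else zero_code k)" for j
      unfolding rot unit_code_def zero_code_def block_code_def
      using block_eq_iff[OF _ less, of _ j 0] by (auto intro!: arg_cong[where f = concat])
    moreover have "concat (map (\<lambda>j. if j = 0 then unit_code k (swap_letters a c r) else zero_code k) [0..<S])
        = unit_code k (swap_letters a c r) @ concat (replicate (S - 1) (zero_code k))"
      by (simp add: S upt_conv_Cons del: upt_Suc) (subst concat_map_const[where c = "zero_code k"]; auto)
    ultimately show ?thesis unfolding last_row_code_def by (simp add: append_assoc)
  qed
  have "enc_mat (rotation_mat S k a c) = concat (map (\<lambda>i. concat (map (?row i) [0..<k])) [0..<S]) @ [False]"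
    unfolding rotation_mat_def enc_mat_blocks by simp
  also have "concat (map (\<lambda>i. concat (map (?row i) [0..<k])) [0..<S])
      = concat (map (\<lambda>i. concat (map (?row i) [0..<k])) [0..<S']) @ concat (map (?row S') [0..<k])"
    by (simp add: S)
  also have "map (?row S') [0..<k] = map (\<lambda>r. last_row_code S k (swap_letters a c r)) [0..<k]"
    using last by (intro map_cong) auto
  also have "map (\<lambda>i. concat (map (?row i) [0..<k])) [0..<S'] = map (\<lambda>i. concat (map (row_code S k i) [0..<k])) [0..<S']"
    using row by (intro map_cong arg_cong[where f = concat]) auto
  finally show ?thesis by (simp add: S)
qed

lemma enc_last_block_vec:
  assumes "c < k" "S \<ge> 1"
  shows "enc_vec (last_block_vec S k c z) =
    concat (replicate (S - 1) (zero_code k)) @ block_code k (\<lambda>x. if x = c then z else 0) @ [False]"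
proof -
  obtain S' where S: "S = Suc S'" using assms by (cases S) auto
  have "block_code k (\<lambda>x. if j * k + x = S' * k + c then z else 0)
      = (if j = S' then block_code k (\<lambda>x. if x = c then z else 0) else zero_code k)" for j
    unfolding zero_code_def block_code_def
    using block_eq_iff[OF _ assms(1), of _ j S'] by (auto intro!: arg_cong[where f = concat])
  then show ?thesis
    unfolding last_block_vec_def enc_vec_blocks
    by (simp add: S) (subst concat_map_const[where c = "zero_code k"]; simp)
qed

lemma enc_block_vec_token:
  assumes "k > 0"
  shows "enc_vec (block_vec S k (token X) 0) = concat (map (\<lambda>j. unit_code k (X j)) [0..<S]) @ [False]"
proof -
  have "block_code k (\<lambda>a. token X ((0 + (j * k + a) div k) mod S) ((j * k + a) mod k)) = unit_code k (X j)"
    if "j < S" for j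
    unfolding unit_code_def block_code_def token_def using that
    by (intro arg_cong[where f = concat] map_cong) auto
  then show ?thesis unfolding block_vec_def enc_vec_blocks
    by (auto intro!: arg_cong[where f = concat] map_cong)
qed

lemma enc_zero_vec: "enc_vec (0\<^sub>v (S * k)) = concat (replicate S (zero_code k)) @ [False]"
  unfolding zero_vec_def enc_vec_blocks zero_code_def
  by (subst concat_map_const[where c = "zero_code k"]) (auto simp: zero_code_def)

section \<open>While programs on Turing machine tapes\<close>

datatype prog =
    Skip
  | Wr nat nat move
  | Mv nat move
  | Seq prog prog
  | If nat "nat set" prog prog
  | While nat "nat set" prog

type_synonym tape_state = "nat \<Rightarrow> tape"

definition scan :: "tape_state \<Rightarrow> nat \<Rightarrow> nat" where
  "scan \<sigma> i = fst (\<sigma> i) (snd (\<sigma> i))"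

text \<open>The next continuation and the actions depend only on the current continuation and the
  scanned symbols, which is the form of a transition function. Tapes that are not addressed get
  their own symbol back.\<close>

fun ctrl_step :: "prog list \<Rightarrow> (nat \<Rightarrow> nat) \<Rightarrow> prog list \<times> (nat \<Rightarrow> nat \<times> move)" where
  "ctrl_step [] s = ([], \<lambda>i. (s i, Stay))"
| "ctrl_step (Skip # ks) s = (ks, \<lambda>i. (s i, Stay))"
| "ctrl_step (Wr i a m # ks) s = (ks, (\<lambda>j. (s j, Stay))(i := (a, m)))"
| "ctrl_step (Mv i m # ks) s = (ks, (\<lambda>j. (s j, Stay))(i := (s i, m)))"
| "ctrl_step (Seq p q # ks) s = (p # q # ks, \<lambda>i. (s i, Stay))"
| "ctrl_step (If i A p q # ks) s = ((if s i \<in> A then p else q) # ks, \<lambda>i. (s i, Stay))"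
| "ctrl_step (While i A p # ks) s = ((if s i \<in> A then p # While i A p # ks else ks), \<lambda>i. (s i, Stay))"

definition prog_step :: "prog list \<times> tape_state \<Rightarrow> prog list \<times> tape_state" where
  "prog_step = (\<lambda>(ks, \<sigma>). case ctrl_step ks (scan \<sigma>) of (ks', acts) \<Rightarrow> (ks', \<lambda>i. act (\<sigma> i) (acts i)))"

text \<open>The number of steps is chosen before the continuation \<open>ks\<close>, so one and the
  same execution can precede any remaining program; this makes \<open>runs\<close>
  compositional.\<close>

definition runs :: "prog \<Rightarrow> tape_state \<Rightarrow> tape_state \<Rightarrow> nat \<Rightarrow> bool" where
  "runs p \<sigma> \<sigma>' t \<longleftrightarrow> (\<exists>t' \<le> t. \<forall>ks. (prog_step ^^ t') (p # ks, \<sigma>) = (ks, \<sigma>'))"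

lemma act_scan_Stay [simp]: "act (\<sigma> i) (scan \<sigma> i, Stay) = \<sigma> i"
  by (cases "\<sigma> i") (simp add: scan_def)

lemma runs_mono: "runs p \<sigma> \<sigma>' t \<Longrightarrow> t \<le> t' \<Longrightarrow> runs p \<sigma> \<sigma>' t'"
  unfolding runs_def by (meson le_trans)

lemma runs_step:
  assumes "\<And>ks. prog_step (p # ks, \<sigma>) = (ks, \<sigma>')"
  shows "runs p \<sigma> \<sigma>' 1"
  unfolding runs_def using assms by (intro exI[of _ 1]) auto

lemma runs_Skip: "runs Skip \<sigma> \<sigma> 1"
  by (rule runs_step) (simp add: prog_step_def)

lemma runs_Wr: "runs (Wr i a m) \<sigma> (\<sigma>(i := act (\<sigma> i) (a, m))) 1"
  by (rule runs_step) (auto simp: prog_step_def)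

lemma runs_Mv: "runs (Mv i m) \<sigma> (\<sigma>(i := (fst (\<sigma> i), move_head m (snd (\<sigma> i))))) 1"
proof -
  have "act (\<sigma> i) (scan \<sigma> i, m) = (fst (\<sigma> i), move_head m (snd (\<sigma> i)))"
    by (cases "\<sigma> i") (simp add: scan_def)
  then show ?thesis
    by (intro runs_step) (auto simp: prog_step_def)
qed

lemma prog_step_chain:
  assumes "(prog_step ^^ a) x = y" "(prog_step ^^ b) y = z"
  shows "(prog_step ^^ (a + b)) x = z"
  using assms by (simp add: add.commute[of a] funpow_add)

lemma runs_Seq:
  assumes "runs p \<sigma> \<sigma>1 t1" "runs q \<sigma>1 \<sigma>2 t2"
  shows "runs (Seq p q) \<sigma> \<sigma>2 (t1 + t2 + 1)"
proof -
  obtain a b where ab: "a \<le> t1" "b \<le> t2"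
    "\<And>ks. (prog_step ^^ a) (p # ks, \<sigma>) = (ks, \<sigma>1)"
    "\<And>ks. (prog_step ^^ b) (q # ks, \<sigma>1) = (ks, \<sigma>2)"
    using assms unfolding runs_def by blast
  have "(prog_step ^^ (1 + (a + b))) (Seq p q # ks, \<sigma>) = (ks, \<sigma>2)" for ks
    by (intro prog_step_chain[OF _ prog_step_chain[OF ab(3) ab(4)]]) (simp add: prog_step_def)
  then show ?thesis unfolding runs_def using ab(1,2) by (intro exI[of _ "1 + (a + b)"]) auto
qed

lemma runs_If:
  assumes "scan \<sigma> i \<in> A \<Longrightarrow> runs p \<sigma> \<sigma>' t" "scan \<sigma> i \<notin> A \<Longrightarrow> runs q \<sigma> \<sigma>' t"
  shows "runs (If i A p q) \<sigma> \<sigma>' (t + 1)"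
proof -
  have "runs (if scan \<sigma> i \<in> A then p else q) \<sigma> \<sigma>' t" using assms by simp
  then obtain a where a: "a \<le> t"
    "\<And>ks. (prog_step ^^ a) ((if scan \<sigma> i \<in> A then p else q) # ks, \<sigma>) = (ks, \<sigma>')"
    unfolding runs_def by blast
  have "(prog_step ^^ (1 + a)) (If i A p q # ks, \<sigma>) = (ks, \<sigma>')" for ks
    by (intro prog_step_chain[OF _ a(2)]) (simp add: prog_step_def)
  then show ?thesis unfolding runs_def using a(1) by (intro exI[of _ "1 + a"]) auto
qed

text \<open>In place of a loop invariant, \<open>st\<close> gives the states between the rounds,
  whose number \<open>m\<close> is known in advance.\<close>

lemma runs_While:
  assumes "\<And>j. j < m \<Longrightarrow> scan (st j) i \<in> A" "\<And>j. j < m \<Longrightarrow> runs p (st j) (st (Suc j)) t"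
    and "scan (st m) i \<notin> A"
  shows "runs (While i A p) (st 0) (st m) (m * (t + 1) + 1)"
  using assms
proof (induction m arbitrary: st)
  case 0
  then show ?case by (auto intro!: runs_step[unfolded One_nat_def] simp: prog_step_def)
next
  case (Suc m)
  have "runs (While i A p) (st 1) (st (Suc m)) (m * (t + 1) + 1)"
    using Suc.IH[of "\<lambda>j. st (Suc j)"] Suc.prems by force
  then obtain b where b: "b \<le> m * (t + 1) + 1"
    "\<And>ks. (prog_step ^^ b) (While i A p # ks, st 1) = (ks, st (Suc m))"
    unfolding runs_def by blast
  obtain a where a: "a \<le> t" "\<And>ks. (prog_step ^^ a) (p # ks, st 0) = (ks, st 1)"
    using Suc.prems(2)[of 0] unfolding runs_def by auto
  have "(prog_step ^^ (1 + (a + b))) (While i A p # ks, st 0) = (ks, st (Suc m))" for ks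
    by (intro prog_step_chain[OF _ prog_step_chain[OF a(2) b(2)]])
      (use Suc.prems(1)[of 0] in \<open>simp add: prog_step_def\<close>)
  then show ?case unfolding runs_def using a(1) b(1) by (intro exI[of _ "1 + (a + b)"]) auto
qed

section \<open>From programs to Turing machines\<close>

fun wf_prog :: "nat \<Rightarrow> prog \<Rightarrow> bool" where
  "wf_prog K Skip = True"
| "wf_prog K (Wr i a m) = (i < K \<and> a < 4)"
| "wf_prog K (Mv i m) = (i < K)"
| "wf_prog K (Seq p q) = (wf_prog K p \<and> wf_prog K q)"
| "wf_prog K (If i A p q) = (i < K \<and> wf_prog K p \<and> wf_prog K q)"
| "wf_prog K (While i A p) = (i < K \<and> wf_prog K p)"

text \<open>The continuations that can occur while executing a program in front of \<open>ks\<close>, apart from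
  \<open>ks\<close> itself. That there are only finitely many makes them usable as control states.\<close>

fun conts :: "prog \<Rightarrow> prog list \<Rightarrow> prog list set" where
  "conts (Seq p q) ks = insert (Seq p q # ks) (conts p (q # ks) \<union> conts q ks)"
| "conts (If i A p q) ks = insert (If i A p q # ks) (conts p ks \<union> conts q ks)"
| "conts (While i A p) ks = insert (While i A p # ks) (conts p (While i A p # ks))"
| "conts p ks = {p # ks}"

lemma finite_conts: "finite (conts p ks)"
  by (induction p ks rule: conts.induct) auto

lemma conts_self: "p # ks \<in> conts p ks"
  by (cases p) auto

lemma conts_closed:
  "l \<in> conts p ks \<Longrightarrow> fst (ctrl_step l s) \<in> insert ks (conts p ks)"
proof (induction p arbitrary: ks)
  case (Seq p q)
  then show ?case using conts_self[of p "q # ks"] conts_self[of q ks] by fastforce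
next
  case (If i A p q)
  have "p # ks \<in> conts (If i A p q) ks" "q # ks \<in> conts (If i A p q) ks"
    using conts_self[of p ks] conts_self[of q ks] by auto
  then show ?case using If.IH[of ks] If.prems by (auto simp del: insert_iff split: if_splits)
next
  case (While i A p)
  then show ?case using conts_self[of p "While i A p # ks"] by fastforce
qed auto

lemma conts_wf:
  "l \<in> conts p ks \<Longrightarrow> wf_prog K p \<Longrightarrow> list_all (wf_prog K) ks \<Longrightarrow> list_all (wf_prog K) l"
proof (induction p arbitrary: ks)
  case (Seq p q)
  then show ?case using Seq.IH(1)[of "q # ks"] by auto
next
  case (While i A p)
  then show ?case using While.IH[of "While i A p # ks"] by auto
qed auto

text \<open>Program states have infinitely many tapes and the machine has \<open>K\<close>; a
  well-formed program cannot tell the difference.\<close>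

lemma ctrl_step_local:
  assumes "list_all (wf_prog K) ks" "\<And>i. i < K \<Longrightarrow> s i = s' i"
  shows "fst (ctrl_step ks s) = fst (ctrl_step ks s')"
    "i < K \<Longrightarrow> snd (ctrl_step ks s) i = snd (ctrl_step ks s') i"
  using assms by (cases "(ks, s)" rule: ctrl_step.cases; auto)+

lemma ctrl_step_symbols:
  assumes "list_all (wf_prog K) ks" "\<And>i. i < K \<Longrightarrow> s i < 4" "i < K"
  shows "fst (snd (ctrl_step ks s) i) < 4"
  using assms by (cases "(ks, s)" rule: ctrl_step.cases) auto

definition init_tapes :: "bool list \<Rightarrow> tape_state" where
  "init_tapes w = (\<lambda>i. (tape_contents (if i = 0 then w else []), 0))"

text \<open>The continuations of \<open>p\<close> are numbered and become control states; the
  machine accepts when nothing is left to be executed.\<close>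

lemma computable_by_prog:
  assumes K: "K \<ge> 1" and wf: "wf_prog K p"
    and run: "\<And>w. \<exists>\<sigma>. runs p (init_tapes w) \<sigma> (T (length w)) \<and> fst (\<sigma> (K - 1)) = tape_contents (f w)"
  shows "\<exists>M. turing_machine M \<and> computes_in_time M f T"
proof -
  define C where "C = insert [] (conts p [])"
  have "finite C" unfolding C_def by (simp add: finite_conts)
  then obtain g where g: "bij_betw g {0..<card C} C"
    using ex_bij_betw_nat_finite by blast
  define h where "h = inv_into {0..<card C} g"
  have gh: "g (h ks) = ks" "h ks < card C" if "ks \<in> C" for ks
    using that g unfolding h_def
    by (auto simp: bij_betw_inv_into_right dest: bij_betwE[OF bij_betw_inv_into])
  have gC: "g n \<in> C" if "n < card C" for n
    using that g bij_betwE by fastforce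
  have wfC: "list_all (wf_prog K) ks" if "ks \<in> C" for ks
    using that conts_wf[OF _ wf] unfolding C_def by auto
  have closed: "fst (ctrl_step ks s) \<in> C" if "ks \<in> C" for ks s
    using that conts_closed unfolding C_def by fastforce
  define dl where "dl = (\<lambda>q as. if q < card C
      then case ctrl_step (g q) (\<lambda>i. as ! i) of (ks, acts) \<Rightarrow> (h ks, map acts [0..<K])
      else (q, map (\<lambda>a. (a, Stay)) as))"
  \<comment> \<open>The rejecting state must differ from the accepting one, so it gets a number
    beyond all continuations; there \<open>dl\<close> leaves the tapes unchanged.\<close>
  define M where "M = \<lparr>tapes = K, symbols = 4, states = card C + 1, start = h [p],
    accept = h [], reject = card C, delta = dl\<rparr>"
  have C: "[] \<in> C" "[p] \<in> C" by (auto simp: C_def conts_self)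
  have "turing_machine M"
  proof -
    have "case dl q as of (q', acts) \<Rightarrow>
           q' < card C + 1 \<and> length acts = K \<and> fst ` set acts \<subseteq> {..<4}"
      if "q < card C + 1" "length as = K" "set as \<subseteq> {..<4}" for q as
    proof (cases "q < card C")
      case True
      obtain ks acts where ka: "ctrl_step (g q) (\<lambda>i. as ! i) = (ks, acts)" by force
      have "ks \<in> C" using closed[OF gC[OF True], of "\<lambda>i. as ! i"] ka by simp
      moreover have "fst (acts i) < 4" if "i < K" for i
        using ctrl_step_symbols[OF wfC[OF gC[OF True]], of "\<lambda>i. as ! i" i] that ka
          \<open>length as = K\<close> \<open>set as \<subseteq> {..<4}\<close> by (auto dest: nth_mem)
      ultimately show ?thesis using True ka gh(2) unfolding dl_def by (force simp: less_Suc_eq)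
    next
      case False
      then show ?thesis using that unfolding dl_def by (auto simp: image_image)
    qed
    then show ?thesis
      using K gh(2)[OF C(1)] gh(2)[OF C(2)] unfolding turing_machine_def M_def by auto
  qed
  define conf where "conf = (\<lambda>(ks, \<sigma>). (h ks, map \<sigma> [0..<K]) :: tm_config)"
  have hinj: "h ks = h [] \<longleftrightarrow> ks = []" if "ks \<in> C" for ks
    using gh(1)[OF that] gh(1)[OF C(1)] by metis
  have sim: "tm_step M (conf (ks, \<sigma>)) = conf (prog_step (ks, \<sigma>)) \<and> fst (prog_step (ks, \<sigma>)) \<in> C"
    if ks: "ks \<in> C" for ks \<sigma>
  proof (cases "ks = []")
    case True
    then show ?thesis using C by (simp add: tm_step_def halted_def conf_def M_def prog_step_def)
  next
    case False
    obtain ks' acts where ka: "ctrl_step ks (scan \<sigma>) = (ks', acts)" by force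
    have nh: "\<not> halted M (conf (ks, \<sigma>))"
      using False hinj[OF ks] gh(2)[OF ks] by (auto simp: halted_def conf_def M_def)
    \<comment> \<open>The machine sees a list of \<open>K\<close> symbols, which agrees with
      \<open>scan\<close> only at indices below \<open>K\<close>; locality transfers the
      step.\<close>
    obtain acts' where ka': "ctrl_step ks (\<lambda>i. map (\<lambda>(f, i). f i) (map \<sigma> [0..<K]) ! i) = (ks', acts')"
      and acts': "\<And>i. i < K \<Longrightarrow> acts' i = acts i"
    proof -
      have eq: "map (\<lambda>(f, i). f i) (map \<sigma> [0..<K]) ! i = scan \<sigma> i" if "i < K" for i
        using that by (simp add: scan_def split_beta)
      show ?thesis
        using ctrl_step_local[OF wfC[OF ks], of "\<lambda>i. map (\<lambda>(f, i). f i) (map \<sigma> [0..<K]) ! i" "scan \<sigma>", OF eq]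
          ka that by (metis fst_conv snd_conv surj_pair)
    qed
    have "map2 act (map \<sigma> [0..<K]) (map acts' [0..<K]) = map (\<lambda>i. act (\<sigma> i) (acts i)) [0..<K]"
      by (rule nth_equalityI) (auto simp: acts')
    moreover have "delta M (fst (conf (ks, \<sigma>))) (map (\<lambda>(f, i). f i) (snd (conf (ks, \<sigma>))))
        = (h ks', map acts' [0..<K])"
      using ka' gh[OF ks] by (simp add: M_def dl_def conf_def)
    ultimately have "tm_step M (conf (ks, \<sigma>)) = conf (prog_step (ks, \<sigma>))"
      using nh ka by (simp add: tm_step_def conf_def prog_step_def)
    then show ?thesis using closed[OF ks, of "scan \<sigma>"] ka by (simp add: prog_step_def)
  qed
  have sims: "(tm_step M ^^ t) (conf ([p], \<sigma>)) = conf ((prog_step ^^ t) ([p], \<sigma>))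
      \<and> fst ((prog_step ^^ t) ([p], \<sigma>)) \<in> C" for t \<sigma>
  proof (induction t)
    case 0
    then show ?case using C by simp
  next
    case (Suc t)
    then show ?case
      using sim[of "fst ((prog_step ^^ t) ([p], \<sigma>))" "snd ((prog_step ^^ t) ([p], \<sigma>))"] by simp
  qed
  have "computes_in_time M f T"
    unfolding computes_in_time_def
  proof
    fix w
    obtain \<sigma> where \<sigma>: "runs p (init_tapes w) \<sigma> (T (length w))" "fst (\<sigma> (K - 1)) = tape_contents (f w)"
      using run by blast
    then obtain t where t: "t \<le> T (length w)" "(prog_step ^^ t) ([p], init_tapes w) = ([], \<sigma>)"
      unfolding runs_def by blast
    have "initial_config M w = conf ([p], init_tapes w)"
    proof -
      have "[0..<K] = 0 # [1..<K]" using K by (simp add: upt_conv_Cons)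
      moreover have "map (init_tapes w) [1..<K] = replicate (K - 1) (tape_contents [], 0)"
        by (rule nth_equalityI) (auto simp: init_tapes_def)
      ultimately show ?thesis
        by (simp add: initial_config_def conf_def M_def init_tapes_def)
    qed
    then have "tm_run M w t = conf ([], \<sigma>)"
      using sims[of t "init_tapes w"] t by (simp add: tm_run_def)
    moreover have "last (map \<sigma> [0..<K]) = \<sigma> (K - 1)"
      using K by (simp add: last_map)
    ultimately show "\<exists>t\<le>T (length w). halted M (tm_run M w t) \<and> fst (last (snd (tm_run M w t))) = tape_contents (f w)"
      using t \<sigma>(2) by (intro exI[of _ t]) (simp add: conf_def halted_def M_def)
  qed
  with \<open>turing_machine M\<close> show ?thesis by blast
qed

section \<open>Programs that append to an output tape\<close>

definition tp :: "nat list \<Rightarrow> nat \<Rightarrow> tape" where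
  "tp xs h = ((\<lambda>i. if i < length xs then xs ! i else 0), h)"

definition bit_symbol :: "bool \<Rightarrow> nat" where
  "bit_symbol b = (if b then 3 else 2)"

lemma tape_contents_tp: "tape_contents w = fst (tp (1 # map bit_symbol w) h)"
  by (auto simp: tape_contents_def tp_def bit_symbol_def fun_eq_iff nth_Cons')

lemma scan_tp: "\<sigma> i = tp xs h \<Longrightarrow> scan \<sigma> i = (if h < length xs then xs ! h else 0)"
  by (simp add: scan_def tp_def)

lemma act_tp: "h < length xs \<Longrightarrow> act (tp xs h) (a, m) = tp (xs[h := a]) (move_head m h)"
  by (auto simp: tp_def fun_eq_iff)

lemma act_tp_append: "act (tp xs (length xs)) (a, m) = tp (xs @ [a]) (move_head m (length xs))"
  by (auto simp: tp_def fun_eq_iff nth_append)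

definition out_tape :: "bool list \<Rightarrow> tape" where
  "out_tape bs = tp (1 # map bit_symbol bs) (length bs + 1)"

text \<open>The output tape is overridden on both sides and the bits printed earlier are arbitrary.
  So \<open>\<sigma>\<close> and \<open>\<sigma>'\<close> matter only on the other tapes, and the
  outputs of consecutive programs concatenate.\<close>

definition emits :: "nat \<Rightarrow> prog \<Rightarrow> tape_state \<Rightarrow> tape_state \<Rightarrow> bool list \<Rightarrow> nat \<Rightarrow> bool" where
  "emits out p \<sigma> \<sigma>' cs t \<longleftrightarrow>
     (\<forall>bs. runs p (\<sigma>(out := out_tape bs)) (\<sigma>'(out := out_tape (bs @ cs))) t)"

lemma emits_mono: "emits out p \<sigma> \<sigma>' cs t \<Longrightarrow> t \<le> t' \<Longrightarrow> emits out p \<sigma> \<sigma>' cs t'"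
  unfolding emits_def using runs_mono by blast

lemma emits_conv:
  "emits out p \<sigma> \<sigma>' cs t \<Longrightarrow> \<sigma> = \<tau> \<Longrightarrow> \<sigma>' = \<tau>' \<Longrightarrow> cs = ds \<Longrightarrow> t \<le> t' \<Longrightarrow> emits out p \<tau> \<tau>' ds t'"
  using emits_mono by blast

lemma emits_Skip: "emits out Skip \<sigma> \<sigma> [] 1"
  unfolding emits_def using runs_Skip by simp

lemma emits_Seq:
  "emits out p \<sigma> \<tau> cs t1 \<Longrightarrow> emits out q \<tau> \<sigma>2 ds t2 \<Longrightarrow> emits out (Seq p q) \<sigma> \<sigma>2 (cs @ ds) (t1 + t2 + 1)"
  unfolding emits_def using runs_Seq by (metis append_assoc)

lemma emits_If:
  assumes "i \<noteq> out" "scan \<sigma> i \<in> A \<Longrightarrow> emits out p \<sigma> \<sigma>' cs t" "scan \<sigma> i \<notin> A \<Longrightarrow> emits out q \<sigma> \<sigma>' cs t"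
  shows "emits out (If i A p q) \<sigma> \<sigma>' cs (t + 1)"
proof -
  have sc: "scan (\<sigma>(out := X)) i = scan \<sigma> i" for X using assms(1) by (simp add: scan_def)
  show ?thesis unfolding emits_def
  proof (intro allI runs_If)
    fix bs
    show "runs p (\<sigma>(out := out_tape bs)) (\<sigma>'(out := out_tape (bs @ cs))) t"
      if "scan (\<sigma>(out := out_tape bs)) i \<in> A"
      using assms(2) that unfolding sc emits_def by blast
    show "runs q (\<sigma>(out := out_tape bs)) (\<sigma>'(out := out_tape (bs @ cs))) t"
      if "scan (\<sigma>(out := out_tape bs)) i \<notin> A"
      using assms(3) that unfolding sc emits_def by blast
  qed
qed

lemma emits_While:
  assumes i: "i \<noteq> out" and "\<And>j. j < m \<Longrightarrow> scan (st j) i \<in> A"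
    and "\<And>j. j < m \<Longrightarrow> emits out p (st j) (st (Suc j)) (cs j) t" and "scan (st m) i \<notin> A"
  shows "emits out (While i A p) (st 0) (st m) (concat (map cs [0..<m])) (m * (t + 1) + 1)"
  unfolding emits_def
proof
  fix bs
  have sc: "scan (\<sigma>(out := X)) i = scan \<sigma> i" for X \<sigma> using i by (simp add: scan_def)
  let ?st = "\<lambda>j. (st j)(out := out_tape (bs @ concat (map cs [0..<j])))"
  have "runs p (?st j) (?st (Suc j)) t" if "j < m" for j
  proof -
    have "runs p (?st j) ((st (Suc j))(out := out_tape ((bs @ concat (map cs [0..<j])) @ cs j))) t"
      using assms(3)[OF that] unfolding emits_def by blast
    then show ?thesis by simp
  qed
  then have "runs (While i A p) (?st 0) (?st m) (m * (t + 1) + 1)"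
    by (intro runs_While) (use assms(2,4) in \<open>simp_all only: sc not_False_eq_True\<close>)
  then show "runs (While i A p) ((st 0)(out := out_tape bs)) ((st m)(out := out_tape (bs @ concat (map cs [0..<m])))) (m * (t + 1) + 1)"
    by simp
qed

lemma emits_While_silent:
  assumes "i \<noteq> out" "\<And>j. j < m \<Longrightarrow> scan (st j) i \<in> A"
    and "\<And>j. j < m \<Longrightarrow> emits out p (st j) (st (Suc j)) [] t" and "scan (st m) i \<notin> A"
  shows "emits out (While i A p) (st 0) (st m) [] (m * (t + 1) + 1)"
proof -
  have "concat (map (\<lambda>_. []) [0..<m]) = ([] :: bool list)" by (induction m) auto
  moreover have "emits out (While i A p) (st 0) (st m) (concat (map (\<lambda>_. []) [0..<m])) (m * (t + 1) + 1)"
    using assms by (intro emits_While) auto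
  ultimately show ?thesis by (rule back_subst[of "\<lambda>cs. emits out (While i A p) (st 0) (st m) cs (m * (t + 1) + 1)", rotated])
qed

lemma emits_Mv:
  assumes "i \<noteq> out" "\<sigma> i = tp xs h" "\<sigma>' = \<sigma>(i := tp xs (move_head m h))"
  shows "emits out (Mv i m) \<sigma> \<sigma>' [] 1"
  unfolding emits_def
proof
  fix bs
  have "(\<sigma>(out := out_tape bs))(i := (fst ((\<sigma>(out := out_tape bs)) i), move_head m (snd ((\<sigma>(out := out_tape bs)) i))))
      = \<sigma>'(out := out_tape (bs @ []))"
    using assms by (auto simp: tp_def)
  then show "runs (Mv i m) (\<sigma>(out := out_tape bs)) (\<sigma>'(out := out_tape (bs @ []))) 1"
    using runs_Mv by metis
qed

lemma emits_Wr:
  assumes "i \<noteq> out" "\<sigma>' = \<sigma>(i := act (\<sigma> i) (a, m))"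
  shows "emits out (Wr i a m) \<sigma> \<sigma>' [] 1"
  unfolding emits_def
proof
  fix bs
  have "(\<sigma>(out := out_tape bs))(i := act ((\<sigma>(out := out_tape bs)) i) (a, m)) = \<sigma>'(out := out_tape (bs @ []))"
    using assms by auto
  then show "runs (Wr i a m) (\<sigma>(out := out_tape bs)) (\<sigma>'(out := out_tape (bs @ []))) 1"
    using runs_Wr by metis
qed

fun emit :: "nat \<Rightarrow> bool list \<Rightarrow> prog" where
  "emit out [] = Skip"
| "emit out (b # bs) = Seq (Wr out (bit_symbol b) Right) (emit out bs)"

lemma emits_emit: "emits out (emit out cs) \<sigma> \<sigma> cs (2 * length cs + 1)"
proof (induction cs)
  case Nil
  then show ?case by (simp add: emits_Skip[unfolded One_nat_def])
next
  case (Cons c cs)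
  have "emits out (Wr out (bit_symbol c) Right) \<sigma> \<sigma> [c] 1"
    unfolding emits_def
  proof
    fix bs
    have "act (out_tape bs) (bit_symbol c, Right) = out_tape (bs @ [c])"
      using act_tp_append[of "1 # map bit_symbol bs" "bit_symbol c" Right] by (simp add: out_tape_def)
    then show "runs (Wr out (bit_symbol c) Right) (\<sigma>(out := out_tape bs)) (\<sigma>(out := out_tape (bs @ [c]))) 1"
      using runs_Wr[of out "bit_symbol c" Right "\<sigma>(out := out_tape bs)"] by simp
  qed
  from emits_Seq[OF this Cons.IH] show ?case by simp
qed

definition seqs :: "prog list \<Rightarrow> prog" where
  "seqs ps = foldr Seq ps Skip"

lemma emits_seqs:
  assumes "\<And>x. x \<in> set xs \<Longrightarrow> emits out (f x) \<sigma> \<sigma> (c x) t"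
  shows "emits out (seqs (map f xs)) \<sigma> \<sigma> (concat (map c xs)) (length xs * (t + 1) + 1)"
  using assms
proof (induction xs)
  case Nil
  then show ?case by (simp add: seqs_def emits_Skip[unfolded One_nat_def])
next
  case (Cons x xs)
  then have "emits out (Seq (f x) (seqs (map f xs))) \<sigma> \<sigma> (c x @ concat (map c xs)) (t + (length xs * (t + 1) + 1) + 1)"
    by (intro emits_Seq) auto
  then show ?case by (simp add: seqs_def algebra_simps)
qed

lemma emits_chain:
  assumes "\<And>j. j < m \<Longrightarrow> emits out (f j) (st j) (st (Suc j)) [] t"
  shows "emits out (seqs (map f [0..<m])) (st 0) (st m) [] (m * (t + 1) + 1)"
proof -
  \<comment> \<open>\<open>seqs\<close> is taken apart from the front, so the claim is generalised
    to an arbitrary first index.\<close>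
  have "emits out (seqs (map f [i..<i + n])) (st i) (st (i + n)) [] (n * (t + 1) + 1)"
    if "i + n \<le> m" for i n
    using that
  proof (induction n arbitrary: i)
    case 0
    then show ?case by (simp add: seqs_def emits_Skip[unfolded One_nat_def])
  next
    case (Suc n)
    have "emits out (Seq (f i) (seqs (map f [Suc i..<Suc i + n]))) (st i) (st (Suc i + n)) ([] @ []) (t + (n * (t + 1) + 1) + 1)"
      using Suc.IH[of "Suc i"] Suc.prems
      by (intro emits_Seq[where \<tau> = "st (Suc i)"] assms) (simp_all del: upt_Suc)
    moreover have "seqs (map f [i..<i + Suc n]) = Seq (f i) (seqs (map f [Suc i..<Suc i + n]))"
      by (simp add: upt_conv_Cons seqs_def del: upt_Suc)
    ultimately show ?case by (auto intro: emits_conv)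
  qed
  from this[of 0 m] show ?thesis by simp
qed

section \<open>Passes over a tape\<close>

definition rewind :: "nat \<Rightarrow> prog" where
  "rewind i = While i (- {1}) (Mv i Left)"

text \<open>As the contents behind cell 0 avoid the symbol 1 and blanks are 0, the first 1 met on
  the way left is the end marker, even if the head starts beyond the contents.\<close>

lemma emits_rewind:
  assumes "i \<noteq> out" "\<sigma> i = tp (1 # ys) h" "1 \<notin> set ys" "\<sigma>' = \<sigma>(i := tp (1 # ys) 0)"
  shows "emits out (rewind i) \<sigma> \<sigma>' [] (2 * h + 1)"
proof -
  let ?st = "\<lambda>j. \<sigma>(i := tp (1 # ys) (h - j))"
  have "emits out (rewind i) (?st 0) (?st h) [] (h * (1 + 1) + 1)"
    unfolding rewind_def
  proof (rule emits_While_silent[OF assms(1)])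
    fix j assume j: "j < h"
    show "scan (?st j) i \<in> - {1}"
    proof (cases "h - j < length (1 # ys)")
      case True
      then have "ys ! (h - j - 1) \<in> set ys" using j by (intro nth_mem) auto
      then have "ys ! (h - j - 1) \<noteq> 1" using assms(3) by metis
      then show ?thesis using True j by (simp add: scan_def tp_def nth_Cons')
    qed (simp add: scan_def tp_def)
    show "emits out (Mv i Left) (?st j) (?st (Suc j)) [] 1"
      using assms(1) by (intro emits_Mv[where xs = "1 # ys" and h = "h - j"]) auto
  qed (simp add: scan_def tp_def)
  moreover have "?st 0 = \<sigma>" using assms(2) by (simp add: fun_upd_idem)
  ultimately show ?thesis using assms(4) by (auto intro: emits_conv)
qed

definition pass :: "nat \<Rightarrow> nat \<Rightarrow> bool list \<Rightarrow> bool list \<Rightarrow> prog" where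
  "pass out i c2 c3 = While i {2, 3} (Seq (If i {3} (emit out c3) (emit out c2)) (Mv i Right))"

definition select_code :: "bool list \<Rightarrow> bool list \<Rightarrow> nat \<Rightarrow> bool list" where
  "select_code c2 c3 x = (if x = 3 then c3 else c2)"

lemma emits_select:
  assumes "i \<noteq> out" "scan \<sigma> i = x"
  shows "emits out (If i {3} (emit out c3) (emit out c2)) \<sigma> \<sigma> (select_code c2 c3 x)
    (2 * (length c2 + length c3) + 2)"
proof -
  have "emits out (If i {3} (emit out c3) (emit out c2)) \<sigma> \<sigma> (select_code c2 c3 x)
    ((2 * (length c2 + length c3) + 1) + 1)"
    using assms by (intro emits_If) (auto simp: select_code_def intro: emits_mono[OF emits_emit])
  then show ?thesis by simp
qed

lemma emits_pass:
  assumes "i \<noteq> out" "\<sigma> i = tp (1 # ys) (Suc h)" "set ys \<subseteq> {2, 3}" "h \<le> length ys"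
    "\<sigma>' = \<sigma>(i := tp (1 # ys) (Suc (length ys)))"
  shows "emits out (pass out i c2 c3) \<sigma> \<sigma>' (concat (map (select_code c2 c3) (drop h ys)))
    (length ys * (2 * (length c2 + length c3) + 5) + 1)"
proof -
  let ?st = "\<lambda>j. \<sigma>(i := tp (1 # ys) (Suc (h + j)))"
  let ?m = "length ys - h"
  have "emits out (pass out i c2 c3) (?st 0) (?st ?m) (concat (map (\<lambda>j. select_code c2 c3 (ys ! (h + j))) [0..<?m]))
    (?m * ((2 * (length c2 + length c3) + 2 + 1 + 1) + 1) + 1)"
    unfolding pass_def
  proof (rule emits_While[OF assms(1)])
    fix j assume j: "j < ?m"
    have sc: "scan (?st j) i = ys ! (h + j)" using j by (simp add: scan_def tp_def)
    have "ys ! (h + j) \<in> set ys" using j by (intro nth_mem) auto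
    with assms(3) have "ys ! (h + j) \<in> {2, 3}" ..
    then show "scan (?st j) i \<in> {2, 3}" unfolding sc .
    have "emits out (Seq (If i {3} (emit out c3) (emit out c2)) (Mv i Right)) (?st j) (?st (Suc j))
      (select_code c2 c3 (ys ! (h + j)) @ []) (2 * (length c2 + length c3) + 2 + 1 + 1)"
      using assms(1) sc
      by (intro emits_Seq[OF emits_select emits_Mv[where xs = "1 # ys" and h = "Suc (h + j)"]]) auto
    then show "emits out (Seq (If i {3} (emit out c3) (emit out c2)) (Mv i Right)) (?st j) (?st (Suc j))
      (select_code c2 c3 (ys ! (h + j))) (2 * (length c2 + length c3) + 2 + 1 + 1)" by simp
  qed (use assms(4) in \<open>simp add: scan_def tp_def\<close>)
  moreover have "?st 0 = \<sigma>" using assms(2) by (simp add: fun_upd_idem)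
  moreover have "?st ?m = \<sigma>'" using assms(4,5) by simp
  moreover have "map (\<lambda>j. select_code c2 c3 (ys ! (h + j))) [0..<?m] = map (select_code c2 c3) (drop h ys)"
    using assms(4) by (intro nth_equalityI) auto
  moreover have "?m * ((2 * (length c2 + length c3) + 2 + 1 + 1) + 1) + 1 \<le> length ys * (2 * (length c2 + length c3) + 5) + 1"
    by (rule add_mono[OF mult_le_mono]) auto
  ultimately show ?thesis by (auto intro: emits_mono)
qed

definition full_pass :: "nat \<Rightarrow> nat \<Rightarrow> bool list \<Rightarrow> bool list \<Rightarrow> prog" where
  "full_pass out i c2 c3 = Seq (Mv i Right) (Seq (pass out i c2 c3) (rewind i))"

text \<open>Skipping one cell gives \<open>S - 1\<close> rounds: the number of zero blocks beside
  the special one in a last row or an increment vector.\<close>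

definition tail_pass :: "nat \<Rightarrow> nat \<Rightarrow> bool list \<Rightarrow> bool list \<Rightarrow> prog" where
  "tail_pass out i c2 c3 = Seq (Mv i Right) (Seq (Mv i Right) (Seq (pass out i c2 c3) (rewind i)))"

text \<open>The constant terms add up to 7 for \<open>full_pass\<close> and to 9 for
  \<open>tail_pass\<close>; 12 covers both.\<close>

definition pass_time :: "nat \<Rightarrow> nat \<Rightarrow> nat" where
  "pass_time n l = n * (2 * l + 5) + 2 * n + 12"

lemma one_notin: "set ys \<subseteq> {2, 3} \<Longrightarrow> (1::nat) \<notin> set ys"
  by auto

lemma emits_full_pass:
  assumes "i \<noteq> out" "\<sigma> i = tp (1 # ys) 0" "set ys \<subseteq> {2, 3}"
  shows "emits out (full_pass out i c2 c3) \<sigma> \<sigma> (concat (map (select_code c2 c3) ys))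
    (pass_time (length ys) (length c2 + length c3))"
proof -
  let ?\<sigma> = "\<lambda>h. \<sigma>(i := tp (1 # ys) h)"
  have 1: "emits out (Mv i Right) \<sigma> (?\<sigma> 1) [] 1"
    using assms(1,2) by (intro emits_Mv[where xs = "1 # ys" and h = 0]) auto
  have 2: "emits out (pass out i c2 c3) (?\<sigma> 1) (?\<sigma> (Suc (length ys))) (concat (map (select_code c2 c3) (drop 0 ys)))
      (length ys * (2 * (length c2 + length c3) + 5) + 1)"
    using assms by (intro emits_pass) auto
  have 3: "emits out (rewind i) (?\<sigma> (Suc (length ys))) \<sigma> [] (2 * Suc (length ys) + 1)"
    using assms(1,2) one_notin[OF assms(3)] by (intro emits_rewind[where ys = ys]) auto
  show ?thesis
    unfolding full_pass_def by (rule emits_conv[OF emits_Seq[OF 1 emits_Seq[OF 2 3]]]) (auto simp: pass_time_def)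
qed

lemma emits_tail_pass:
  assumes "i \<noteq> out" "\<sigma> i = tp (1 # ys) 0" "set ys \<subseteq> {2, 3}" "ys \<noteq> []"
  shows "emits out (tail_pass out i c2 c3) \<sigma> \<sigma> (concat (map (select_code c2 c3) (tl ys)))
    (pass_time (length ys) (length c2 + length c3))"
proof -
  let ?\<sigma> = "\<lambda>h. \<sigma>(i := tp (1 # ys) h)"
  have 0: "emits out (Mv i Right) \<sigma> (?\<sigma> 1) [] 1"
    using assms(1,2) by (intro emits_Mv[where xs = "1 # ys" and h = 0]) auto
  have 1: "emits out (Mv i Right) (?\<sigma> 1) (?\<sigma> (Suc 1)) [] 1"
    using assms(1) by (intro emits_Mv[where xs = "1 # ys" and h = 1]) auto
  have 2: "emits out (pass out i c2 c3) (?\<sigma> (Suc 1)) (?\<sigma> (Suc (length ys))) (concat (map (select_code c2 c3) (drop 1 ys)))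
      (length ys * (2 * (length c2 + length c3) + 5) + 1)"
    using assms by (intro emits_pass) (auto simp: Suc_le_eq)
  have 3: "emits out (rewind i) (?\<sigma> (Suc (length ys))) \<sigma> [] (2 * Suc (length ys) + 1)"
    using assms(1,2) one_notin[OF assms(3)] by (intro emits_rewind[where ys = ys]) auto
  show ?thesis
    unfolding tail_pass_def
    by (rule emits_conv[OF emits_Seq[OF 0 emits_Seq[OF 1 emits_Seq[OF 2 3]]]]) (auto simp: pass_time_def drop_Suc)
qed

section \<open>Printing matrices and vectors\<close>

lemma length_block_code:
  assumes "\<And>x. \<bar>h x\<bar> \<le> 1"
  shows "length (block_code k h) \<le> 5 * k"
proof -
  \<comment> \<open>The codes of 1 and -1 are the longest: a sign bit, one digit with its preceding
    bit, and a closing bit. The list bit in front of each entry gives the factor 5.\<close>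
  have "length (enc_int (h x)) \<le> 4" for x
  proof -
    have "h x = 0 \<or> h x = 1 \<or> h x = - 1" using assms[of x] by linarith
    then show ?thesis
      by (elim disjE) (simp_all add: enc_int_def enc_nat_def enc_list_def binary_digits.simps)
  qed
  then have "sum_list (map (\<lambda>x. length (True # enc_int (h x))) [0..<k]) \<le> sum_list (map (\<lambda>x. 5) [0..<k])"
    by (intro sum_list_mono) simp
  then show ?thesis by (simp add: block_code_def length_concat comp_def sum_list_triv)
qed

lemma length_unit_code: "length (unit_code k y) \<le> 5 * k"
  unfolding unit_code_def by (rule length_block_code) simp

lemma length_zero_code: "length (zero_code k) \<le> 5 * k"
  unfolding zero_code_def by (rule length_block_code) simp

lemma pass_time_mono: "n \<le> n' \<Longrightarrow> l \<le> l' \<Longrightarrow> pass_time n l \<le> pass_time n' l'"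
  unfolding pass_time_def by (intro add_mono mult_le_mono) auto

definition unary :: "nat \<Rightarrow> nat \<Rightarrow> tape" where
  "unary x h = tp (1 # replicate x 2) h"

lemma act_unary: "act (unary x (Suc x)) (2, Right) = unary (Suc x) (Suc (Suc x))"
  using act_tp_append[of "1 # replicate x 2" 2 Right]
  by (simp add: unary_def replicate_append_same)

lemma emits_Mv_unary:
  "i \<noteq> out \<Longrightarrow> \<sigma> i = unary x h \<Longrightarrow> \<sigma>' = \<sigma>(i := unary x (move_head m h)) \<Longrightarrow> emits out (Mv i m) \<sigma> \<sigma>' [] 1"
  unfolding unary_def by (rule emits_Mv)

lemma emits_rewind_unary:
  "i \<noteq> out \<Longrightarrow> \<sigma> i = unary x h \<Longrightarrow> \<sigma>' = \<sigma>(i := unary x 0) \<Longrightarrow> emits out (rewind i) \<sigma> \<sigma>' [] (2 * h + 1)"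
  unfolding unary_def by (rule emits_rewind) auto

lemma scan_unary: "\<sigma> i = unary x h \<Longrightarrow> scan \<sigma> i = (if h = 0 then 1 else if h \<le> x then 2 else 0)"
  unfolding unary_def by (subst scan_tp) (auto simp: nth_Cons')

definition row_prog :: "nat \<Rightarrow> nat \<Rightarrow> nat \<Rightarrow> nat \<Rightarrow> prog" where
  "row_prog out u k r =
     Seq (emit out [True]) (Seq (full_pass out u (zero_code k) (unit_code k r)) (emit out [False]))"

definition last_row_prog :: "nat \<Rightarrow> nat \<Rightarrow> nat \<Rightarrow> nat \<Rightarrow> prog" where
  "last_row_prog out u k r =
     Seq (emit out (True # unit_code k r)) (Seq (tail_pass out u (zero_code k) (zero_code k)) (emit out [False]))"

text \<open>The block row that is being printed is remembered by the symbol 3 in the column of its only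
  nonzero block.\<close>

definition mat_prog :: "nat \<Rightarrow> nat \<Rightarrow> nat \<Rightarrow> nat \<Rightarrow> nat \<Rightarrow> prog" where
  "mat_prog out u k a c =
     Seq (Mv u Right) (Seq (Mv u Right) (Seq
       (While u {2} (Seq (Wr u 3 Stay) (Seq (rewind u) (Seq (seqs (map (row_prog out u k) [0..<k]))
         (Seq (While u {1, 2} (Mv u Right)) (Wr u 2 Right))))))
       (Seq (rewind u) (Seq (seqs (map (\<lambda>r. last_row_prog out u k (swap_letters a c r)) [0..<k])) (emit out [False])))))"

definition row_time :: "nat \<Rightarrow> nat \<Rightarrow> nat" where
  "row_time S k = 3 + (pass_time S (10 * k) + 3 + 1) + 1"

definition last_row_time :: "nat \<Rightarrow> nat \<Rightarrow> nat" where
  "last_row_time S k = (2 * (5 * k + 1) + 1) + (pass_time S (10 * k) + 3 + 1) + 1"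

definition mat_body_time :: "nat \<Rightarrow> nat \<Rightarrow> nat" where
  "mat_body_time S k = 1 + ((2 * (S + 2) + 1) + ((k * (row_time S k + 1) + 1) + (((S + 2) * (1 + 1) + 1) + 1 + 1) + 1) + 1) + 1"

definition mat_time :: "nat \<Rightarrow> nat \<Rightarrow> nat" where
  "mat_time S k = 1 + (1 + ((S * (mat_body_time S k + 1) + 1) +
     ((2 * (S + 1) + 1) + ((k * (last_row_time S k + 1) + 1) + 3 + 1) + 1) + 1) + 1) + 1"

lemma emits_row:
  assumes "u \<noteq> out" "i + 1 < S" "\<sigma> u = tp (1 # (replicate S 2)[Suc i := 3]) 0"
  shows "emits out (row_prog out u k r) \<sigma> \<sigma> (row_code S k i r) (row_time S k)"
proof -
  let ?ys = "(replicate S 2)[Suc i := 3 :: nat]"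
  have ys: "set ?ys \<subseteq> {2, 3}" using set_update_subset_insert[of "replicate S (2::nat)" "Suc i" 3] by auto
  have "map (select_code (zero_code k) (unit_code k r)) ?ys
      = map (\<lambda>j. if j = Suc i then unit_code k r else zero_code k) [0..<S]"
    by (rule nth_equalityI) (auto simp: select_code_def nth_list_update)
  moreover have "length (zero_code k) + length (unit_code k r) \<le> 10 * k"
    using length_zero_code[of k] length_unit_code[of k r] by simp
  ultimately show ?thesis
    unfolding row_prog_def row_code_def
    by (intro emits_conv[OF emits_Seq[OF emits_emit emits_Seq[OF emits_full_pass[where i = u and \<sigma> = \<sigma>, OF assms(1,3) ys] emits_emit]]])
      (auto simp: row_time_def intro: pass_time_mono)
qed

lemma map_select_replicate: "map (select_code c2 c3) (replicate n 2) = replicate n c2"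
  by (simp add: select_code_def)

lemma emits_tail_zeros:
  assumes "u \<noteq> out" "\<sigma> u = unary S 0" "S \<ge> 1"
  shows "emits out (tail_pass out u (zero_code k) (zero_code k)) \<sigma> \<sigma> (concat (replicate (S - 1) (zero_code k)))
    (pass_time S (10 * k))"
proof -
  obtain S' where S: "S = Suc S'" using assms(3) by (cases S) auto
  have "emits out (tail_pass out u (zero_code k) (zero_code k)) \<sigma> \<sigma>
     (concat (map (select_code (zero_code k) (zero_code k)) (tl (replicate S (2::nat)))))
     (pass_time (length (replicate S (2::nat))) (length (zero_code k) + length (zero_code k)))"
    using assms by (intro emits_tail_pass) (auto simp: unary_def)
  then show ?thesis
    using length_zero_code[of k]
    by (elim emits_conv) (auto simp: S select_code_def map_select_replicate intro!: pass_time_mono)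
qed

lemma emits_zeros:
  assumes "u \<noteq> out" "\<sigma> u = unary S 0"
  shows "emits out (full_pass out u (zero_code k) (zero_code k)) \<sigma> \<sigma> (concat (replicate S (zero_code k)))
    (pass_time S (10 * k))"
proof -
  have "emits out (full_pass out u (zero_code k) (zero_code k)) \<sigma> \<sigma>
     (concat (map (select_code (zero_code k) (zero_code k)) (replicate S (2::nat))))
     (pass_time (length (replicate S (2::nat))) (length (zero_code k) + length (zero_code k)))"
    using assms by (intro emits_full_pass) (auto simp: unary_def)
  then show ?thesis
    using length_zero_code[of k]
    by (elim emits_conv) (auto simp: select_code_def map_select_replicate intro!: pass_time_mono)
qed

lemma emits_last_row:
  assumes "u \<noteq> out" "\<sigma> u = unary S 0" "S \<ge> 1"
  shows "emits out (last_row_prog out u k r) \<sigma> \<sigma> (last_row_code S k r) (last_row_time S k)"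
  unfolding last_row_prog_def last_row_code_def
  by (rule emits_conv[OF emits_Seq[OF emits_emit emits_Seq[OF emits_tail_zeros[where u = u and \<sigma> = \<sigma> and S = S, OF assms] emits_emit]]])
    (use length_unit_code[of k r] in \<open>auto simp: last_row_time_def\<close>)

text \<open>Behind the end marker, block column \<open>Suc j\<close> has cell
  \<open>Suc (Suc j)\<close>. Printing a row rewinds the head, so the cell is found again by running
  over 1 and 2 up to the mark, which is erased with a step to the next cell.\<close>

lemma emits_mat_body:
  assumes u: "u \<noteq> out" and j: "j + 1 < S" and \<sigma>: "\<sigma> u = unary S (Suc (Suc j))"
    and \<sigma>': "\<sigma>' = \<sigma>(u := unary S (Suc (Suc (Suc j))))"
  shows "emits out (Seq (Wr u 3 Stay) (Seq (rewind u) (Seq (seqs (map (row_prog out u k) [0..<k]))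
         (Seq (While u {1, 2} (Mv u Right)) (Wr u 2 Right))))) \<sigma> \<sigma>'
     (concat (map (row_code S k j) [0..<k])) (mat_body_time S k)"
proof -
  let ?ys = "(replicate S 2)[Suc j := 3 :: nat]"
  let ?\<tau> = "\<lambda>h. \<sigma>(u := tp (1 # ?ys) h)"
  have "(1::nat) \<notin> set ?ys" using set_update_subset_insert[of "replicate S (2::nat)" "Suc j" 3] by auto
  note nin = this
  have 1: "emits out (Wr u 3 Stay) \<sigma> (?\<tau> (Suc (Suc j))) [] 1"
    using u \<sigma> j by (intro emits_Wr) (auto simp: unary_def act_tp)
  have 2: "emits out (rewind u) (?\<tau> (Suc (Suc j))) (?\<tau> 0) [] (2 * (Suc (Suc j)) + 1)"
    using u nin by (intro emits_rewind[where ys = ?ys]) auto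
  have 3: "emits out (seqs (map (row_prog out u k) [0..<k])) (?\<tau> 0) (?\<tau> 0) (concat (map (row_code S k j) [0..<k]))
      (length [0..<k] * (row_time S k + 1) + 1)"
    using u j by (intro emits_seqs emits_row) auto
  have 4: "emits out (While u {1, 2} (Mv u Right)) (?\<tau> 0) (?\<tau> (Suc (Suc j))) [] (Suc (Suc j) * (1 + 1) + 1)"
  proof (rule emits_While_silent[where st = ?\<tau>, OF u])
    fix i assume i: "i < Suc (Suc j)"
    show "scan (?\<tau> i) u \<in> {1, 2}" using i j by (auto simp: scan_def tp_def nth_Cons')
    show "emits out (Mv u Right) (?\<tau> i) (?\<tau> (Suc i)) [] 1"
      using u by (intro emits_Mv[where xs = "1 # ?ys" and h = i]) auto
  qed (use j in \<open>simp add: scan_def tp_def\<close>)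
  have 5: "emits out (Wr u 2 Right) (?\<tau> (Suc (Suc j))) \<sigma>' [] 1"
  proof (rule emits_Wr[OF u])
    have "(1 # ?ys)[Suc (Suc j) := 2] = 1 # replicate S 2"
      using list_update_id[of "replicate S (2::nat)" "Suc j"] j by simp
    then have "act (tp (1 # ?ys) (Suc (Suc j))) (2, Right) = unary S (Suc (Suc (Suc j)))"
      using j act_tp[of "Suc (Suc j)" "1 # ?ys" 2 Right] by (simp add: unary_def)
    then show "\<sigma>' = (?\<tau> (Suc (Suc j)))(u := act (?\<tau> (Suc (Suc j)) u) (2, Right))"
      by (simp add: \<sigma>')
  qed
  show ?thesis
    by (rule emits_conv[OF emits_Seq[OF 1 emits_Seq[OF 2 emits_Seq[OF 3 emits_Seq[OF 4 5]]]]])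
      (use j in \<open>auto simp: mat_body_time_def\<close>)
qed

lemma emits_mat:
  assumes u: "u \<noteq> out" and \<sigma>: "\<sigma> u = unary S 0" and S: "S \<ge> 1" and ac: "a < k" "c < k"
  shows "emits out (mat_prog out u k a c) \<sigma> \<sigma> (enc_mat (rotation_mat S k a c)) (mat_time S k)"
proof -
  let ?\<tau> = "\<lambda>h. \<sigma>(u := unary S h)"
  let ?body = "Seq (Wr u 3 Stay) (Seq (rewind u) (Seq (seqs (map (row_prog out u k) [0..<k]))
         (Seq (While u {1, 2} (Mv u Right)) (Wr u 2 Right))))"
  have 1: "emits out (Mv u Right) \<sigma> (?\<tau> 1) [] 1"
    using u \<sigma> by (intro emits_Mv_unary[where h = 0]) auto
  have 2: "emits out (Mv u Right) (?\<tau> 1) (?\<tau> (Suc (Suc 0))) [] 1"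
    using u by (intro emits_Mv_unary[where h = 1]) auto
  \<comment> \<open>From cell 2 on, the loop meets the \<open>S - 1\<close> block columns other than
    the first and stops on the blank in cell \<open>S + 1\<close>. The last block row, with its
    nonzero block in column 0, is printed separately.\<close>
  have 3: "emits out (While u {2} ?body) (?\<tau> (Suc (Suc 0))) (?\<tau> (Suc (Suc (S - 1))))
      (concat (map (\<lambda>j. concat (map (row_code S k j) [0..<k])) [0..<S - 1])) ((S - 1) * (mat_body_time S k + 1) + 1)"
  proof (rule emits_While[where st = "\<lambda>j. ?\<tau> (Suc (Suc j))", OF u])
    fix j assume j: "j < S - 1"
    show "scan (?\<tau> (Suc (Suc j))) u \<in> {2}" using j by (subst scan_unary[where x = S]) auto
    show "emits out ?body (?\<tau> (Suc (Suc j))) (?\<tau> (Suc (Suc (Suc j)))) (concat (map (row_code S k j) [0..<k])) (mat_body_time S k)"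
      using j by (intro emits_mat_body[OF u]) auto
  next
    show "scan (?\<tau> (Suc (Suc (S - 1)))) u \<notin> {2}" using S by (subst scan_unary[where x = S]) auto
  qed
  have 4: "emits out (rewind u) (?\<tau> (Suc (Suc (S - 1)))) \<sigma> [] (2 * Suc (Suc (S - 1)) + 1)"
    using u \<sigma> by (intro emits_rewind_unary) auto
  have 5: "emits out (seqs (map (\<lambda>r. last_row_prog out u k (swap_letters a c r)) [0..<k])) \<sigma> \<sigma>
      (concat (map (\<lambda>r. last_row_code S k (swap_letters a c r)) [0..<k])) (length [0..<k] * (last_row_time S k + 1) + 1)"
    using u \<sigma> S by (intro emits_seqs emits_last_row)
  have le: "(S - 1) * (mat_body_time S k + 1) \<le> S * (mat_body_time S k + 1)" by (rule mult_le_mono1) simp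
  show ?thesis
    unfolding mat_prog_def enc_rotation_mat[OF ac S]
    by (rule emits_conv[OF emits_Seq[OF 1 emits_Seq[OF 2 emits_Seq[OF 3 emits_Seq[OF 4 emits_Seq[OF 5 emits_emit]]]]]])
      (use S le in \<open>auto simp: mat_time_def\<close>)
qed

section \<open>Printing transitions and the initial vector\<close>

definition rule_prog :: "nat \<Rightarrow> nat \<Rightarrow> nat \<Rightarrow> counter_rule \<Rightarrow> prog" where
  "rule_prog out u k = (\<lambda>(p, a, c, z, q).
     Seq (emit out (True # enc_nat p)) (Seq (mat_prog out u k a c)
       (Seq (tail_pass out u (zero_code k) (zero_code k))
         (emit out (block_code k (\<lambda>x. if x = c then z else 0) @ [False] @ enc_nat q)))))"

definition rule_time :: "nat \<Rightarrow> nat \<Rightarrow> counter_rule \<Rightarrow> nat" where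
  "rule_time S k = (\<lambda>(p, a, c, z, q). (2 * length (True # enc_nat p) + 1) + (mat_time S k +
     (pass_time S (10 * k) + (2 * length (block_code k (\<lambda>x. if x = c then z else 0) @ [False] @ enc_nat q) + 1) + 1) + 1) + 1)"

lemma emits_rule:
  assumes u: "u \<noteq> out" and \<sigma>: "\<sigma> u = unary S 0" and S: "S \<ge> 1" and ac: "a < k" "c < k"
  shows "emits out (rule_prog out u k (p, a, c, z, q)) \<sigma> \<sigma> (True # enc_transition (rule_transition S k (p, a, c, z, q)))
    (rule_time S k (p, a, c, z, q))"
  unfolding rule_prog_def rule_time_def prod.case
  by (rule emits_conv[OF emits_Seq[OF emits_emit emits_Seq[OF emits_mat[where u = u and \<sigma> = \<sigma> and S = S, OF assms]
      emits_Seq[OF emits_tail_zeros[where u = u and \<sigma> = \<sigma> and S = S, OF u \<sigma> S] emits_emit]]]])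
    (auto simp: enc_transition_def rule_transition_def enc_last_block_vec[OF ac(2) S])

lemma emits_seqs_sum:
  assumes "\<And>x. x \<in> set xs \<Longrightarrow> emits out (f x) \<sigma> \<sigma> (c x) (t x)"
  shows "emits out (seqs (map f xs)) \<sigma> \<sigma> (concat (map c xs)) (sum_list (map (\<lambda>x. t x + 1) xs) + 1)"
  using assms
proof (induction xs)
  case Nil
  then show ?case by (simp add: seqs_def emits_Skip[unfolded One_nat_def])
next
  case (Cons x xs)
  then have "emits out (Seq (f x) (seqs (map f xs))) \<sigma> \<sigma> (c x @ concat (map c xs))
      (t x + (sum_list (map (\<lambda>x. t x + 1) xs) + 1) + 1)"
    by (intro emits_Seq) auto
  then show ?case by (simp add: seqs_def algebra_simps)
qed

text \<open>The word of the initial configuration: the separator, cell 0, the input, and blanks.\<close>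

definition init_prog :: "nat \<Rightarrow> nat \<Rightarrow> nat \<Rightarrow> nat \<Rightarrow> prog" where
  "init_prog out u k G =
     Seq (Mv u Right) (Seq (emit out (unit_code k (2 * G) @ unit_code k (G + 1))) (Seq (Mv u Right) (Seq (Mv u Right) (Seq (Mv 0 Right)
       (Seq (While 0 {2, 3} (Seq (If 0 {3} (emit out (unit_code k 3)) (emit out (unit_code k 2))) (Seq (Mv 0 Right) (Mv u Right))))
         (Seq (rewind 0) (Seq (pass out u (unit_code k 0) (unit_code k 0)) (Seq (rewind u) (emit out [False])))))))))"

definition init_time :: "nat \<Rightarrow> nat \<Rightarrow> nat" where
  "init_time S k = 1 + ((2 * (10 * k) + 1) + (1 + (1 + (1 + ((S * ((2 * (10 * k) + 2 + (1 + 1 + 1) + 1) + 1) + 1) +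
    ((2 * S + 1) + ((S * (2 * (10 * k) + 5) + 1) + ((2 * (S + 1) + 1) + 3 + 1) + 1) + 1) + 1) + 1) + 1) + 1) + 1) + 1"

text \<open>Tape \<open>u\<close> measures the length of the word: its head advances by one cell per
  letter, for the separator and cell 0 and then in step with the input. The cells that remain are as
  many as the blanks still to be printed.\<close>

lemma emits_init:
  assumes u: "u \<noteq> out" "u \<noteq> 0" "out \<noteq> 0" and \<sigma>u: "\<sigma> u = unary S 0" and \<sigma>0: "\<sigma> 0 = tp (1 # map bit_symbol w) 0"
    and S: "length w + 2 \<le> S" and M: "symbols M = G" and k: "k > 0"
  shows "emits out (init_prog out u k G) \<sigma> \<sigma>
    (enc_vec (block_vec S k (token (tape_word M (tape_contents w) 0)) 0)) (init_time S k)"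
proof -
  let ?n = "length w"
  let ?W = "1 # map bit_symbol w"
  let ?\<tau> = "\<lambda>h. \<sigma>(u := unary S h)"
  let ?\<rho> = "\<lambda>h j. \<sigma>(u := unary S h, 0 := tp ?W j)"
  let ?sel = "select_code (unit_code k 2) (unit_code k 3)"
  have E: "length (unit_code k x) \<le> 5 * k" for x by (rule length_unit_code)
  have 1: "emits out (Mv u Right) \<sigma> (?\<tau> 1) [] 1"
    using u \<sigma>u by (intro emits_Mv_unary[where h = 0]) auto
  have 2: "emits out (Mv u Right) (?\<tau> 1) (?\<tau> (Suc (Suc 0))) [] 1"
    using u by (intro emits_Mv_unary[where h = 1]) auto
  have 3: "emits out (Mv u Right) (?\<tau> (Suc (Suc 0))) (?\<tau> (Suc (Suc (Suc 0)))) [] 1"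
    using u by (intro emits_Mv_unary[where h = "Suc (Suc 0)"]) auto
  have 4: "emits out (Mv 0 Right) (?\<tau> (Suc (Suc (Suc 0)))) (?\<rho> (Suc (Suc (Suc 0))) (Suc 0)) [] 1"
    using u \<sigma>0 by (intro emits_Mv[where xs = ?W and h = 0]) auto
  let ?st = "\<lambda>j. ?\<rho> (Suc (Suc (Suc j))) (Suc j)"
  let ?body = "Seq (If 0 {3} (emit out (unit_code k 3)) (emit out (unit_code k 2))) (Seq (Mv 0 Right) (Mv u Right))"
  have 5: "emits out (While 0 {2, 3} ?body) (?st 0) (?st ?n) (concat (map (\<lambda>j. ?sel (bit_symbol (w ! j))) [0..<?n]))
      (?n * ((2 * (10 * k) + 2 + (1 + 1 + 1) + 1) + 1) + 1)"
  proof (rule emits_While[where st = ?st])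
    fix j assume j: "j < ?n"
    have sc: "scan (?st j) 0 = bit_symbol (w ! j)"
      using j by (simp add: scan_def tp_def)
    then show "scan (?st j) 0 \<in> {2, 3}" by (simp add: bit_symbol_def)
    have a: "emits out (Mv 0 Right) (?st j) (?\<rho> (Suc (Suc (Suc j))) (Suc (Suc j))) [] 1"
      using u by (intro emits_Mv[where xs = ?W and h = "Suc j"]) auto
    have b: "emits out (Mv u Right) (?\<rho> (Suc (Suc (Suc j))) (Suc (Suc j))) (?st (Suc j)) [] 1"
      using u by (intro emits_Mv_unary[where h = "Suc (Suc (Suc j))"]) (auto simp: fun_eq_iff)
    show "emits out ?body (?st j) (?st (Suc j)) (?sel (bit_symbol (w ! j))) (2 * (10 * k) + 2 + (1 + 1 + 1) + 1)"
      by (rule emits_conv[OF emits_Seq[OF emits_select[OF u(3)[symmetric] sc] emits_Seq[OF a b]]])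
        (use E[of 2] E[of 3] in auto)
  qed (use u in \<open>auto simp: scan_def tp_def\<close>)
  have 6: "emits out (rewind 0) (?st ?n) (?\<tau> (Suc (Suc (Suc ?n)))) [] (2 * Suc ?n + 1)"
    using u \<sigma>0 by (intro emits_rewind[where ys = "map bit_symbol w"]) (auto simp: bit_symbol_def fun_eq_iff)
  have 7: "emits out (pass out u (unit_code k 0) (unit_code k 0)) (?\<tau> (Suc (Suc (Suc ?n)))) (?\<tau> (Suc (length (replicate S (2::nat)))))
      (concat (map (select_code (unit_code k 0) (unit_code k 0)) (drop (Suc (Suc ?n)) (replicate S 2))))
      (S * (2 * (10 * k) + 5) + 1)"
  proof (rule emits_mono[OF emits_pass])
    show "length (replicate S (2::nat)) * (2 * (length (unit_code k 0) + length (unit_code k 0)) + 5) + 1 \<le> S * (2 * (10 * k) + 5) + 1"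
      using E[of 0] by simp
  qed (use u S in \<open>auto simp: unary_def\<close>)
  have 8: "emits out (rewind u) (?\<tau> (Suc (length (replicate S (2::nat))))) \<sigma> [] (2 * Suc (length (replicate S (2::nat))) + 1)"
    using u \<sigma>u by (intro emits_rewind_unary) auto
  have n: "?n * ((2 * (10 * k) + 2 + (1 + 1 + 1) + 1) + 1) \<le> S * ((2 * (10 * k) + 2 + (1 + 1 + 1) + 1) + 1)"
    using S by (intro mult_le_mono1) simp
  \<comment> \<open>\<open>2 * G\<close> is the separator and \<open>G + 1\<close> the end marker
    under the head; the input bits are the symbols 2 and 3, and all later cells are blank.\<close>
  have code: "map (\<lambda>j. unit_code k (tape_word M (tape_contents w) 0 j)) [0..<S] =
      [unit_code k (2 * G), unit_code k (G + 1)] @ map (\<lambda>j. ?sel (bit_symbol (w ! j))) [0..<?n] @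
        replicate (S - (?n + 2)) (unit_code k 0)" (is "?l = ?r")
  proof (rule nth_equalityI)
    show "length ?l = length ?r" using S by simp
    fix j assume "j < length ?l"
    then have j: "j < S" by simp
    consider "j = 0" | "j = 1" | i where "j = Suc (Suc i)" "i < ?n" | i where "j = Suc (Suc i)" "i \<ge> ?n"
      by (metis One_nat_def not_less not0_implies_Suc)
    then show "?l ! j = ?r ! j"
    proof cases
      case 3
      then show ?thesis using j M
        by (simp add: tape_word_def plain_word_def tape_contents_def nth_append select_code_def bit_symbol_def)
    next
      case 4
      then have "i - ?n < S - (?n + 2)" using j by simp
      then show ?thesis using j M 4
        by (simp add: tape_word_def plain_word_def tape_contents_def nth_append)
    qed (use j M S in \<open>auto simp: tape_word_def plain_word_def tape_contents_def\<close>)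
  qed
  have lenE: "length (unit_code k (2 * G) @ unit_code k (G + 1)) \<le> 10 * k"
    using E[of "2 * G"] E[of "G + 1"] by simp
  have dr: "drop (Suc (Suc ?n)) (replicate S 2) = replicate (S - (?n + 2)) (2::nat)" by simp
  show ?thesis
    unfolding init_prog_def enc_block_vec_token[OF k] code
    by (rule emits_conv[OF emits_Seq[OF 1 emits_Seq[OF emits_emit emits_Seq[OF 2 emits_Seq[OF 3 emits_Seq[OF 4
        emits_Seq[OF 5 emits_Seq[OF 6 emits_Seq[OF 7 emits_Seq[OF 8 emits_emit]]]]]]]]]])
      (use n lenE S in \<open>auto simp: init_time_def dr select_code_def\<close>)
qed

section \<open>Unary powers and a binary counter\<close>

text \<open>For each cell of \<open>src\<close> the program appends one cell to \<open>dst\<close>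
  and one more for every nonblank cell of the input tape. There are n + 1 of these, counting the end
  marker; this gives the factor n + 2.\<close>

definition mult_prog :: "nat \<Rightarrow> nat \<Rightarrow> prog" where
  "mult_prog src dst = Seq (Mv dst Right) (Seq (Mv src Right) (Seq
     (While src {2} (Seq (Wr dst 2 Right) (Seq (While 0 {1, 2, 3} (Seq (Wr dst 2 Right) (Mv 0 Right)))
       (Seq (rewind 0) (Mv src Right)))))
     (Seq (rewind src) (rewind dst))))"

definition mult_time :: "nat \<Rightarrow> nat \<Rightarrow> nat" where
  "mult_time n a = 1 + (1 + ((a * ((1 + (((n + 1) * ((1 + 1 + 1) + 1) + 1) + ((2 * (n + 1) + 1) + 1 + 1) + 1) + 1) + 1) + 1) +
     ((2 * (a + 1) + 1) + (2 * (a * (n + 2) + 1) + 1) + 1) + 1) + 1) + 1"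

lemma emits_mult:
  assumes d: "src \<noteq> out" "dst \<noteq> out" "out \<noteq> 0" "src \<noteq> dst" "src \<noteq> 0" "dst \<noteq> 0"
    and \<sigma>0: "\<sigma> 0 = tp (1 # map bit_symbol w) 0" and src: "\<sigma> src = unary a 0" and dst: "\<sigma> dst = unary 0 0"
    and n: "length w = n" and \<sigma>': "\<sigma>' = \<sigma>(dst := unary (a * (n + 2)) 0)"
  shows "emits out (mult_prog src dst) \<sigma> \<sigma>' [] (mult_time n a)"
proof -
  let ?W = "1 # map bit_symbol w"
  let ?\<rho> = "\<lambda>x j h. \<sigma>(dst := unary x (Suc x), src := unary a j, 0 := tp ?W h)"
  let ?st = "\<lambda>j. ?\<rho> (j * (n + 2)) (Suc j) 0"
  let ?inner = "Seq (Wr dst 2 Right) (Mv 0 Right)"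
  let ?body = "Seq (Wr dst 2 Right) (Seq (While 0 {1, 2, 3} ?inner) (Seq (rewind 0) (Mv src Right)))"
  have wr: "emits out (Wr dst 2 Right) (?\<rho> x j h) (?\<rho> (Suc x) j h) [] 1" for x j h
    using d by (intro emits_Wr) (auto simp: act_unary fun_eq_iff)
  have mv0: "emits out (Mv 0 Right) (?\<rho> x j h) (?\<rho> x j (Suc h)) [] 1" for x j h
    using d by (intro emits_Mv[where xs = ?W and h = h]) auto
  have inner: "emits out ?inner (?\<rho> x j h) (?\<rho> (Suc x) j (Suc h)) [] (1 + 1 + 1)" for x j h
    by (rule emits_conv[OF emits_Seq[OF wr mv0]]) auto
  have loop: "emits out (While 0 {1, 2, 3} ?inner) (?\<rho> (x + 0) j 0) (?\<rho> (x + (n + 1)) j (n + 1)) [] ((n + 1) * ((1 + 1 + 1) + 1) + 1)" for x j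
  proof (rule emits_While_silent[where st = "\<lambda>h. ?\<rho> (x + h) j h"])
    fix h assume h: "h < n + 1"
    show "scan (?\<rho> (x + h) j h) 0 \<in> {1, 2, 3}"
      using h n by (auto simp: scan_def tp_def nth_Cons' bit_symbol_def)
    show "emits out ?inner (?\<rho> (x + h) j h) (?\<rho> (x + Suc h) j (Suc h)) [] (1 + 1 + 1)"
      using inner[of "x + h" j h] by simp
  qed (use d n in \<open>auto simp: scan_def tp_def\<close>)
  have rew: "emits out (rewind 0) (?\<rho> x j h) (?\<rho> x j 0) [] (2 * h + 1)" for x j h
    using d by (intro emits_rewind[where ys = "map bit_symbol w"]) (auto simp: bit_symbol_def)
  have mvs: "emits out (Mv src Right) (?\<rho> x j 0) (?\<rho> x (Suc j) 0) [] 1" for x j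
    using d by (intro emits_Mv_unary[where x = a and h = j]) (auto simp: fun_eq_iff)
  have body: "emits out ?body (?st j) (?st (Suc j)) [] (1 + (((n + 1) * ((1 + 1 + 1) + 1) + 1) + ((2 * (n + 1) + 1) + 1 + 1) + 1) + 1)" for j
    by (rule emits_conv[OF emits_Seq[OF wr emits_Seq[OF loop[of "Suc (j * (n + 2))", unfolded add_0_right] emits_Seq[OF rew mvs]]]]) (auto simp: ac_simps)
  have 1: "emits out (Mv dst Right) \<sigma> (\<sigma>(dst := unary 0 1)) [] 1"
    using d dst by (intro emits_Mv_unary[where h = 0]) auto
  have 2: "emits out (Mv src Right) (\<sigma>(dst := unary 0 1)) (?st 0) [] 1"
    using d src \<sigma>0 by (intro emits_Mv_unary[where x = a and h = 0]) (auto simp: fun_eq_iff)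
  have 3: "emits out (While src {2} ?body) (?st 0) (?st a) []
      (a * ((1 + (((n + 1) * ((1 + 1 + 1) + 1) + 1) + ((2 * (n + 1) + 1) + 1 + 1) + 1) + 1) + 1) + 1)"
  proof (rule emits_While_silent[where st = ?st, OF d(1) _ body])
    show "scan (?st j) src \<in> {2}" if "j < a" for j
      using that d by (subst scan_unary[where x = a and h = "Suc j"]) auto
    show "scan (?st a) src \<notin> {2}"
      using d by (subst scan_unary[where x = a and h = "Suc a"]) auto
  qed
  have 4: "emits out (rewind src) (?st a) (\<sigma>(dst := unary (a * (n + 2)) (Suc (a * (n + 2))))) [] (2 * Suc a + 1)"
    using d src \<sigma>0 by (intro emits_rewind_unary[where x = a]) (auto simp: fun_eq_iff)
  have 5: "emits out (rewind dst) (\<sigma>(dst := unary (a * (n + 2)) (Suc (a * (n + 2))))) \<sigma>' [] (2 * Suc (a * (n + 2)) + 1)"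
    using d \<sigma>' by (intro emits_rewind_unary) auto
  show ?thesis unfolding mult_prog_def
    by (rule emits_conv[OF emits_Seq[OF 1 emits_Seq[OF 2 emits_Seq[OF 3 emits_Seq[OF 4 5]]]]]) (auto simp: mult_time_def)
qed

text \<open>Tape \<open>j + 2\<close> receives the power with exponent \<open>j\<close>, computed
  from the preceding tape; with a fresh tape for each power nothing has to be copied or
  reset.\<close>

definition power_prog :: "nat \<Rightarrow> prog" where
  "power_prog e = Seq (Mv 2 Right) (Seq (Wr 2 2 Stay) (Seq (rewind 2)
     (seqs (map (\<lambda>j. mult_prog (j + 2) (j + 3)) [0..<e]))))"

definition power_time :: "nat \<Rightarrow> nat \<Rightarrow> nat" where
  "power_time e n = 1 + (1 + (3 + (e * (mult_time n ((n + 2) ^ e) + 1) + 1) + 1) + 1) + 1"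

definition power_tapes :: "nat \<Rightarrow> bool list \<Rightarrow> tape_state" where
  "power_tapes e w = (\<lambda>i. if i = 0 then tp (1 # map bit_symbol w) 0
     else if 2 \<le> i \<and> i \<le> e + 2 then unary ((length w + 2) ^ (i - 2)) 0 else unary 0 0)"

lemma mult_time_mono: "a \<le> a' \<Longrightarrow> mult_time n a \<le> mult_time n a'"
  unfolding mult_time_def by (intro add_mono mult_le_mono) auto

lemma init_tapes_unary: "init_tapes w i = (if i = 0 then tp (1 # map bit_symbol w) 0 else unary 0 0)"
proof (cases "i = 0")
  case True
  then show ?thesis by (simp add: init_tapes_def tape_contents_tp[of _ 0]) (simp add: tp_def)
next
  case False
  then show ?thesis by (simp add: init_tapes_def tape_contents_tp[of _ 0] unary_def) (simp add: tp_def)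
qed

lemma emits_power:
  assumes "out > e + 2"
  shows "emits out (power_prog e) (init_tapes w) (power_tapes e w) [] (power_time e (length w))"
proof -
  let ?n = "length w"
  let ?\<sigma> = "init_tapes w"
  have 1: "emits out (Mv 2 Right) ?\<sigma> (?\<sigma>(2 := unary 0 1)) [] 1"
    using assms by (intro emits_Mv_unary[where h = 0]) (auto simp: init_tapes_unary)
  have "act (unary 0 1) (2, Stay) = unary 1 1"
    using act_tp_append[of "[1]" 2 Stay] by (simp add: unary_def)
  then have 2: "emits out (Wr 2 2 Stay) (?\<sigma>(2 := unary 0 1)) (?\<sigma>(2 := unary 1 1)) [] 1"
    using assms by (intro emits_Wr) auto
  have 3: "emits out (rewind 2) (?\<sigma>(2 := unary 1 1)) (power_tapes 0 w) [] (2 * 1 + 1)"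
    using assms by (intro emits_rewind_unary[where h = 1]) (auto simp: power_tapes_def init_tapes_unary fun_eq_iff)
  have 4: "emits out (seqs (map (\<lambda>j. mult_prog (j + 2) (j + 3)) [0..<e])) (power_tapes 0 w) (power_tapes e w) []
      (e * (mult_time ?n ((?n + 2) ^ e) + 1) + 1)"
  proof (rule emits_chain[where st = "\<lambda>j. power_tapes j w"])
    fix j assume j: "j < e"
    have "emits out (mult_prog (j + 2) (j + 3)) (power_tapes j w) (power_tapes (Suc j) w) [] (mult_time ?n ((?n + 2) ^ j))"
    proof (rule emits_mult)
      show "power_tapes (Suc j) w = (power_tapes j w)(j + 3 := unary ((?n + 2) ^ j * (?n + 2)) 0)"
      proof
        fix i
        consider "i = j + 3" | "i < j + 3" | "i > j + 3" by linarith
        then show "power_tapes (Suc j) w i = ((power_tapes j w)(j + 3 := unary ((?n + 2) ^ j * (?n + 2)) 0)) i"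
          by cases (auto simp: power_tapes_def mult.commute)
      qed
    qed (use assms j in \<open>auto simp: power_tapes_def\<close>)
    moreover have "(?n + 2) ^ j \<le> (?n + 2) ^ e" using j by (intro power_increasing) auto
    ultimately show "emits out (mult_prog (j + 2) (j + 3)) (power_tapes j w) (power_tapes (Suc j) w) [] (mult_time ?n ((?n + 2) ^ e))"
      by (blast intro: emits_mono mult_time_mono)
  qed
  show ?thesis unfolding power_prog_def
    by (rule emits_conv[OF emits_Seq[OF 1 emits_Seq[OF 2 emits_Seq[OF 3 4]]]]) (auto simp: power_time_def)
qed

text \<open>This is the carry, with the least significant digit first: leading ones become zeros and
  the first zero becomes a one. If there is no zero, \<open>drop\<close> yields the empty list and
  the one is a new digit.\<close>

lemma binary_digits_Suc:
  "binary_digits (Suc m) = replicate (length (takeWhile id (binary_digits m))) False @ True #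
     drop (Suc (length (takeWhile id (binary_digits m)))) (binary_digits m)"
proof (induction m rule: less_induct)
  case (less m)
  consider "m = 0" | "m > 0" "even m" | "odd m" by auto
  then show ?case
  proof cases
    case 1
    then show ?thesis by (simp add: binary_digits.simps)
  next
    case 2
    then show ?thesis by (simp add: binary_digits.simps[of m] binary_digits.simps[of "Suc m"])
  next
    case 3
    then have "Suc m div 2 = Suc (m div 2)" "m div 2 < m" "m \<noteq> 0" by (auto elim: oddE)
    then show ?thesis using 3 less.IH[of "m div 2"]
      by (simp add: binary_digits.simps[of m] binary_digits.simps[of "Suc m"])
  qed
qed

lemma length_binary_digits: "length (binary_digits m) \<le> m"
proof (induction m rule: less_induct)
  case (less m)
  show ?case
  proof (cases "m = 0")
    case True
    then show ?thesis by (simp add: binary_digits.simps)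
  next
    case False
    then have "length (binary_digits (m div 2)) \<le> m div 2" by (intro less) simp
    then show ?thesis using False by (simp add: binary_digits.simps[of m])
  qed
qed

definition counter_tape :: "nat \<Rightarrow> tape" where
  "counter_tape m = tp (1 # map bit_symbol (binary_digits m)) 0"

definition incr_prog :: "nat \<Rightarrow> prog" where
  "incr_prog b = Seq (Mv b Right) (Seq (While b {3} (Wr b 2 Right)) (Seq (Wr b 3 Stay) (rewind b)))"

definition incr_time :: "nat \<Rightarrow> nat" where
  "incr_time m = 1 + ((m * (1 + 1) + 1) + (1 + (2 * (m + 1) + 1) + 1) + 1) + 1"

lemma emits_incr:
  assumes b: "b \<noteq> out" and \<sigma>: "\<sigma> b = counter_tape m" and \<sigma>': "\<sigma>' = \<sigma>(b := counter_tape (Suc m))"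
  shows "emits out (incr_prog b) \<sigma> \<sigma>' [] (incr_time m)"
proof -
  define ds where "ds = binary_digits m"
  define j where "j = length (takeWhile id ds)"
  have j: "j \<le> length ds" by (simp add: j_def length_takeWhile_le)
  have ones: "ds ! i" if "i < j" for i
    using that nth_mem[of i "takeWhile id ds"] set_takeWhileD[of "takeWhile id ds ! i" id ds]
    by (auto simp: j_def takeWhile_nth)
  have stop: "\<not> ds ! j" if "j < length ds"
    using nth_length_takeWhile[of id ds] that by (simp add: j_def)
  \<comment> \<open>The tape after \<open>i\<close> carries: \<open>i\<close> zero digits have been
    written, the other digits are untouched.\<close>
  let ?xs = "\<lambda>i. 1 # replicate i 2 @ map bit_symbol (drop i ds)"
  let ?st = "\<lambda>i. \<sigma>(b := tp (?xs i) (Suc i))"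
  have 1: "emits out (Mv b Right) \<sigma> (?st 0) [] 1"
    using b \<sigma> by (intro emits_Mv[where h = 0]) (auto simp: counter_tape_def ds_def)
  have 2: "emits out (While b {3} (Wr b 2 Right)) (?st 0) (?st j) [] (j * (1 + 1) + 1)"
  proof (rule emits_While_silent[where st = ?st, OF b])
    fix i assume i: "i < j"
    then have "scan (?st i) b = bit_symbol (ds ! i)" using j by (simp add: scan_def tp_def nth_append)
    then show "scan (?st i) b \<in> {3}" using ones[OF i] by (simp add: bit_symbol_def)
    have "drop i ds = ds ! i # drop (Suc i) ds" using i j by (simp add: Cons_nth_drop_Suc)
    then have "(?xs i)[Suc i := 2] = ?xs (Suc i)"
      by (simp add: list_update_append replicate_append_same[symmetric])
    then have "act (tp (?xs i) (Suc i)) (2, Right) = tp (?xs (Suc i)) (Suc (Suc i))"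
      using act_tp[of "Suc i" "?xs i" 2 Right] i j by simp
    then show "emits out (Wr b 2 Right) (?st i) (?st (Suc i)) [] 1"
      using b by (intro emits_Wr) auto
  next
    have "scan (?st j) b = (if j < length ds then bit_symbol (ds ! j) else 0)"
      using j by (simp add: scan_def tp_def nth_append)
    then show "scan (?st j) b \<notin> {3}" using stop by (simp add: bit_symbol_def)
  qed
  have new: "binary_digits (Suc m) = replicate j False @ True # drop (Suc j) ds"
    unfolding j_def ds_def by (rule binary_digits_Suc)
  have "act (tp (?xs j) (Suc j)) (3, Stay) = tp (1 # map bit_symbol (binary_digits (Suc m))) (Suc j)"
  proof (cases "j < length ds")
    case True
    then have "drop j ds = ds ! j # drop (Suc j) ds" by (simp add: Cons_nth_drop_Suc)
    then have "(?xs j)[Suc j := 3] = 1 # map bit_symbol (binary_digits (Suc m))"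
      by (simp add: new list_update_append bit_symbol_def)
    then show ?thesis using act_tp[of "Suc j" "?xs j" 3 Stay] True by simp
  next
    case False
    then have "drop j ds = []" "drop (Suc j) ds = []" using j by auto
    then show ?thesis using act_tp_append[of "1 # replicate j 2" 3 Stay]
      by (simp add: new bit_symbol_def)
  qed
  then have 3: "emits out (Wr b 3 Stay) (?st j) (\<sigma>(b := tp (1 # map bit_symbol (binary_digits (Suc m))) (Suc j))) [] 1"
    using b by (intro emits_Wr) auto
  have 4: "emits out (rewind b) (\<sigma>(b := tp (1 # map bit_symbol (binary_digits (Suc m))) (Suc j))) \<sigma>' [] (2 * Suc j + 1)"
    using b \<sigma>' by (intro emits_rewind[where ys = "map bit_symbol (binary_digits (Suc m))"])
      (auto simp: counter_tape_def bit_symbol_def)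
  have "j \<le> m" using j length_binary_digits[of m] by (simp add: ds_def)
  then show ?thesis unfolding incr_prog_def
    by (intro emits_conv[OF emits_Seq[OF 1 emits_Seq[OF 2 emits_Seq[OF 3 4]]]]) (auto simp: incr_time_def)
qed

text \<open>The dimension has to be printed in binary, while \<open>S\<close> is available only as a
  unary tape; \<open>k\<close> increments per cell produce the digits of
  \<open>S * k\<close>.\<close>

definition count_prog :: "nat \<Rightarrow> nat \<Rightarrow> nat \<Rightarrow> prog" where
  "count_prog b u k = Seq (Mv u Right) (Seq (While u {2} (Seq (seqs (map (\<lambda>_. incr_prog b) [0..<k])) (Mv u Right))) (rewind u))"

definition count_time :: "nat \<Rightarrow> nat \<Rightarrow> nat" where
  "count_time S k = 1 + ((S * (((k * (incr_time (S * k) + 1) + 1) + 1 + 1) + 1) + 1) + (2 * (S + 1) + 1) + 1) + 1"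

lemma emits_count:
  assumes d: "b \<noteq> out" "u \<noteq> out" "b \<noteq> u" and u: "\<sigma> u = unary S 0" and b: "\<sigma> b = unary 0 0"
    and \<sigma>': "\<sigma>' = \<sigma>(b := counter_tape (S * k))"
  shows "emits out (count_prog b u k) \<sigma> \<sigma>' [] (count_time S k)"
proof -
  let ?\<rho> = "\<lambda>x j. \<sigma>(b := counter_tape x, u := unary S j)"
  have c0: "counter_tape 0 = unary 0 0" by (simp add: counter_tape_def unary_def binary_digits.simps)
  have inc: "emits out (seqs (map (\<lambda>_. incr_prog b) [0..<k])) (?\<rho> (x + 0) j) (?\<rho> (x + k) j) [] (k * (incr_time (S * k) + 1) + 1)"
    if "x + k \<le> S * k" for x j
  proof (rule emits_chain[where st = "\<lambda>i. ?\<rho> (x + i) j"])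
    fix i assume i: "i < k"
    have "emits out (incr_prog b) (?\<rho> (x + i) j) (?\<rho> (x + Suc i) j) [] (incr_time (x + i))"
      using d by (intro emits_incr) (auto simp: fun_eq_iff)
    then show "emits out (incr_prog b) (?\<rho> (x + i) j) (?\<rho> (x + Suc i) j) [] (incr_time (S * k))"
      by (rule emits_mono) (use i that in \<open>simp add: incr_time_def\<close>)
  qed
  have 1: "emits out (Mv u Right) \<sigma> (?\<rho> (0 * k) (Suc 0)) [] 1"
    using d u b c0 by (intro emits_Mv_unary[where h = 0]) (auto simp: fun_eq_iff)
  let ?body = "Seq (seqs (map (\<lambda>_. incr_prog b) [0..<k])) (Mv u Right)"
  have 2: "emits out (While u {2} ?body) (?\<rho> (0 * k) (Suc 0)) (?\<rho> (S * k) (Suc S)) []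
      (S * (((k * (incr_time (S * k) + 1) + 1) + 1 + 1) + 1) + 1)"
  proof (rule emits_While_silent[where st = "\<lambda>j. ?\<rho> (j * k) (Suc j)", OF d(2)])
    fix j assume j: "j < S"
    show "scan (?\<rho> (j * k) (Suc j)) u \<in> {2}" using j by (subst scan_unary[where x = S]) auto
    have "Suc j * k \<le> S * k" using j by (intro mult_le_mono1) simp
    then have a: "emits out (seqs (map (\<lambda>_. incr_prog b) [0..<k])) (?\<rho> (j * k) (Suc j)) (?\<rho> (j * k + k) (Suc j)) []
        (k * (incr_time (S * k) + 1) + 1)"
      using inc[of "j * k" "Suc j"] by simp
    have c: "emits out (Mv u Right) (?\<rho> (j * k + k) (Suc j)) (?\<rho> (Suc j * k) (Suc (Suc j))) [] 1"
      using d by (intro emits_Mv_unary[where h = "Suc j"]) (auto simp: fun_eq_iff add.commute)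
    show "emits out ?body (?\<rho> (j * k) (Suc j)) (?\<rho> (Suc j * k) (Suc (Suc j))) [] ((k * (incr_time (S * k) + 1) + 1) + 1 + 1)"
      using emits_Seq[OF a c] by simp
  next
    show "scan (?\<rho> (S * k) (Suc S)) u \<notin> {2}" by (subst scan_unary[where x = S]) auto
  qed
  have 3: "emits out (rewind u) (?\<rho> (S * k) (Suc S)) \<sigma>' [] (2 * Suc S + 1)"
    using d u \<sigma>' by (intro emits_rewind_unary[where x = S]) (auto simp: fun_eq_iff)
  show ?thesis unfolding count_prog_def
    by (rule emits_conv[OF emits_Seq[OF 1 emits_Seq[OF 2 3]]]) (auto simp: count_time_def)
qed

section \<open>The reduction\<close>

text \<open>Tape 0 is the input, tape 1 the binary dimension, tapes 2 to \<open>e + 2\<close> the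
  powers, the last of them being the unary \<open>S\<close>, and tape \<open>e + 3\<close> the
  output. The printing follows the order of \<open>enc_instance\<close>; in the pass over tape 1
  each digit is preceded by its list bit.\<close>

definition main_prog :: "nat \<Rightarrow> nat \<Rightarrow> nat \<Rightarrow> nat list \<Rightarrow> counter_rule list \<Rightarrow> nat \<Rightarrow> nat \<Rightarrow> prog" where
  "main_prog e k G Qs rs s0 fin = (let out = e + 3; u = e + 2 in
     Seq (Mv out Right) (Seq (power_prog e) (Seq (count_prog 1 u k)
     (Seq (full_pass out 1 [True, False] [True, True]) (Seq (emit out ([False] @ enc_list enc_nat Qs))
     (Seq (seqs (map (rule_prog out u k) rs)) (Seq (emit out ([False] @ enc_nat s0))
     (Seq (init_prog out u k G) (Seq (emit out (enc_nat fin))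
     (Seq (full_pass out u (zero_code k) (zero_code k)) (emit out [False])))))))))))"

definition main_time :: "nat \<Rightarrow> nat \<Rightarrow> nat list \<Rightarrow> counter_rule list \<Rightarrow> nat \<Rightarrow> nat \<Rightarrow> nat \<Rightarrow> nat" where
  "main_time e k Qs rs s0 fin n = (let S = (n + 2) ^ e in
     1 + (power_time e n + (count_time S k +
     (pass_time (S * k) 4 + ((2 * length ([False] @ enc_list enc_nat Qs) + 1) +
     ((sum_list (map (\<lambda>r. rule_time S k r + 1) rs) + 1) + ((2 * length ([False] @ enc_nat s0) + 1) +
     (init_time S k + ((2 * length (enc_nat fin) + 1) +
     (pass_time S (10 * k) + 3 + 1) + 1) + 1) + 1) + 1) + 1) + 1) + 1) + 1) + 1)"

lemma enc_nat_pass: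
  "concat (map (select_code [True, False] [True, True]) (map bit_symbol (binary_digits d))) @ [False] = enc_nat d"
proof -
  have "select_code [True, False] [True, True] (bit_symbol b) = [True, b]" for b
    by (simp add: select_code_def bit_symbol_def)
  then show ?thesis by (simp add: enc_nat_def enc_list_def comp_def)
qed

lemma out_tape_contents: "fst (out_tape bs) = tape_contents bs"
  unfolding out_tape_def by (rule tape_contents_tp[symmetric])

lemma runs_main:
  assumes S: "S = (length w + 2) ^ e" "length w + 2 \<le> S" and G: "symbols M = G"
    and rs: "\<And>p a c z q. (p, a, c, z, q) \<in> set rs \<Longrightarrow> a < k \<and> c < k" and k: "k > 0"
  shows "\<exists>\<sigma>. runs (main_prog e k G Qs rs s0 fin) (init_tapes w) \<sigma> (main_time e k Qs rs s0 fin (length w)) \<and>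
    fst (\<sigma> (e + 3)) = tape_contents (enc_instance (S * k) Qs (map (rule_transition S k) rs)
      (s0, block_vec S k (token (tape_word M (tape_contents w) 0)) 0) (fin, 0\<^sub>v (S * k)))"
proof -
  let ?out = "e + 3" and ?u = "e + 2"
  let ?n = "length w"
  define \<sigma> where "\<sigma> = (power_tapes e w)(1 := counter_tape (S * k))"
  have u: "\<sigma> ?u = unary S 0" by (simp add: \<sigma>_def power_tapes_def S(1))
  have 0: "\<sigma> 0 = tp (1 # map bit_symbol w) 0" by (simp add: \<sigma>_def power_tapes_def)
  have 1: "\<sigma> 1 = tp (1 # map bit_symbol (binary_digits (S * k))) 0" by (simp add: \<sigma>_def counter_tape_def)
  have "S \<ge> 1" using S(2) by simp
  have a: "emits ?out (power_prog e) (init_tapes w) (power_tapes e w) [] (power_time e ?n)"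
    by (rule emits_power) simp
  have b: "emits ?out (count_prog 1 ?u k) (power_tapes e w) \<sigma> [] (count_time S k)"
    by (rule emits_count) (auto simp: \<sigma>_def power_tapes_def S(1))
  have "set (map bit_symbol (binary_digits (S * k))) \<subseteq> {2, 3}" by (auto simp: bit_symbol_def)
  then have "emits ?out (full_pass ?out 1 [True, False] [True, True]) \<sigma> \<sigma>
      (concat (map (select_code [True, False] [True, True]) (map bit_symbol (binary_digits (S * k)))))
      (pass_time (length (map bit_symbol (binary_digits (S * k)))) (length [True, False] + length [True, True]))"
    using 1 by (intro emits_full_pass) auto
  then have c: "emits ?out (full_pass ?out 1 [True, False] [True, True]) \<sigma> \<sigma>
      (concat (map (select_code [True, False] [True, True]) (map bit_symbol (binary_digits (S * k)))))
      (pass_time (S * k) 4)"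
    by (rule emits_mono) (auto intro!: pass_time_mono length_binary_digits)
  have d: "emits ?out (seqs (map (rule_prog ?out ?u k) rs)) \<sigma> \<sigma>
      (concat (map (\<lambda>r. True # enc_transition (rule_transition S k r)) rs))
      (sum_list (map (\<lambda>r. rule_time S k r + 1) rs) + 1)"
  proof (rule emits_seqs_sum)
    fix r assume "r \<in> set rs"
    then obtain p a c z q where r: "r = (p, a, c, z, q)" "a < k" "c < k" using rs by (metis prod_cases5)
    show "emits ?out (rule_prog ?out ?u k r) \<sigma> \<sigma> (True # enc_transition (rule_transition S k r)) (rule_time S k r)"
      unfolding r(1) by (rule emits_rule) (use u r \<open>S \<ge> 1\<close> in auto)
  qed
  have f: "emits ?out (init_prog ?out ?u k G) \<sigma> \<sigma>
    (enc_vec (block_vec S k (token (tape_word M (tape_contents w) 0)) 0)) (init_time S k)"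
    by (rule emits_init) (use u 0 S(2) G k in auto)
  have g: "emits ?out (full_pass ?out ?u (zero_code k) (zero_code k)) \<sigma> \<sigma> (concat (replicate S (zero_code k)))
    (pass_time S (10 * k))"
    by (rule emits_zeros) (use u in auto)
  let ?code = "enc_instance (S * k) Qs (map (rule_transition S k) rs)
      (s0, block_vec S k (token (tape_word M (tape_contents w) 0)) 0) (fin, 0\<^sub>v (S * k))"
  let ?rest = "Seq (power_prog e) (Seq (count_prog 1 ?u k)
     (Seq (full_pass ?out 1 [True, False] [True, True]) (Seq (emit ?out ([False] @ enc_list enc_nat Qs))
     (Seq (seqs (map (rule_prog ?out ?u k) rs)) (Seq (emit ?out ([False] @ enc_nat s0))
     (Seq (init_prog ?out ?u k G) (Seq (emit ?out (enc_nat fin))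
     (Seq (full_pass ?out ?u (zero_code k) (zero_code k)) (emit ?out [False])))))))))"
  have enc: "?code = (concat (map (select_code [True, False] [True, True]) (map bit_symbol (binary_digits (S * k)))) @ [False]) @
      enc_list enc_nat Qs @ concat (map (\<lambda>r. True # enc_transition (rule_transition S k r)) rs) @ [False] @
      enc_nat s0 @ enc_vec (block_vec S k (token (tape_word M (tape_contents w) 0)) 0) @
      enc_nat fin @ concat (replicate S (zero_code k)) @ [False]"
    unfolding enc_nat_pass
    by (simp add: enc_instance_def enc_configuration_def enc_zero_vec enc_list_def[of enc_transition] comp_def)
  \<comment> \<open>The subtracted 2 accounts for the first movement and its \<open>Seq\<close>.
    That movement takes the output head from cell 0 to the place expected by
    \<open>out_tape\<close>, so it is treated outside of \<open>emits\<close>.\<close>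
  have "emits ?out ?rest (init_tapes w) \<sigma> ?code (main_time e k Qs rs s0 fin ?n - 2)"
    unfolding enc
    by (rule emits_conv[OF emits_Seq[OF a emits_Seq[OF b emits_Seq[OF c emits_Seq[OF emits_emit emits_Seq[OF d
        emits_Seq[OF emits_emit emits_Seq[OF f emits_Seq[OF emits_emit emits_Seq[OF g emits_emit]]]]]]]]]])
      (auto simp: main_time_def Let_def S(1))
  then have "runs ?rest ((init_tapes w)(?out := out_tape [])) (\<sigma>(?out := out_tape ?code)) (main_time e k Qs rs s0 fin ?n - 2)"
    unfolding emits_def by (metis append_Nil)
  moreover have "runs (Mv ?out Right) (init_tapes w) ((init_tapes w)(?out := out_tape [])) 1"
    using runs_Mv[of ?out Right "init_tapes w"]
    by (simp add: init_tapes_unary unary_def out_tape_def) (simp add: tp_def)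
  ultimately have "runs (Seq (Mv ?out Right) ?rest) (init_tapes w) (\<sigma>(?out := out_tape ?code))
      (1 + (main_time e k Qs rs s0 fin ?n - 2) + 1)"
    by (rule runs_Seq[rotated])
  then have "runs (main_prog e k G Qs rs s0 fin) (init_tapes w) (\<sigma>(?out := out_tape ?code)) (main_time e k Qs rs s0 fin ?n)"
    unfolding main_prog_def Let_def by (rule runs_mono) (simp add: main_time_def Let_def)
  moreover have "fst ((\<sigma>(?out := out_tape ?code)) ?out) = tape_contents ?code"
    by (simp only: fun_upd_same out_tape_contents)
  ultimately show ?thesis by blast
qed

lemma wf_emit: "out < K \<Longrightarrow> wf_prog K (emit out bs)"
  by (induction bs) (auto simp: bit_symbol_def)

lemma wf_seqs: "wf_prog K (seqs ps) \<longleftrightarrow> (\<forall>p \<in> set ps. wf_prog K p)"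
  by (induction ps) (auto simp: seqs_def)

lemma wf_main: "wf_prog (e + 4) (main_prog e k G Qs rs s0 fin)"
proof -
  have "wf_prog (e + 4) (power_prog e)"
    by (auto simp: power_prog_def wf_seqs mult_prog_def rewind_def)
  moreover have "wf_prog (e + 4) (rule_prog (e + 3) (e + 2) k r)" for r
    by (auto simp: rule_prog_def mat_prog_def row_prog_def last_row_prog_def wf_emit wf_seqs rewind_def
        full_pass_def tail_pass_def pass_def bit_symbol_def split: prod.split)
  ultimately show ?thesis
    by (auto simp: main_prog_def Let_def wf_emit wf_seqs count_prog_def incr_prog_def init_prog_def rewind_def
        full_pass_def pass_def bit_symbol_def)
qed

section \<open>Polynomial time bounds\<close>

definition poly_bounded :: "(nat \<Rightarrow> nat) \<Rightarrow> bool" where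
  "poly_bounded g \<longleftrightarrow> (\<exists>p :: nat poly. \<forall>n. g n \<le> poly p n)"

lemma poly_bounded_const: "poly_bounded (\<lambda>_. c)"
  unfolding poly_bounded_def by (rule exI[of _ "[:c:]"]) simp

lemma poly_bounded_id: "poly_bounded (\<lambda>n. n)"
  unfolding poly_bounded_def by (rule exI[of _ "[:0, 1:]"]) simp

lemma poly_bounded_add: "poly_bounded f \<Longrightarrow> poly_bounded g \<Longrightarrow> poly_bounded (\<lambda>n. f n + g n)"
  unfolding poly_bounded_def by (metis add_mono poly_add)

lemma poly_bounded_mult: "poly_bounded f \<Longrightarrow> poly_bounded g \<Longrightarrow> poly_bounded (\<lambda>n. f n * g n)"
  unfolding poly_bounded_def by (metis mult_le_mono poly_mult)

lemma poly_bounded_power: "poly_bounded f \<Longrightarrow> poly_bounded (\<lambda>n. f n ^ e)"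
  by (induction e) (auto intro: poly_bounded_const poly_bounded_mult)

lemma poly_bounded_sum_list:
  "(\<And>x. x \<in> set xs \<Longrightarrow> poly_bounded (t x)) \<Longrightarrow> poly_bounded (\<lambda>n. sum_list (map (\<lambda>x. t x n) xs))"
  by (induction xs) (auto intro: poly_bounded_const poly_bounded_add)

lemmas poly_bounded_intros =
  poly_bounded_add poly_bounded_mult poly_bounded_power poly_bounded_id poly_bounded_const

lemma poly_bounded_pass_time: "poly_bounded f \<Longrightarrow> poly_bounded (\<lambda>n. pass_time (f n) l)"
  unfolding pass_time_def by (intro poly_bounded_intros)

lemma poly_bounded_mult_time: "poly_bounded f \<Longrightarrow> poly_bounded (\<lambda>n. mult_time n (f n))"
  unfolding mult_time_def by (intro poly_bounded_intros)

lemma poly_bounded_count_time: "poly_bounded f \<Longrightarrow> poly_bounded (\<lambda>n. count_time (f n) k)"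
  unfolding count_time_def incr_time_def by (intro poly_bounded_intros)

lemma poly_bounded_init_time: "poly_bounded f \<Longrightarrow> poly_bounded (\<lambda>n. init_time (f n) k)"
  unfolding init_time_def by (intro poly_bounded_intros)

lemma poly_bounded_mat_time: "poly_bounded f \<Longrightarrow> poly_bounded (\<lambda>n. mat_time (f n) k)"
  unfolding mat_time_def mat_body_time_def row_time_def last_row_time_def
  by (intro poly_bounded_intros poly_bounded_pass_time)

lemma poly_bounded_rule_time: "poly_bounded f \<Longrightarrow> poly_bounded (\<lambda>n. rule_time (f n) k r)"
  unfolding rule_time_def case_prod_unfold
  by (intro poly_bounded_intros poly_bounded_pass_time poly_bounded_mat_time)

lemma poly_bounded_main_time: "poly_bounded (main_time e k Qs rs s0 fin)"
proof -
  have S: "poly_bounded (\<lambda>n. (n + 2) ^ e)" by (intro poly_bounded_intros)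
  show ?thesis
    unfolding main_time_def Let_def power_time_def
    by (intro poly_bounded_add poly_bounded_mult poly_bounded_const poly_bounded_sum_list poly_bounded_pass_time
        poly_bounded_mult_time poly_bounded_count_time poly_bounded_init_time poly_bounded_rule_time S)
qed

text \<open>The base \<open>n + 2\<close> is at least 2 and exceeds \<open>n\<close>: a coefficient
  \<open>a\<close> is absorbed by \<open>2 ^ a\<close>, a factor \<open>n\<close> by one more power,
  and the sum of two terms by another.\<close>

lemma poly_le_power: "\<exists>e. \<forall>n. poly (p :: nat poly) n \<le> (n + 2) ^ e"
proof (induction p)
  case 0
  then show ?case by simp
next
  case (pCons a p)
  then obtain e where e: "\<And>n. poly p n \<le> (n + 2) ^ e" by blast
  have "poly (pCons a p) n \<le> (n + 2) ^ (a + Suc e + 1)" for n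
  proof -
    have "a \<le> 2 ^ a" by (simp add: less_imp_le)
    also have "\<dots> \<le> (n + 2) ^ a" by (intro power_mono) auto
    also have "\<dots> \<le> (n + 2) ^ (a + Suc e)" by (intro power_increasing) auto
    finally have "a \<le> (n + 2) ^ (a + Suc e)" .
    moreover have "n * poly p n \<le> (n + 2) ^ (a + Suc e)"
    proof -
      have "n * poly p n \<le> (n + 2) * (n + 2) ^ e" by (intro mult_le_mono e) simp
      also have "\<dots> = (n + 2) ^ Suc e" by simp
      also have "\<dots> \<le> (n + 2) ^ (a + Suc e)" by (intro power_increasing) auto
      finally show ?thesis .
    qed
    ultimately have "poly (pCons a p) n \<le> 2 * (n + 2) ^ (a + Suc e)" by simp
    also have "\<dots> \<le> (n + 2) * (n + 2) ^ (a + Suc e)" by (rule mult_le_mono1) simp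
    also have "\<dots> = (n + 2) ^ (a + Suc e + 1)" by simp
    finally show ?thesis .
  qed
  then show ?case by blast
qed

text \<open>The constructors with an argument are separated modulo 4; the code 1 is left free for
  the final state of the counters.\<close>

fun control_code :: "control \<Rightarrow> nat" where
  "control_code Clean = 0"
| "control_code (Sweep q) = 4 * q + 2"
| "control_code (FromLeft q) = 4 * q + 3"
| "control_code (ToLeft q) = 4 * q + 4"
| "control_code (AtStart q) = 4 * q + 5"

lemma inj_control_code: "inj control_code"
proof (rule injI)
  fix x y assume "control_code x = control_code y"
  then show "x = y" by (cases x; cases y; simp; presburger)
qed

lemma one_notin_control_code: "1 \<notin> range control_code"
proof
  assume "1 \<in> range control_code"
  then obtain x where "1 = control_code x" by blast
  then show False by (cases x) auto
qed

section \<open>Correctness of the reduction\<close>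

context one_tape_machine
begin

lemma halted_run: "halted M (tm_run M w t) \<Longrightarrow> tm_run M w (t + j) = tm_run M w t"
  by (induction j) (simp_all add: tm_run_def tm_step_def)

text \<open>Halted configurations persist, so a run cannot both accept and reject; hence the
  accepting state at any time already decides membership.\<close>

lemma accept_iff:
  assumes dec: "decides_in_space M L s"
  shows "w \<in> L \<longleftrightarrow> (\<exists>f i. reachable M w (accept M) f i)"
proof
  assume "w \<in> L"
  then obtain t where "fst (tm_run M w t) = accept M" using dec unfolding decides_in_space_def by metis
  moreover obtain q f i where "tm_run M w t = (q, [(f, i)])" using run_shape by blast
  ultimately show "\<exists>f i. reachable M w (accept M) f i" unfolding reachable_def by auto
next
  assume "\<exists>f i. reachable M w (accept M) f i"
  then obtain f i t where "tm_run M w t = (accept M, [(f, i)])" unfolding reachable_def by blast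
  then have t: "fst (tm_run M w t) = accept M" by simp
  show "w \<in> L"
  proof (rule ccontr)
    assume "w \<notin> L"
    then obtain t' where t': "fst (tm_run M w t') = reject M" using dec unfolding decides_in_space_def by metis
    \<comment> \<open>Both halted configurations persist until the common time
      \<open>t + t'\<close>, where they have to coincide.\<close>
    have "tm_run M w (t + t') = tm_run M w t" "tm_run M w (t' + t) = tm_run M w t'"
      using t t' by (intro halted_run; simp add: halted_def)+
    then have "accept M = reject M" using t t' by (simp add: add.commute)
    then show False using M by (simp add: turing_machine_def)
  qed
qed

lemma reduction:
  assumes dec: "decides_in_space M L (poly p)"
  shows "polynomial_time_reducible L permutation_zvass_reachability"
proof -
  let ?G = "symbols M"
  let ?k = "2 * ?G + 1"
  let ?R = "sweep_rules M"
  \<comment> \<open>The summand \<open>[:2, 1:]\<close> is n + 2: with this exponent,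
    \<open>S\<close> both exceeds the space bound and has room for the separator, cell 0 and the
    input.\<close>
  obtain e where e: "\<And>n. poly (p + [:2, 1:]) n \<le> (n + 2) ^ e" using poly_le_power by blast
  define S where "S = (\<lambda>w :: bool list. (length w + 2) ^ e)"
  have S_ge: "length w + 2 \<le> S w" and S_gt: "poly p (length w) < S w" for w
    using e[of "length w"] unfolding S_def by simp_all
  let ?Z = "simulation_rules control_code ?R Clean 1"
  have finZ: "finite ?Z" using finite_sweep_rules by (simp add: simulation_rules_def)
  then obtain rs where rs: "set rs = ?Z" using finite_list by blast
  define Q where "Q = insert 1 (control_code ` controls)"
  have finQ: "finite Q" by (simp add: Q_def controls_def)
  then obtain Qs where Qs: "set Qs = Q" using finite_list by blast
  have rule_bounds: "a < ?k \<and> c < ?k" "control_code q \<in> Q \<and> control_code q' \<in> Q"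
    if "(q, a, c, q') \<in> ?R" for q a c q'
    using that sweep_rules_subset by (auto simp: Q_def)
  have Qbase: "control_code Clean \<in> Q" "1 \<in> Q" "control_code (Sweep (start M)) \<in> Q"
  proof -
    have "Clean \<in> controls" "Sweep (start M) \<in> controls"
      using M by (auto simp: controls_def turing_machine_def)
    then show "control_code Clean \<in> Q" "1 \<in> Q" "control_code (Sweep (start M)) \<in> Q"
      unfolding Q_def by blast+
  qed
  define u0 where "u0 = (\<lambda>w. block_vec (S w) ?k (token (tape_word M (tape_contents w) 0)) 0)"
  define s0 where "s0 = control_code (Sweep (start M))"
  define f where "f = (\<lambda>w. enc_instance (S w * ?k) Qs (map (rule_transition (S w) ?k) rs) (s0, u0 w) (1, 0\<^sub>v (S w * ?k)))"
  have "polynomial_time_computable f"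
  proof -
    have rsk: "a < ?k \<and> c < ?k" if "(p, a, c, z, q) \<in> set rs" for p a c z q
      using that rule_bounds(1) unfolding rs simulation_rules_def by auto
    obtain P :: "nat poly" where P: "\<And>n. main_time e ?k Qs rs s0 1 n \<le> poly P n"
      using poly_bounded_main_time[of e ?k Qs rs s0 1] unfolding poly_bounded_def by blast
    have "\<exists>N. turing_machine N \<and> computes_in_time N f (poly P)"
    proof (rule computable_by_prog[OF _ wf_main])
      fix w
      have "\<exists>\<sigma>. runs (main_prog e ?k ?G Qs rs s0 1) (init_tapes w) \<sigma> (main_time e ?k Qs rs s0 1 (length w)) \<and>
          fst (\<sigma> (e + 3)) = tape_contents (f w)"
        unfolding f_def u0_def by (rule runs_main) (use S_ge[of w] rsk in \<open>auto simp: S_def\<close>)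
      moreover have "e + 4 - 1 = e + 3" by simp
      ultimately show "\<exists>\<sigma>. runs (main_prog e ?k ?G Qs rs s0 1) (init_tapes w) \<sigma> (poly P (length w)) \<and>
          fst (\<sigma> (e + 4 - 1)) = tape_contents (f w)"
        using runs_mono[OF _ P] by metis
    qed simp
    then show ?thesis unfolding polynomial_time_computable_def by blast
  qed
  moreover have "w \<in> L \<longleftrightarrow> f w \<in> permutation_zvass_reachability" for w
  proof -
    let ?S = "S w"
    let ?V = "(?S * ?k, set Qs, set (map (rule_transition ?S ?k) rs))"
    have space: "i + 1 < ?S" if r: "reachable M w q g i" for q g i
    proof -
      obtain t where "tm_run M w t = (q, [(g, i)])" using r unfolding reachable_def by blast
      moreover have "\<forall>(f, i) \<in> set (snd (tm_run M w t)). i < poly p (length w)"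
        using dec unfolding decides_in_space_def by blast
      ultimately show ?thesis using S_gt[of w] by simp
    qed
    have S1: "?S \<ge> 1" using S_ge[of w] by simp
    interpret simulation control_code ?R Clean 1 ?S ?k
      using inj_control_code one_notin_control_code S1 rule_bounds(1) by unfold_locales auto
    have rv: "valid_rules ?k (set Qs) (set rs)"
      using Qbase unfolding rs Qs valid_rules_def simulation_rules_def by (auto dest: rule_bounds)
    then have perm: "permutation_zvass ?V"
      using permutation_zvass_rules[OF rv, of ?S] S1 by simp
    have X0: "tape_word M (tape_contents w) 0 x < ?k" for x
      using tape_word_le[OF reachable_initial, of w x] by simp
    have "((s0, u0 w), (1, 0\<^sub>v (?S * ?k))) \<in> (step_rel ?V)\<^sup>* \<longleftrightarrow> cleaned (Sweep (start M)) (tape_word M (tape_contents w) 0)"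
      using simulation_correct[of Q "tape_word M (tape_contents w) 0" "Sweep (start M)"] rule_bounds(2) Qbase X0
      unfolding s0_def u0_def by (simp add: Qs rs)
    also have "\<dots> \<longleftrightarrow> (\<exists>f i. reachable M w (accept M) f i)"
    proof -
      have "\<exists>f i. reachable M w (accept M) f i" if "(sweep_init w, (Clean, X, m)) \<in> (sweep ?R ?S)\<^sup>*" for X m
        by (rule sweep_sound[OF space that])
      moreover have "\<exists>X m. (sweep_init w, (Clean, X, m)) \<in> (sweep ?R ?S)\<^sup>* \<and> (\<forall>x < ?S. X x = 0)"
        if "reachable M w (accept M) g i" for g i
        by (rule sweep_complete[OF space that])
      ultimately show ?thesis unfolding cleaned_def sweep_init_def by blast
    qed
    also have "\<dots> \<longleftrightarrow> w \<in> L" using accept_iff[OF dec] by simp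
    finally have *: "((s0, u0 w), (1, 0\<^sub>v (?S * ?k))) \<in> (step_rel ?V)\<^sup>* \<longleftrightarrow> w \<in> L" .
    show ?thesis
    proof
      assume "w \<in> L"
      moreover have "(s0, u0 w) \<in> configurations ?V" "(1, 0\<^sub>v (?S * ?k)) \<in> configurations ?V"
        using Qbase by (auto simp: configurations_def s0_def u0_def block_vec_def Qs)
      ultimately show "f w \<in> permutation_zvass_reachability"
        using * perm unfolding permutation_zvass_reachability_def f_def by blast
    next
      assume "f w \<in> permutation_zvass_reachability"
      \<comment> \<open>The code might stem from a different instance; unique readability for affine
        instances shows that it is the same one.\<close>
      then obtain d Qs' Ts c c' where eq: "f w = enc_instance d Qs' Ts c c'"
        and inst: "permutation_zvass (d, set Qs', set Ts)" "(c, c') \<in> (step_rel (d, set Qs', set Ts))\<^sup>*"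
        unfolding permutation_zvass_reachability_def by blast
      have "affine_zvass ?V" "affine_zvass (d, set Qs', set Ts)"
        using perm inst(1) unfolding permutation_zvass_def by blast+
      from enc_instance_inj[OF this eq[unfolded f_def]] inst(2) * show "w \<in> L" by blast
    qed
  qed
  ultimately show ?thesis unfolding polynomial_time_reducible_def by blast
qed

end

theorem theorem6p1:
  shows "PSPACE_hard permutation_zvass_reachability"
  unfolding PSPACE_hard_def
proof
  fix L assume "L \<in> PSPACE"
  then obtain M and p :: "nat poly" where tm: "turing_machine M" "tapes M = 1" "decides_in_space M L (poly p)"
    unfolding PSPACE_def by blast
  interpret one_tape_machine M using tm by unfold_locales
  show "polynomial_time_reducible L permutation_zvass_reachability" by (rule reduction[OF tm(3)])
qed

end
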